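(* Let $n\ge3$ and let $e\in\mathbb{R}^{p+2}$ be a unit vector. There are no complete $(n-2)$-singular minimal surfaces $g\colon L^2\to\mathbb{R}^{p+2}$ with density vector $e$ and with Gaussian curvature bounded from below that are contained between two hyperplanes perpendicular to the density vector $e$.
   Context: An isometric immersion $g\colon L^2\to\mathbb{R}^{p+2}$ of a two-dimensional Riemannian manifold is an $(n-2)$-singular minimal surface with density vector $e$ (a unit vector) if $\phi=\langle g,e\rangle>0$ and its mean curvature vector field (half the trace of the second fundamental form) satisfies $2\mathcal{H}_g=\frac{n-2}{\phi}e^\perp$, where $e^\perp$ is the orthogonal projection of $e$ onto the normal bundle of $g$. Complete means that $L^2$ with the metric induced by $g$ from the Euclidean metric is a complete Riemannian manifold; the Gaussian curvature is that of this metric. *)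

theory Defs
  imports "HOL-Analysis.Analysis"
begin

section \<open>Smooth maps between Euclidean spaces\<close>

primrec times_differentiable_on ::
    "nat \<Rightarrow> ('a::euclidean_space \<Rightarrow> 'b::euclidean_space) \<Rightarrow> 'a set \<Rightarrow> bool" where
  "times_differentiable_on 0 f S \<longleftrightarrow> continuous_on S f"
| "times_differentiable_on (Suc k) f S \<longleftrightarrow>
     (\<forall>u\<in>S. f differentiable (at u)) \<and>
     (\<forall>v. times_differentiable_on k (\<lambda>u. frechet_derivative f (at u) v) S)"

text \<open>Used for open \<open>S\<close> only; the derivatives above are two-sided.\<close>

definition smooth_map_on :: "('a::euclidean_space \<Rightarrow> 'b::euclidean_space) \<Rightarrow> 'a set \<Rightarrow> bool" where
  "smooth_map_on f S \<longleftrightarrow> (\<forall>k. times_differentiable_on k f S)"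

definition pdiff :: "2 \<Rightarrow> (real^2 \<Rightarrow> 'b::euclidean_space) \<Rightarrow> real^2 \<Rightarrow> 'b" where
  "pdiff i f u = frechet_derivative f (at u) (axis i 1)"


section \<open>Smooth two-dimensional manifolds\<close>

text \<open>A chart is a pair \<open>(U, x)\<close> of its domain and its coordinate map. Atlases are not required
  to be maximal; none of the notions below depends on the choice of the atlas within a smooth
  structure.\<close>

type_synonym 'a chart = "'a set \<times> ('a \<Rightarrow> real^2)"

definition smooth_atlas :: "'a topology \<Rightarrow> 'a chart set \<Rightarrow> bool" where
  "smooth_atlas L A \<longleftrightarrow>
     (\<forall>(U, x)\<in>A. openin L U \<and> open (x ` U) \<and>
        homeomorphic_map (subtopology L U) (top_of_set (x ` U)) x) \<and>
     topspace L = (\<Union>(U, x)\<in>A. U) \<and>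
     (\<forall>(U, x)\<in>A. \<forall>(V, y)\<in>A. smooth_map_on (y \<circ> inv_into U x) (x ` (U \<inter> V)))"

definition smooth_surface :: "'a topology \<Rightarrow> 'a chart set \<Rightarrow> bool" where
  "smooth_surface L A \<longleftrightarrow>
     topspace L \<noteq> {} \<and> connected_space L \<and> Hausdorff_space L \<and> second_countable L \<and>
     smooth_atlas L A"


section \<open>Immersions\<close>

definition local_rep :: "('a \<Rightarrow> 'b) \<Rightarrow> 'a chart \<Rightarrow> real^2 \<Rightarrow> 'b" where
  "local_rep g ch = g \<circ> inv_into (fst ch) (snd ch)"

definition immersion :: "'a chart set \<Rightarrow> ('a \<Rightarrow> 'b::euclidean_space) \<Rightarrow> bool" where
  "immersion A g \<longleftrightarrow>
     (\<forall>(U, x)\<in>A. smooth_map_on (local_rep g (U, x)) (x ` U) \<and>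
        (\<forall>u\<in>x ` U. inj (frechet_derivative (local_rep g (U, x)) (at u))))"

text \<open>The surface always carries the metric induced by the immersion, so that the immersion is
  isometric. In a chart, with \<open>f = local_rep g (U, x)\<close>, its components are the following.\<close>

definition induced_metric :: "(real^2 \<Rightarrow> 'b::euclidean_space) \<Rightarrow> real^2 \<Rightarrow> real^2^2" where
  "induced_metric f u = (\<chi> i j. pdiff i f u \<bullet> pdiff j f u)"


section \<open>Gaussian curvature of a metric in coordinates\<close>

text \<open>\<open>christoffel h k i j\<close> is the symbol with upper index \<open>k\<close> and lower indices \<open>i, j\<close>, and
  \<open>riemann h l i j k\<close> is the component along the \<open>l\<close>-th coordinate field of
  \<open>R(X\<^sub>i, X\<^sub>j) X\<^sub>k\<close>, where \<open>R(X, Y) Z = \<nabla>\<^sub>X \<nabla>\<^sub>Y Z - \<nabla>\<^sub>Y \<nabla>\<^sub>X Z\<close> for coordinate fields. The Gaussian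
  curvature is \<open>\<langle>R(X\<^sub>1, X\<^sub>2) X\<^sub>2, X\<^sub>1\<rangle> / det h\<close>, which is positive on round spheres.\<close>

definition christoffel :: "(real^2 \<Rightarrow> real^2^2) \<Rightarrow> 2 \<Rightarrow> 2 \<Rightarrow> 2 \<Rightarrow> real^2 \<Rightarrow> real" where
  "christoffel h k i j u =
     (1/2) * (\<Sum>l\<in>UNIV. matrix_inv (h u) $ k $ l *
        (pdiff i (\<lambda>v. h v $ j $ l) u + pdiff j (\<lambda>v. h v $ i $ l) u - pdiff l (\<lambda>v. h v $ i $ j) u))"

definition riemann :: "(real^2 \<Rightarrow> real^2^2) \<Rightarrow> 2 \<Rightarrow> 2 \<Rightarrow> 2 \<Rightarrow> 2 \<Rightarrow> real^2 \<Rightarrow> real" where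
  "riemann h l i j k u =
     pdiff i (christoffel h l j k) u - pdiff j (christoffel h l i k) u +
     (\<Sum>m\<in>UNIV. christoffel h m j k u * christoffel h l i m u -
                christoffel h m i k u * christoffel h l j m u)"

definition gaussian_curvature :: "(real^2 \<Rightarrow> real^2^2) \<Rightarrow> real^2 \<Rightarrow> real" where
  "gaussian_curvature h u = (\<Sum>l\<in>UNIV. riemann h l 1 2 2 u * h u $ l $ 1) / det (h u)"

definition curvature_bounded_below :: "'a chart set \<Rightarrow> ('a \<Rightarrow> 'b::euclidean_space) \<Rightarrow> bool" where
  "curvature_bounded_below A g \<longleftrightarrow>
     (\<exists>\<kappa>. \<forall>(U, x)\<in>A. \<forall>u\<in>x ` U.
        \<kappa> \<le> gaussian_curvature (induced_metric (local_rep g (U, x))) u)"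


section \<open>Mean curvature and singular minimal surfaces\<close>

definition tangent_plane :: "(real^2 \<Rightarrow> 'b::euclidean_space) \<Rightarrow> real^2 \<Rightarrow> 'b set" where
  "tangent_plane f u = range (frechet_derivative f (at u))"

definition normal_part :: "(real^2 \<Rightarrow> 'b::euclidean_space) \<Rightarrow> real^2 \<Rightarrow> 'b \<Rightarrow> 'b" where
  "normal_part f u v =
     (THE w. v - w \<in> tangent_plane f u \<and> w \<in> orthogonal_comp (tangent_plane f u))"

definition second_fundamental_form ::
    "(real^2 \<Rightarrow> 'b::euclidean_space) \<Rightarrow> 2 \<Rightarrow> 2 \<Rightarrow> real^2 \<Rightarrow> 'b" where
  "second_fundamental_form f i j u = normal_part f u (pdiff i (pdiff j f) u)"

text \<open>The trace is taken with respect to the induced metric.\<close>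

definition mean_curvature :: "(real^2 \<Rightarrow> 'b::euclidean_space) \<Rightarrow> real^2 \<Rightarrow> 'b" where
  "mean_curvature f u =
     (1/2) *\<^sub>R (\<Sum>i\<in>UNIV. \<Sum>j\<in>UNIV.
        (matrix_inv (induced_metric f u) $ i $ j) *\<^sub>R second_fundamental_form f i j u)"

definition singular_minimal_surface ::
    "real \<Rightarrow> 'b::euclidean_space \<Rightarrow> 'a topology \<Rightarrow> 'a chart set \<Rightarrow> ('a \<Rightarrow> 'b) \<Rightarrow> bool" where
  "singular_minimal_surface \<alpha> e L A g \<longleftrightarrow>
     smooth_surface L A \<and> immersion A g \<and>
     (\<forall>q\<in>topspace L. g q \<bullet> e > 0) \<and>
     (\<forall>(U, x)\<in>A. \<forall>u\<in>x ` U.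
        2 *\<^sub>R mean_curvature (local_rep g (U, x)) u =
          (\<alpha> / (local_rep g (U, x) u \<bullet> e)) *\<^sub>R normal_part (local_rep g (U, x)) u e)"


section \<open>Completeness of the induced metric\<close>

definition piecewise_C1_curve :: "'a topology \<Rightarrow> 'a chart set \<Rightarrow> (real \<Rightarrow> 'a) \<Rightarrow> bool" where
  "piecewise_C1_curve L A c \<longleftrightarrow>
     continuous_map (top_of_set {0..1}) L c \<and>
     (\<forall>(U, x)\<in>A. \<forall>a b. {a..b} \<subseteq> {0..1} \<and> c ` {a..b} \<subseteq> U \<longrightarrow>
        (x \<circ> c) piecewise_C1_differentiable_on {a..b})"

text \<open>The speed of \<open>c\<close> in the induced metric is the norm of \<open>(g \<circ> c)'\<close>. Since
  \<open>piecewise_C1_differentiable_on\<close> does not bound the derivative near the break points, curves of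
  infinite length have to be excluded explicitly: \<open>integral\<close> would assign them the value 0.\<close>

definition curve_lengths ::
    "'a topology \<Rightarrow> 'a chart set \<Rightarrow> ('a \<Rightarrow> 'b::euclidean_space) \<Rightarrow> 'a \<Rightarrow> 'a \<Rightarrow> real set" where
  "curve_lengths L A g q r =
     {integral {0..1} (\<lambda>t. norm (vector_derivative (g \<circ> c) (at t))) | c.
        piecewise_C1_curve L A c \<and> c 0 = q \<and> c 1 = r \<and>
        (\<lambda>t. norm (vector_derivative (g \<circ> c) (at t))) integrable_on {0..1}}"

definition induced_dist ::
    "'a topology \<Rightarrow> 'a chart set \<Rightarrow> ('a \<Rightarrow> 'b::euclidean_space) \<Rightarrow> 'a \<Rightarrow> 'a \<Rightarrow> real" where
  "induced_dist L A g q r = Inf (curve_lengths L A g q r)"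

text \<open>This is \<open>Metric_space.mcomplete\<close> for \<open>induced_dist\<close>, written out, because the
  defining equation of that constant is only available once the metric axioms have been proved.\<close>

definition complete_surface ::
    "'a topology \<Rightarrow> 'a chart set \<Rightarrow> ('a \<Rightarrow> 'b::euclidean_space) \<Rightarrow> bool" where
  "complete_surface L A g \<longleftrightarrow>
     (\<forall>\<sigma>::nat \<Rightarrow> 'a. range \<sigma> \<subseteq> topspace L \<and>
        (\<forall>\<epsilon>>0. \<exists>N. \<forall>m\<ge>N. \<forall>n\<ge>N. induced_dist L A g (\<sigma> m) (\<sigma> n) < \<epsilon>) \<longrightarrow>
        (\<exists>q\<in>topspace L. (\<lambda>n. induced_dist L A g (\<sigma> n) q) \<longlonglongrightarrow> 0))"


section \<open>Slabs\<close>

definition between_hyperplanes_perpendicular_to ::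
    "'b::euclidean_space \<Rightarrow> 'b set \<Rightarrow> bool" where
  "between_hyperplanes_perpendicular_to e S \<longleftrightarrow>
     (\<exists>a b. S \<subseteq> {y. a \<le> y \<bullet> e \<and> y \<bullet> e \<le> b})"

end

theory Submission
  imports Defs
begin

text \<open>Put \<open>\<phi> = \<langle>g, e\<rangle>\<close> and \<open>M = sup \<phi>\<close>. The Laplacian of \<open>\<phi>\<close> is \<open>(n - 2) (1 - \<bar>\<nabla>\<phi>\<bar>\<^sup>2) / \<phi>\<close>, which cannot be
  small where \<open>\<phi>\<close> is bounded and \<open>\<nabla>\<phi>\<close> is small. Instead of the Omori--Yau maximum principle a
  local argument is used. By the Gauss equation \<open>\<bar>A\<bar>\<^sup>2 = \<bar>2H\<bar>\<^sup>2 - 2K\<close>, so where \<open>\<phi> \<ge> M/2\<close> the lower bound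
  on the curvature and the equation for \<open>H\<close> bound the second fundamental form. Hence near every
  point \<open>q\<close> with \<open>\<phi>(q)\<close> close to \<open>M\<close> the surface is, by completeness, a graph over a disc in the
  tangent plane at \<open>q\<close> whose radius \<open>r\<close> does not depend on \<open>q\<close>. If \<open>M - \<phi>(q)\<close> is small compared
  with \<open>\<theta> r\<^sup>2\<close>, then \<open>\<phi> - \<theta> \<bar>g - g(q)\<bar>\<^sup>2\<close> has an interior maximum on this compact graph, and there
  both the gradient and the Laplacian of \<open>\<phi>\<close> are of order \<open>\<theta>\<close>.\<close>

section \<open>Calculus in the plane\<close>

text \<open>The supremum M need not be attained, so a compact piece of surface is needed on whose
  rim a penalty outweighs the missing height M - phi(q). The image of a closed disc of radius d
  under a graph map is such a piece: projection does not increase lengths, so a point over the rim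
  has distance at least d from g(q) and pays at least theta d^2. No geodesics enter, and the penalty
  is the extrinsic distance, which is smooth and whose second derivatives are explicit. The point q
  is chosen after theta and d, which is why the radius of the graph must not depend on q.

  The graph is obtained by continuation along rays. Call c the slope bound if |tau| is at most c
  times the length of the projection of tau for all tangent vectors tau. A graph is required to have
  slope bound 2; integrating the second fundamental form from the centre, where the bound is 1,
  improves this to 3/2. The bound 3/2 survives limits, and its distance from 2 leaves room to extend
  the graph past a limit point.\<close>

lemma smooth_map_on_differentiable:
  "smooth_map_on f S \<Longrightarrow> u \<in> S \<Longrightarrow> f differentiable (at u)"
  unfolding smooth_map_on_def by (drule spec[of _ 1]) simp

lemma smooth_map_on_continuous_on: "smooth_map_on f S \<Longrightarrow> continuous_on S f"
  unfolding smooth_map_on_def by (drule spec[of _ 0]) simp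

lemma smooth_map_on_pdiff: "smooth_map_on f S \<Longrightarrow> smooth_map_on (pdiff i f) S"
  unfolding smooth_map_on_def pdiff_def
  by (rule allI, drule_tac x = "Suc k" in spec) simp

lemma has_derivative_pdiff:
  fixes f :: "real^2 \<Rightarrow> 'b::euclidean_space"
  assumes "f differentiable (at u)"
  shows "(f has_derivative (\<lambda>w. w$1 *\<^sub>R pdiff 1 f u + w$2 *\<^sub>R pdiff 2 f u)) (at u)"
proof -
  let ?D = "frechet_derivative f (at u)"
  have D: "(f has_derivative ?D) (at u)"
    using assms frechet_derivative_works by blast
  then have lin: "linear ?D"
    by (rule has_derivative_linear)
  have "?D w = w$1 *\<^sub>R pdiff 1 f u + w$2 *\<^sub>R pdiff 2 f u" for w
  proof -
    have "w = w$1 *\<^sub>R axis 1 1 + w$2 *\<^sub>R axis 2 1"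
      by (simp add: vec_eq_iff forall_2 axis_def)
    then have "?D w = ?D (w$1 *\<^sub>R axis 1 1 + w$2 *\<^sub>R axis 2 1)"
      by simp
    then show ?thesis
      by (simp only: linear_add[OF lin] linear_scale[OF lin] pdiff_def)
  qed
  then have "?D = (\<lambda>w. w$1 *\<^sub>R pdiff 1 f u + w$2 *\<^sub>R pdiff 2 f u)"
    by (rule ext)
  then show ?thesis
    using D by simp
qed

lemma frechet_derivative_pdiff:
  fixes f :: "real^2 \<Rightarrow> 'b::euclidean_space"
  assumes "f differentiable (at u)"
  shows "frechet_derivative f (at u) = (\<lambda>w. w$1 *\<^sub>R pdiff 1 f u + w$2 *\<^sub>R pdiff 2 f u)"
  using frechet_derivative_at[OF has_derivative_pdiff[OF assms]] by simp

lemma pdiff_eqI: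
  assumes "(f has_derivative D) (at u)"
  shows "pdiff i f u = D (axis i 1)"
  using frechet_derivative_at[OF assms] by (simp add: pdiff_def)

text \<open>\<open>frechet_derivative\<close> is a choice from the set of all derivatives. Two
  functions that agree near \<open>u\<close> have the same such set, hence the same value, whether
  or not they are differentiable.\<close>

lemma pdiff_cong:
  assumes "open S" "u \<in> S" "\<And>v. v \<in> S \<Longrightarrow> f v = g v"
  shows "pdiff i f u = pdiff i g u"
proof -
  have "(f has_derivative D) (at u) \<longleftrightarrow> (g has_derivative D) (at u)" for D
    using has_derivative_transform_within_open[OF _ assms(1,2)] assms(3) by metis
  then show ?thesis
    by (simp add: pdiff_def frechet_derivative_def)
qed

lemma pdiff_inner:
  fixes f g :: "real^2 \<Rightarrow> 'b::euclidean_space"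
  assumes "f differentiable (at u)" "g differentiable (at u)"
  shows "pdiff i (\<lambda>v. f v \<bullet> g v) u = pdiff i f u \<bullet> g u + f u \<bullet> pdiff i g u"
proof -
  have f: "(f has_derivative frechet_derivative f (at u)) (at u)"
    and g: "(g has_derivative frechet_derivative g (at u)) (at u)"
    using assms frechet_derivative_works by blast+
  show ?thesis
    using pdiff_eqI[OF has_derivative_inner[OF f g], of i] by (simp add: pdiff_def)
qed

section \<open>Symmetry of second partial derivatives\<close>

lemma has_real_derivative_along_axis:
  fixes F :: "real^2 \<Rightarrow> real"
  assumes "F differentiable (at (u + x *\<^sub>R axis i 1))"
  shows "((\<lambda>x. F (u + x *\<^sub>R axis i 1)) has_real_derivative pdiff i F (u + x *\<^sub>R axis i 1)) (at x)"
proof -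
  let ?D = "frechet_derivative F (at (u + x *\<^sub>R axis i 1))"
  have D: "(F has_derivative ?D) (at (u + x *\<^sub>R axis i 1))"
    using assms frechet_derivative_works by blast
  have "((\<lambda>x. u + x *\<^sub>R axis i 1) has_derivative (\<lambda>h. h *\<^sub>R axis i 1)) (at x)"
    by (auto intro!: derivative_eq_intros)
  from has_derivative_compose[OF this D]
  have "((\<lambda>x. F (u + x *\<^sub>R axis i 1)) has_derivative (\<lambda>h. ?D (h *\<^sub>R axis i 1))) (at x)" .
  moreover have "?D (h *\<^sub>R axis i 1) = pdiff i F (u + x *\<^sub>R axis i 1) * h" for h
    using linear_scale[OF has_derivative_linear[OF D]] by (simp add: pdiff_def mult.commute)
  ultimately show ?thesis
    by (simp add: has_field_derivative_def)
qed

text \<open>Two mean value theorems: one for the increment \<open>p\<close> in direction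
  \<open>j\<close>, as a function of the step in direction \<open>i\<close>, and one for
  \<open>pdiff i F\<close> in direction \<open>j\<close>. The left side is symmetric in
  \<open>i\<close> and \<open>j\<close>, which gives the symmetry of second derivatives in the
  limit.\<close>

lemma second_difference_mean_value:
  fixes F :: "real^2 \<Rightarrow> real"
  assumes sub: "cball u (2 * h) \<subseteq> S" and F: "smooth_map_on F S" and h: "h > 0"
  obtains v where "v \<in> cball u (2 * h)"
    "F (u + h *\<^sub>R axis i 1 + h *\<^sub>R axis j 1) - F (u + h *\<^sub>R axis i 1) - F (u + h *\<^sub>R axis j 1) + F u
      = h\<^sup>2 * pdiff j (pdiff i F) v"
proof -
  have mem: "u + x *\<^sub>R axis i 1 + y *\<^sub>R axis j 1 \<in> cball u (2 * h)"
    if "0 \<le> x" "x \<le> h" "0 \<le> y" "y \<le> h" for x y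
  proof -
    have "norm (x *\<^sub>R axis i (1::real) + y *\<^sub>R axis j 1 :: real^2) \<le> x + y"
      by (rule order_trans[OF norm_triangle_ineq]) (use that in simp)
    then show ?thesis
      using that norm_minus_cancel[of "x *\<^sub>R axis i (1::real) + y *\<^sub>R axis j 1 :: real^2"]
      by (simp add: dist_norm)
  qed
  have dF: "G differentiable (at (u + x *\<^sub>R axis i 1 + y *\<^sub>R axis j 1))"
    if "smooth_map_on G S" "0 \<le> x" "x \<le> h" "0 \<le> y" "y \<le> h" for x y and G :: "real^2 \<Rightarrow> real"
    using smooth_map_on_differentiable[OF that(1)] mem[OF that(2-)] sub by blast
  define p where "p x = F (u + x *\<^sub>R axis i 1 + h *\<^sub>R axis j 1) - F (u + x *\<^sub>R axis i 1)" for x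
  have p': "(p has_real_derivative
      pdiff i F (u + x *\<^sub>R axis i 1 + h *\<^sub>R axis j 1) - pdiff i F (u + x *\<^sub>R axis i 1)) (at x)"
    if "0 \<le> x" "x \<le> h" for x
    unfolding p_def
    using has_real_derivative_along_axis[of F "u + h *\<^sub>R axis j 1" x i]
      has_real_derivative_along_axis[of F u x i] dF[OF F that, of h] dF[OF F that, of 0] h
    by (intro DERIV_diff) (simp_all add: algebra_simps)
  obtain x where x: "0 < x" "x < h" "p h - p 0 = (h - 0) *
      (pdiff i F (u + x *\<^sub>R axis i 1 + h *\<^sub>R axis j 1) - pdiff i F (u + x *\<^sub>R axis i 1))"
    using MVT2[OF h p'] by blast
  have q': "((\<lambda>y. pdiff i F (u + x *\<^sub>R axis i 1 + y *\<^sub>R axis j 1)) has_real_derivative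
      pdiff j (pdiff i F) (u + x *\<^sub>R axis i 1 + y *\<^sub>R axis j 1)) (at y)"
    if "0 \<le> y" "y \<le> h" for y
    using has_real_derivative_along_axis[of "pdiff i F" "u + x *\<^sub>R axis i 1" y j]
      dF[OF smooth_map_on_pdiff[OF F] _ _ that, of x] x by simp
  obtain y where y: "0 < y" "y < h"
    "pdiff i F (u + x *\<^sub>R axis i 1 + h *\<^sub>R axis j 1) - pdiff i F (u + x *\<^sub>R axis i 1 + 0 *\<^sub>R axis j 1)
      = (h - 0) * pdiff j (pdiff i F) (u + x *\<^sub>R axis i 1 + y *\<^sub>R axis j 1)"
    using MVT2[OF h q'] by blast
  show thesis
    by (rule that[OF mem[of x y]]) (use x y in \<open>simp_all add: p_def power2_eq_square algebra_simps\<close>)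
qed

lemma pdiff_commute_real:
  fixes F :: "real^2 \<Rightarrow> real"
  assumes F: "smooth_map_on F S" and S: "open S" and u: "u \<in> S"
  shows "pdiff i (pdiff j F) u = pdiff j (pdiff i F) u"
proof -
  let ?P = "pdiff i (pdiff j F)" and ?Q = "pdiff j (pdiff i F)"
  have "dist (?P u) (?Q u) < \<epsilon>" if "\<epsilon> > 0" for \<epsilon>
  proof -
    have "isCont ?P u" "isCont ?Q u"
      using F S u smooth_map_on_pdiff smooth_map_on_continuous_on continuous_on_eq_continuous_at by blast+
    have nhd: "\<exists>d>0. \<forall>v. dist v u < d \<longrightarrow> dist (G v) (G u) < \<epsilon>/2"
      if "isCont G u" for G :: "real^2 \<Rightarrow> real"
      using tendstoD[OF that[unfolded isCont_def], of "\<epsilon>/2"] \<open>\<epsilon> > 0\<close>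
      unfolding eventually_at by (metis UNIV_I dist_self half_gt_zero)
    obtain d1 where d1: "d1 > 0" "\<And>v. dist v u < d1 \<Longrightarrow> dist (?P v) (?P u) < \<epsilon>/2"
      using nhd[of ?P] \<open>isCont ?P u\<close> by blast
    obtain d2 where d2: "d2 > 0" "\<And>v. dist v u < d2 \<Longrightarrow> dist (?Q v) (?Q u) < \<epsilon>/2"
      using nhd[of ?Q] \<open>isCont ?Q u\<close> by blast
    obtain d3 where d3: "d3 > 0" "cball u d3 \<subseteq> S"
      using S u open_contains_cball by blast
    define h where "h = min d3 (min d1 d2) / 4"
    have h: "h > 0" "2 * h < d1" "2 * h < d2" "2 * h \<le> d3"
      using d1(1) d2(1) d3(1) by (auto simp: h_def)
    have sub: "cball u (2 * h) \<subseteq> S"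
      using d3(2) h by (meson subset_cball order_trans)
    obtain v where v: "v \<in> cball u (2 * h)"
      "F (u + h *\<^sub>R axis i 1 + h *\<^sub>R axis j 1) - F (u + h *\<^sub>R axis i 1) - F (u + h *\<^sub>R axis j 1) + F u
        = h\<^sup>2 * ?Q v"
      using second_difference_mean_value[OF sub F h(1)] by blast
    obtain w where w: "w \<in> cball u (2 * h)"
      "F (u + h *\<^sub>R axis j 1 + h *\<^sub>R axis i 1) - F (u + h *\<^sub>R axis j 1) - F (u + h *\<^sub>R axis i 1) + F u
        = h\<^sup>2 * ?P w"
      using second_difference_mean_value[OF sub F h(1)] by blast
    have "F (u + h *\<^sub>R axis i 1 + h *\<^sub>R axis j 1) = F (u + h *\<^sub>R axis j 1 + h *\<^sub>R axis i 1)"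
      by (simp add: algebra_simps)
    then have "h\<^sup>2 * ?Q v = h\<^sup>2 * ?P w"
      using v(2) w(2) by linarith
    then have eq: "?Q v = ?P w"
      using h by simp
    have "dist (?Q v) (?Q u) < \<epsilon>/2" "dist (?P w) (?P u) < \<epsilon>/2"
      using d1(2)[of w] d2(2)[of v] v(1) w(1) h by (auto simp: dist_commute)
    then show ?thesis
      using eq unfolding dist_real_def by linarith
  qed
  then show ?thesis
    by (metis dist_pos_lt less_irrefl)
qed

lemma pdiff_inner_left:
  fixes f :: "real^2 \<Rightarrow> 'b::euclidean_space"
  assumes "f differentiable (at u)"
  shows "pdiff i (\<lambda>v. f v \<bullet> b) u = pdiff i f u \<bullet> b"
proof -
  have "pdiff i (\<lambda>v::real^2. b) u = 0"
    by (rule pdiff_eqI[OF has_derivative_const])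
  then show ?thesis
    using pdiff_inner[OF assms, of "\<lambda>_. b" i] by simp
qed

lemma times_differentiable_on_inner_left:
  assumes "times_differentiable_on k f S" "open S"
  shows "times_differentiable_on k (\<lambda>u. f u \<bullet> b) S"
  using assms
proof (induction k arbitrary: f)
  case 0
  then show ?case
    by (simp add: continuous_on_inner)
next
  case (Suc k)
  have d: "f differentiable (at u)" if "u \<in> S" for u
    using Suc.prems that by simp
  have fr: "frechet_derivative (\<lambda>u. f u \<bullet> b) (at u) = (\<lambda>v. frechet_derivative f (at u) v \<bullet> b)"
    if "u \<in> S" for u
    using d[OF that] frechet_derivative_works[of f "at u"]
    by (intro frechet_derivative_at[symmetric] has_derivative_inner_left) simp
  \<comment> \<open>The derivative of the inner product is known only on \<open>S\<close>, so the
    iterated predicate must be shown to depend only on the values on the open set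
    \<open>S\<close>.\<close>
  have cong: "times_differentiable_on k p S"
    if "times_differentiable_on k q S" "\<And>u. u \<in> S \<Longrightarrow> p u = q u" for p q :: "'a \<Rightarrow> real"
    using that
  proof (induction k arbitrary: p q)
    case 0
    then show ?case
      using continuous_on_cong by force
  next
    case (Suc k)
    have hd: "(p has_derivative D) (at u) \<longleftrightarrow> (q has_derivative D) (at u)" if "u \<in> S" for D u
      using has_derivative_transform_within_open[OF _ \<open>open S\<close> that] Suc.prems(2) by metis
    have "times_differentiable_on k (\<lambda>u. frechet_derivative p (at u) v) S" for v
      by (rule Suc.IH[of "\<lambda>u. frechet_derivative q (at u) v"])
        (use Suc.prems hd in \<open>auto simp: frechet_derivative_def\<close>)
    then show ?case
      using Suc.prems hd by (auto simp: differentiable_def)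
  qed
  have "times_differentiable_on k (\<lambda>u. frechet_derivative (\<lambda>u. f u \<bullet> b) (at u) v) S" for v
    by (rule cong[of "\<lambda>u. frechet_derivative f (at u) v \<bullet> b"])
      (use Suc fr in auto)
  then show ?case
    using d by (auto intro: differentiable_inner)
qed

lemma pdiff_commute:
  fixes f :: "real^2 \<Rightarrow> 'b::euclidean_space"
  assumes f: "smooth_map_on f S" and S: "open S" and u: "u \<in> S"
  shows "pdiff i (pdiff j f) u = pdiff j (pdiff i f) u"
proof (rule euclidean_eqI)
  fix b :: 'b
  have sm: "smooth_map_on (\<lambda>v. f v \<bullet> b) S"
    using f S times_differentiable_on_inner_left unfolding smooth_map_on_def by blast
  have "pdiff i (pdiff j (\<lambda>v. f v \<bullet> b)) u = pdiff i (pdiff j f) u \<bullet> b" for i j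
  proof -
    have "pdiff i (pdiff j (\<lambda>v. f v \<bullet> b)) u = pdiff i (\<lambda>v. pdiff j f v \<bullet> b) u"
      by (rule pdiff_cong[OF S u])
        (use f smooth_map_on_differentiable pdiff_inner_left in blast)
    then show ?thesis
      using f u smooth_map_on_pdiff smooth_map_on_differentiable pdiff_inner_left by metis
  qed
  then show "pdiff i (pdiff j f) u \<bullet> b = pdiff j (pdiff i f) u \<bullet> b"
    using pdiff_commute_real[OF sm S u, of i j] by simp
qed

text \<open>Everything happens on the line through \<open>u\<close> in direction \<open>w\<close>.
  If \<open>H w\<close> were positive, the derivative along \<open>w\<close>, which vanishes at
  \<open>u\<close>, would be positive shortly after \<open>u\<close>, and by the mean value theorem
  \<open>F\<close> would exceed its maximum.\<close>

lemma second_derivative_test: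
  fixes F :: "'a::euclidean_space \<Rightarrow> real"
  assumes S: "open S" and u: "u \<in> S"
    and D: "\<And>v. v \<in> S \<Longrightarrow> (F has_derivative D v) (at v)"
    and H: "((\<lambda>v. D v w) has_derivative H) (at u)"
    and max: "\<And>v. v \<in> S \<Longrightarrow> F v \<le> F u"
  shows "D u = (\<lambda>_. 0)" and "H w \<le> 0"
proof -
  show D0: "D u = (\<lambda>_. 0)"
    using differential_zero_maxmin[OF u S D[OF u]] max by blast
  show "H w \<le> 0"
  proof (rule ccontr)
    assume "\<not> H w \<le> 0"
    have line: "((\<lambda>t. u + t *\<^sub>R w) has_derivative (\<lambda>h. h *\<^sub>R w)) (at t)" for t
      by (auto intro!: derivative_eq_intros)
    have "((\<lambda>t. D (u + t *\<^sub>R w) w) has_derivative (\<lambda>h. H (h *\<^sub>R w))) (at 0)"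
      using has_derivative_compose[OF line[of 0]] H by simp
    then have "((\<lambda>t. D (u + t *\<^sub>R w) w) has_real_derivative H w) (at 0)"
      by (simp add: has_field_derivative_def linear_scale[OF has_derivative_linear[OF H]]
          mult_commute_abs)
    then obtain d where d: "d > 0" "\<And>h. 0 < h \<Longrightarrow> h < d \<Longrightarrow> D (u + 0 *\<^sub>R w) w < D (u + (0 + h) *\<^sub>R w) w"
      using DERIV_pos_inc_right[of "\<lambda>t. D (u + t *\<^sub>R w) w" "H w" 0] \<open>\<not> H w \<le> 0\<close> by force
    have "open ((\<lambda>t. u + t *\<^sub>R w) -` S)"
      using S by (intro open_vimage continuous_intros)
    moreover have "0 \<in> (\<lambda>t. u + t *\<^sub>R w) -` S"
      using u by simp
    ultimately obtain d' where d': "d' > 0" "ball 0 d' \<subseteq> (\<lambda>t. u + t *\<^sub>R w) -` S"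
      using open_contains_ball by blast
    define t where "t = min d d' / 2"
    have t: "0 < t" "t < d" "t < d'"
      using d(1) d'(1) by (auto simp: t_def)
    have in_S: "u + x *\<^sub>R w \<in> S" if "0 \<le> x" "x \<le> t" for x
    proof -
      have "x \<in> ball 0 d'"
        using that t by (simp add: dist_real_def)
      then show ?thesis
        using d'(2) by blast
    qed
    have "((\<lambda>t. F (u + t *\<^sub>R w)) has_real_derivative D (u + x *\<^sub>R w) w) (at x)"
      if "0 \<le> x" "x \<le> t" for x
      using has_derivative_compose[OF line D[OF in_S[OF that]]]
      by (simp add: has_field_derivative_def mult_commute_abs
          linear_scale[OF has_derivative_linear[OF D[OF in_S[OF that]]]])
    then obtain x where x: "0 < x" "x < t" "F (u + t *\<^sub>R w) - F (u + 0 *\<^sub>R w) = (t - 0) * D (u + x *\<^sub>R w) w"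
      using MVT2[OF t(1), of "\<lambda>t. F (u + t *\<^sub>R w)" "\<lambda>x. D (u + x *\<^sub>R w) w"] by blast
    have "D (u + x *\<^sub>R w) w > 0"
      using d(2)[of x] x t D0 by simp
    then have "F (u + t *\<^sub>R w) > F u"
      using x t by (smt (verit) mult_pos_pos scaleR_zero_left add.right_neutral)
    then show False
      using max in_S[of t] t by force
  qed
qed

section \<open>The Gauss equation of an immersed patch\<close>

lemma matrix_inv_2:
  fixes h :: "real^2^2"
  assumes d: "det h \<noteq> 0"
  shows "matrix_inv h $ 1 $ 1 = h $ 2 $ 2 / det h" "matrix_inv h $ 1 $ 2 = - h $ 1 $ 2 / det h"
    "matrix_inv h $ 2 $ 1 = - h $ 2 $ 1 / det h" "matrix_inv h $ 2 $ 2 = h $ 1 $ 1 / det h"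
proof -
  let ?d = "h$1$1 * h$2$2 - h$1$2 * h$2$1" and ?B = "matrix_inv h"
  have d': "?d \<noteq> 0"
    using d by (simp add: det_2)
  have "\<exists>B. h ** B = mat 1 \<and> B ** h = mat 1"
    using invertible_det_nz[of h] d by (simp add: invertible_def)
  then have "h ** ?B = mat 1"
    unfolding matrix_inv_def by (rule someI2_ex) simp
  then have "(h ** ?B) $ i $ j = mat 1 $ i $ j" for i j
    by simp
  then have eq: "h$i$1 * ?B$1$j + h$i$2 * ?B$2$j = (if i = j then 1 else 0)" for i j
    by (simp add: matrix_matrix_mult_def sum_2 mat_def)
  have "?d * ?B$1$j = h$2$2 * (if 1 = j then 1 else 0) - h$1$2 * (if 2 = j then 1 else 0)" for j
    unfolding eq[symmetric] by algebra
  moreover have "?d * ?B$2$j = h$1$1 * (if 2 = j then 1 else 0) - h$2$1 * (if 1 = j then 1 else 0)" for j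
    unfolding eq[symmetric] by algebra
  ultimately have *: "?d * ?B$1$1 = h$2$2" "?d * ?B$1$2 = - h$1$2" "?d * ?B$2$1 = - h$2$1" "?d * ?B$2$2 = h$1$1"
    by simp_all
  show "?B $ 1 $ 1 = h $ 2 $ 2 / det h" "?B $ 1 $ 2 = - h $ 1 $ 2 / det h"
    "?B $ 2 $ 1 = - h $ 2 $ 1 / det h" "?B $ 2 $ 2 = h $ 1 $ 1 / det h"
    using * d' by (simp_all add: det_2 field_simps)
qed

lemma pdiff_mult:
  fixes f g :: "real^2 \<Rightarrow> real"
  assumes "f differentiable (at u)" "g differentiable (at u)"
  shows "pdiff i (\<lambda>v. f v * g v) u = pdiff i f u * g u + f u * pdiff i g u"
  using pdiff_inner[OF assms, of i] by simp

lemma pdiff_add: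
  fixes f g :: "real^2 \<Rightarrow> 'b::euclidean_space"
  assumes "f differentiable (at u)" "g differentiable (at u)"
  shows "pdiff i (\<lambda>v. f v + g v) u = pdiff i f u + pdiff i g u"
  using pdiff_eqI[OF has_derivative_add[OF has_derivative_pdiff has_derivative_pdiff], OF assms, of i]
    pdiff_eqI[OF has_derivative_pdiff[OF assms(1)], of i] pdiff_eqI[OF has_derivative_pdiff[OF assms(2)], of i]
  by simp

text \<open>The coefficients are separate reals because they are often scalar functions such as
  \<open>lift1 a u\<close> and \<open>lift2 a u\<close> instead of the components of a given
  vector.\<close>

abbreviation tangent_combination :: "(real^2 \<Rightarrow> 'b::euclidean_space) \<Rightarrow> real^2 \<Rightarrow> real \<Rightarrow> real \<Rightarrow> 'b" where
  "tangent_combination f u w1 w2 \<equiv> w1 *\<^sub>R pdiff 1 f u + w2 *\<^sub>R pdiff 2 f u"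

abbreviation tangent_vector :: "(real^2 \<Rightarrow> 'b::euclidean_space) \<Rightarrow> real^2 \<Rightarrow> real^2 \<Rightarrow> 'b" where
  "tangent_vector f u w \<equiv> tangent_combination f u (w$1) (w$2)"

text \<open>The second fundamental form as a bilinear form in coordinates. Its symmetry, that is the
  commutation of partial derivatives, is built in: only the mixed entry 1 2 occurs.\<close>

abbreviation second_form :: "(real^2 \<Rightarrow> 'b::euclidean_space) \<Rightarrow> real^2 \<Rightarrow> real \<Rightarrow> real \<Rightarrow> real \<Rightarrow> real \<Rightarrow> 'b" where
  "second_form f u w1 w2 z1 z2 \<equiv> (w1 * z1) *\<^sub>R second_fundamental_form f 1 1 u
     + (w1 * z2 + w2 * z1) *\<^sub>R second_fundamental_form f 1 2 u + (w2 * z2) *\<^sub>R second_fundamental_form f 2 2 u"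

section \<open>Induced metric and orthogonal projection in one chart\<close>

locale immersed_patch =
  fixes f :: "real^2 \<Rightarrow> 'b::euclidean_space" and S :: "(real^2) set"
  assumes open_S: "open S" and smooth: "smooth_map_on f S"
    and inj_derivative: "u \<in> S \<Longrightarrow> inj (frechet_derivative f (at u))"
begin

definition metric_det :: "real^2 \<Rightarrow> real" where
  "metric_det u = (pdiff 1 f u \<bullet> pdiff 1 f u) * (pdiff 2 f u \<bullet> pdiff 2 f u) - (pdiff 1 f u \<bullet> pdiff 2 f u)\<^sup>2"

text \<open>The coefficients of the orthogonal projection of \<open>v\<close> to the tangent plane,
  solved from the normal equations by Cramer's rule. For second derivatives of \<open>f\<close> they
  are the Christoffel symbols.\<close>

definition tangential_coeff :: "2 \<Rightarrow> real^2 \<Rightarrow> 'b \<Rightarrow> real" where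
  "tangential_coeff k u v =
    (if k = 1
     then (pdiff 2 f u \<bullet> pdiff 2 f u) * (v \<bullet> pdiff 1 f u) - (pdiff 1 f u \<bullet> pdiff 2 f u) * (v \<bullet> pdiff 2 f u)
     else (pdiff 1 f u \<bullet> pdiff 1 f u) * (v \<bullet> pdiff 2 f u) - (pdiff 1 f u \<bullet> pdiff 2 f u) * (v \<bullet> pdiff 1 f u))
    / metric_det u"

lemma differentiable: "u \<in> S \<Longrightarrow> f differentiable (at u)"
  and differentiable_pdiff: "u \<in> S \<Longrightarrow> pdiff i f differentiable (at u)"
  and differentiable_pdiff2: "u \<in> S \<Longrightarrow> pdiff i (pdiff j f) differentiable (at u)"
  using smooth smooth_map_on_pdiff smooth_map_on_differentiable by blast+

lemma mixed_commute: "u \<in> S \<Longrightarrow> pdiff i (pdiff j f) u = pdiff j (pdiff i f) u"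
  using pdiff_commute[OF smooth open_S] .

lemma derivative_eq: "u \<in> S \<Longrightarrow> frechet_derivative f (at u) w = tangent_vector f u w"
  using frechet_derivative_pdiff[OF differentiable] by simp

lemma tangent_plane_eq:
  "u \<in> S \<Longrightarrow> tangent_plane f u = range (\<lambda>w::real^2. tangent_vector f u w)"
  unfolding tangent_plane_def using frechet_derivative_pdiff[OF differentiable] by simp

lemma derivative_eq_0_iff:
  assumes "u \<in> S"
  shows "tangent_vector f u w = 0 \<longleftrightarrow> w = (0 :: real^2)"
proof -
  let ?D = "\<lambda>w::real^2. tangent_vector f u w"
  have "inj ?D"
    using inj_derivative[OF assms] frechet_derivative_pdiff[OF differentiable[OF assms]] by simp
  then have "?D w = ?D 0 \<longleftrightarrow> w = 0"
    by (rule inj_eq)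
  then show ?thesis
    by simp
qed

lemma tangent_combination_nonzero:
  assumes "u \<in> S" "x \<noteq> 0 \<or> y \<noteq> 0"
  shows "x *\<^sub>R pdiff 1 f u + y *\<^sub>R pdiff 2 f u \<noteq> 0"
proof -
  have "vector [x, y] \<noteq> (0 :: real^2)"
    using assms(2) by (auto simp: vec_eq_iff forall_2)
  then show ?thesis
    using derivative_eq_0_iff[OF assms(1), of "vector [x, y]"] by simp
qed

lemma metric_pos:
  assumes "u \<in> S"
  shows "pdiff 1 f u \<bullet> pdiff 1 f u > 0" "pdiff 2 f u \<bullet> pdiff 2 f u > 0" "metric_det u > 0"
proof -
  let ?a = "pdiff 1 f u" and ?b = "pdiff 2 f u"
  note ne = tangent_combination_nonzero[OF assms]
  show a: "?a \<bullet> ?a > 0" and b: "?b \<bullet> ?b > 0"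
    using ne[of 1 0] ne[of 0 1] by simp_all
  \<comment> \<open>This is |b|^2 times the part of a orthogonal to b. Its squared length is |b|^2
    times the Gram determinant, and it is nonzero because the derivative is injective.\<close>
  let ?v = "(?b \<bullet> ?b) *\<^sub>R ?a + (- (?a \<bullet> ?b)) *\<^sub>R ?b"
  have "?v \<bullet> ?v > 0"
    using ne[of "?b \<bullet> ?b" "- (?a \<bullet> ?b)"] b by simp
  moreover have "?v \<bullet> ?v = (?b \<bullet> ?b) * metric_det u"
    unfolding metric_det_def
    by (simp add: inner_simps inner_commute[of ?b ?a] power2_eq_square algebra_simps)
  ultimately show "metric_det u > 0"
    using b by (metis zero_less_mult_pos)
qed

lemma det_induced_metric: "det (induced_metric f u) = metric_det u"
  by (simp add: induced_metric_def det_2 metric_det_def power2_eq_square inner_commute)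

lemma inverse_induced_metric:
  assumes "u \<in> S"
  shows "matrix_inv (induced_metric f u) $ 1 $ 1 = (pdiff 2 f u \<bullet> pdiff 2 f u) / metric_det u"
    "matrix_inv (induced_metric f u) $ 1 $ 2 = - (pdiff 1 f u \<bullet> pdiff 2 f u) / metric_det u"
    "matrix_inv (induced_metric f u) $ 2 $ 1 = - (pdiff 1 f u \<bullet> pdiff 2 f u) / metric_det u"
    "matrix_inv (induced_metric f u) $ 2 $ 2 = (pdiff 1 f u \<bullet> pdiff 1 f u) / metric_det u"
proof -
  have "det (induced_metric f u) \<noteq> 0"
    using metric_pos(3)[OF assms] by (simp add: det_induced_metric)
  note * = matrix_inv_2[OF this, unfolded det_induced_metric]
  show "matrix_inv (induced_metric f u) $ 1 $ 1 = (pdiff 2 f u \<bullet> pdiff 2 f u) / metric_det u"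
    "matrix_inv (induced_metric f u) $ 1 $ 2 = - (pdiff 1 f u \<bullet> pdiff 2 f u) / metric_det u"
    "matrix_inv (induced_metric f u) $ 2 $ 1 = - (pdiff 1 f u \<bullet> pdiff 2 f u) / metric_det u"
    "matrix_inv (induced_metric f u) $ 2 $ 2 = (pdiff 1 f u \<bullet> pdiff 1 f u) / metric_det u"
    unfolding * by (simp_all add: induced_metric_def inner_commute)
qed

lemma tangential_coeff_inner:
  assumes "u \<in> S"
  shows "tangential_coeff 1 u v * (pdiff 1 f u \<bullet> pdiff m f u) + tangential_coeff 2 u v * (pdiff 2 f u \<bullet> pdiff m f u)
    = v \<bullet> pdiff m f u"
proof -
  let ?a = "pdiff 1 f u" and ?b = "pdiff 2 f u"
  have d: "metric_det u \<noteq> 0"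
    using metric_pos(3)[OF assms] by simp
  consider "m = 1" | "m = 2"
    using exhaust_2 by blast
  then show ?thesis
  proof cases
    case 1
    have "((?b \<bullet> ?b) * (v \<bullet> ?a) - (?a \<bullet> ?b) * (v \<bullet> ?b)) * (?a \<bullet> ?a)
        + ((?a \<bullet> ?a) * (v \<bullet> ?b) - (?a \<bullet> ?b) * (v \<bullet> ?a)) * (?b \<bullet> ?a) = (v \<bullet> ?a) * metric_det u"
      unfolding metric_det_def inner_commute[of ?b ?a] by algebra
    then show ?thesis
      using 1 d by (simp add: tangential_coeff_def add_divide_distrib[symmetric])
  next
    case 2
    have "((?b \<bullet> ?b) * (v \<bullet> ?a) - (?a \<bullet> ?b) * (v \<bullet> ?b)) * (?a \<bullet> ?b)
        + ((?a \<bullet> ?a) * (v \<bullet> ?b) - (?a \<bullet> ?b) * (v \<bullet> ?a)) * (?b \<bullet> ?b) = (v \<bullet> ?b) * metric_det u"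
      unfolding metric_det_def by algebra
    then show ?thesis
      using 2 d by (simp add: tangential_coeff_def add_divide_distrib[symmetric])
  qed
qed

text \<open>Resolves the definite description. Existence is the system of normal equations; for
  uniqueness, the difference of two candidates is tangent and orthogonal to both of them, hence to
  itself.\<close>

lemma normal_part_eq:
  assumes "u \<in> S"
  shows "normal_part f u v
    = v - (tangential_coeff 1 u v *\<^sub>R pdiff 1 f u + tangential_coeff 2 u v *\<^sub>R pdiff 2 f u)" (is "_ = ?n")
  unfolding normal_part_def
proof (rule the_equality)
  have T: "tangent_plane f u = range (\<lambda>w::real^2. tangent_vector f u w)"
    by (rule tangent_plane_eq[OF assms])
  define w :: "real^2" where "w = vector [tangential_coeff 1 u v, tangential_coeff 2 u v]"
  have "v - ?n = tangent_vector f u w"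
    by (simp add: w_def)
  then have 1: "v - ?n \<in> tangent_plane f u"
    unfolding T by blast
  have "?n \<bullet> pdiff m f u = 0" for m
    using tangential_coeff_inner[OF assms, of v m] by (simp add: inner_simps)
  then have orth: "\<tau> \<bullet> ?n = 0" if "\<tau> \<in> tangent_plane f u" for \<tau>
    using that unfolding T by (auto simp: inner_simps inner_commute algebra_simps)
  then have 2: "?n \<in> orthogonal_comp (tangent_plane f u)"
    by (simp add: orthogonal_comp_def orthogonal_def)
  show "v - ?n \<in> tangent_plane f u \<and> ?n \<in> orthogonal_comp (tangent_plane f u)"
    using 1 2 ..
  fix w
  assume w: "v - w \<in> tangent_plane f u \<and> w \<in> orthogonal_comp (tangent_plane f u)"
  have "subspace (tangent_plane f u)"
    unfolding T by (rule linear_subspace_image[OF has_derivative_linear[OF has_derivative_pdiff[OF differentiable[OF assms]]] subspace_UNIV])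
  moreover obtain N where N: "N = ?n"
    by blast
  ultimately have "(v - w) - (v - N) \<in> tangent_plane f u"
    using w 1 subspace_diff by blast
  then have t: "N - w \<in> tangent_plane f u"
    by simp
  have "(N - w) \<bullet> w = 0"
    using w t by (simp add: orthogonal_comp_def orthogonal_def)
  moreover have "(N - w) \<bullet> N = 0"
    using orth t N by blast
  ultimately have "(N - w) \<bullet> (N - w) = 0"
    by (simp only: inner_diff_right diff_self)
  then show "w = ?n"
    using N by simp
qed

lemma normal_part_inner_pdiff: "u \<in> S \<Longrightarrow> normal_part f u v \<bullet> pdiff m f u = 0"
  using tangential_coeff_inner[of u v m] by (simp add: normal_part_eq inner_simps)

text \<open>In the alternating sum of metric derivatives all terms cancel but twice the inner
  product of the second derivative with the coordinate vector, since partial derivatives commute.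
  Raising the index is then the Cramer formula of \<open>tangential_coeff\<close>.\<close>

lemma christoffel_eq:
  assumes u: "u \<in> S"
  shows "christoffel (induced_metric f) k i j u = tangential_coeff k u (pdiff i (pdiff j f) u)"
proof -
  let ?X = "\<lambda>i. pdiff i f u" and ?XX = "\<lambda>i j. pdiff i (pdiff j f) u"
  have dh: "pdiff i (\<lambda>v. induced_metric f v $ j $ l) u = ?XX i j \<bullet> ?X l + ?X j \<bullet> ?XX i l" for i j l
    using pdiff_inner[OF differentiable_pdiff[OF u] differentiable_pdiff[OF u]]
    by (simp add: induced_metric_def)
  have "pdiff i (\<lambda>v. induced_metric f v $ j $ l) u + pdiff j (\<lambda>v. induced_metric f v $ i $ l) u
      - pdiff l (\<lambda>v. induced_metric f v $ i $ j) u = 2 * (?XX i j \<bullet> ?X l)" for l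
    unfolding dh mixed_commute[OF u, of j i] mixed_commute[OF u, of l i] mixed_commute[OF u, of l j]
    by (simp add: inner_commute)
  then have *: "christoffel (induced_metric f) k i j u
      = matrix_inv (induced_metric f u) $ k $ 1 * (?XX i j \<bullet> ?X 1) + matrix_inv (induced_metric f u) $ k $ 2 * (?XX i j \<bullet> ?X 2)"
    unfolding christoffel_def sum_2 by simp
  consider "k = 1" | "k = 2"
    using exhaust_2 by blast
  then show ?thesis
    unfolding * by cases (simp_all add: inverse_induced_metric[OF u] tangential_coeff_def diff_divide_distrib)
qed

lemma differentiable_tangential_coeff:
  assumes u: "u \<in> S" and G: "G differentiable (at u)"
  shows "(\<lambda>v. tangential_coeff k v (G v)) differentiable (at u)"
proof -
  have d: "metric_det u \<noteq> 0"
    using metric_pos(3)[OF u] by simp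
  have m: "metric_det differentiable (at u)"
    unfolding metric_det_def[abs_def] power2_eq_square
    using differentiable_pdiff[OF u]
    by (intro differentiable_diff differentiable_mult differentiable_inner) auto
  have "(\<lambda>v. (G v \<bullet> pdiff i f v)) differentiable (at u)"
    "(\<lambda>v. (pdiff i f v \<bullet> pdiff j f v)) differentiable (at u)" for i j
    using differentiable_pdiff[OF u] G by (auto intro: differentiable_inner)
  then show ?thesis
    unfolding tangential_coeff_def using m d
    by (cases "k = 1") (simp_all add: differentiable_divide differentiable_diff differentiable_mult)
qed

text \<open>Derivatives of Christoffel symbols enter the curvature only contracted with the first
  row of the metric. This contraction follows by differentiating the identity
  \<open>tangential_coeff_inner\<close>, without ever differentiating a quotient by the
  determinant.\<close>

lemma pdiff_tangential_coeff:
  assumes u: "u \<in> S" and G: "\<And>v. v \<in> S \<Longrightarrow> G differentiable (at v)"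
  shows "pdiff a (\<lambda>v. tangential_coeff 1 v (G v)) u * (pdiff 1 f u \<bullet> pdiff 1 f u)
      + pdiff a (\<lambda>v. tangential_coeff 2 v (G v)) u * (pdiff 2 f u \<bullet> pdiff 1 f u)
    = pdiff a G u \<bullet> pdiff 1 f u + G u \<bullet> pdiff a (pdiff 1 f) u
      - tangential_coeff 1 u (G u) * (2 * (pdiff 1 f u \<bullet> pdiff a (pdiff 1 f) u))
      - tangential_coeff 2 u (G u) * (pdiff a (pdiff 2 f) u \<bullet> pdiff 1 f u + pdiff 2 f u \<bullet> pdiff a (pdiff 1 f) u)"
proof -
  note dp = differentiable_pdiff[OF u]
  have dt: "(\<lambda>v. tangential_coeff l v (G v)) differentiable (at u)" for l
    by (rule differentiable_tangential_coeff[OF u G[OF u]])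
  have di: "(\<lambda>v. pdiff l f v \<bullet> pdiff 1 f v) differentiable (at u)" for l
    by (rule differentiable_inner[OF dp dp])
  have "pdiff a (\<lambda>v. G v \<bullet> pdiff 1 f v) u
    = pdiff a (\<lambda>v. tangential_coeff 1 v (G v) * (pdiff 1 f v \<bullet> pdiff 1 f v)
        + tangential_coeff 2 v (G v) * (pdiff 2 f v \<bullet> pdiff 1 f v)) u"
    by (rule pdiff_cong[OF open_S u]) (simp only: tangential_coeff_inner)
  then show ?thesis
    unfolding pdiff_inner[OF G[OF u] dp] pdiff_add[OF differentiable_mult[OF dt di] differentiable_mult[OF dt di]]
      pdiff_mult[OF dt di] pdiff_inner[OF dp dp]
    by (simp add: algebra_simps inner_commute)
qed

text \<open>The third derivatives of \<open>f\<close> cancel by symmetry. What remains is the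
  product of second derivatives minus the product of their tangential parts, which is the product of
  their normal parts.\<close>

theorem gauss_equation:
  assumes u: "u \<in> S"
  shows "gaussian_curvature (induced_metric f) u * metric_det u
    = second_fundamental_form f 1 1 u \<bullet> second_fundamental_form f 2 2 u
      - second_fundamental_form f 1 2 u \<bullet> second_fundamental_form f 1 2 u"
proof -
  let ?X = "\<lambda>i. pdiff i f u" and ?XX = "\<lambda>i j. pdiff i (pdiff j f) u"
    and ?c = "\<lambda>k i j. tangential_coeff k u (pdiff i (pdiff j f) u)"
    and ?dc = "\<lambda>a k i j. pdiff a (\<lambda>v. tangential_coeff k v (pdiff i (pdiff j f) v)) u"
    and ?A = "\<lambda>i j. second_fundamental_form f i j u"
  have pc: "pdiff a (christoffel (induced_metric f) k i j) u = ?dc a k i j" for a k i j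
    by (rule pdiff_cong[OF open_S u]) (rule christoffel_eq)
  have K: "gaussian_curvature (induced_metric f) u * metric_det u
      = (\<Sum>l\<in>UNIV. (?dc 1 l 2 2 - ?dc 2 l 1 2
          + (\<Sum>m\<in>UNIV. ?c m 2 2 * ?c l 1 m - ?c m 1 2 * ?c l 2 m)) * (?X l \<bullet> ?X 1))"
    unfolding gaussian_curvature_def riemann_def pc christoffel_eq[OF u] det_induced_metric
    using metric_pos(3)[OF u] by (simp add: induced_metric_def)
  have E: "?dc a 1 i j * (?X 1 \<bullet> ?X 1) + ?dc a 2 i j * (?X 2 \<bullet> ?X 1)
    = pdiff a (pdiff i (pdiff j f)) u \<bullet> ?X 1 + ?XX i j \<bullet> ?XX a 1
      - ?c 1 i j * (2 * (?X 1 \<bullet> ?XX a 1)) - ?c 2 i j * (?XX a 2 \<bullet> ?X 1 + ?X 2 \<bullet> ?XX a 1)" for a i j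
    by (rule pdiff_tangential_coeff[OF u differentiable_pdiff2])
  have Q: "?c 1 i j * (?X 1 \<bullet> ?X 1) + ?c 2 i j * (?X 2 \<bullet> ?X 1) = ?XX i j \<bullet> ?X 1" for i j
    by (rule tangential_coeff_inner[OF u])
  have third: "pdiff 2 (pdiff 1 (pdiff 2 f)) u = pdiff 1 (pdiff 2 (pdiff 2 f)) u"
    by (rule pdiff_commute[OF smooth_map_on_pdiff[OF smooth] open_S u])
  have s21: "?XX 2 1 = ?XX 1 2"
    by (rule mixed_commute[OF u])
  have A: "?A i j \<bullet> ?A k l = ?XX i j \<bullet> ?XX k l - ?c 1 i j * (?X 1 \<bullet> ?XX k l) - ?c 2 i j * (?X 2 \<bullet> ?XX k l)" for i j k l
  proof -
    have "?A i j \<bullet> ?A k l = ?A i j \<bullet> ?XX k l"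
      unfolding second_fundamental_form_def normal_part_eq[OF u, of "?XX k l"]
      by (simp add: inner_simps normal_part_inner_pdiff[OF u])
    then show ?thesis
      unfolding second_fundamental_form_def normal_part_eq[OF u, of "?XX i j"] by (simp add: inner_simps)
  qed
  \<comment> \<open>The formula \<open>A\<close> expands the tangential part of its first factor.
    Taking the factors in the order 22, 11 produces the coefficients of the 22 derivative, which are
    those coming from \<open>E\<close> and \<open>Q\<close>.\<close>
  note A11_22 = trans[OF inner_commute A[of 2 2 1 1]]
  have "gaussian_curvature (induced_metric f) u * metric_det u
    = (?dc 1 1 2 2 * (?X 1 \<bullet> ?X 1) + ?dc 1 2 2 2 * (?X 2 \<bullet> ?X 1))
      - (?dc 2 1 1 2 * (?X 1 \<bullet> ?X 1) + ?dc 2 2 1 2 * (?X 2 \<bullet> ?X 1))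
      + (?c 1 2 2 * (?c 1 1 1 * (?X 1 \<bullet> ?X 1) + ?c 2 1 1 * (?X 2 \<bullet> ?X 1))
         + ?c 2 2 2 * (?c 1 1 2 * (?X 1 \<bullet> ?X 1) + ?c 2 1 2 * (?X 2 \<bullet> ?X 1)))
      - (?c 1 1 2 * (?c 1 2 1 * (?X 1 \<bullet> ?X 1) + ?c 2 2 1 * (?X 2 \<bullet> ?X 1))
         + ?c 2 1 2 * (?c 1 2 2 * (?X 1 \<bullet> ?X 1) + ?c 2 2 2 * (?X 2 \<bullet> ?X 1)))"
    unfolding K sum_2 by (simp only: algebra_simps)
  then show ?thesis
    unfolding E Q A11_22 unfolding A third s21 by (simp add: algebra_simps inner_commute)
qed

lemma mean_curvature_eq:
  assumes u: "u \<in> S"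
  shows "2 *\<^sub>R mean_curvature f u =
    (1 / metric_det u) *\<^sub>R ((pdiff 2 f u \<bullet> pdiff 2 f u) *\<^sub>R second_fundamental_form f 1 1 u
      - (2 * (pdiff 1 f u \<bullet> pdiff 2 f u)) *\<^sub>R second_fundamental_form f 1 2 u
      + (pdiff 1 f u \<bullet> pdiff 1 f u) *\<^sub>R second_fundamental_form f 2 2 u)"
proof -
  have "second_fundamental_form f 2 1 u = second_fundamental_form f 1 2 u"
    unfolding second_fundamental_form_def mixed_commute[OF u, of 2 1] ..
  then show ?thesis
    unfolding mean_curvature_def sum_2 inverse_induced_metric[OF u]
    by (simp add: scaleR_right_distrib scaleR_right_diff_distrib scaleR_left_distrib[symmetric] add_divide_distrib[symmetric]
        algebra_simps)
qed

end

section \<open>Bounding the second fundamental form\<close>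

text \<open>The operator norm of a symmetric two by two form is at most its Hilbert-Schmidt norm;
  the vector-valued entries are reduced to their norms by the triangle inequality.\<close>

lemma norm_bilinear_symmetric_le:
  fixes B1 B2 B3 :: "'b::real_inner"
  assumes "(norm B1)\<^sup>2 + 2 * (norm B2)\<^sup>2 + (norm B3)\<^sup>2 \<le> C\<^sup>2" "C \<ge> 0"
  shows "norm ((a * c) *\<^sub>R B1 + (a * d + b * c) *\<^sub>R B2 + (b * d) *\<^sub>R B3) \<le> C * sqrt (a\<^sup>2 + b\<^sup>2) * sqrt (c\<^sup>2 + d\<^sup>2)"
proof -
  let ?x = "norm B1" and ?y = "norm B2" and ?z = "norm B3"
  have "norm ((a * c) *\<^sub>R B1 + (a * d + b * c) *\<^sub>R B2 + (b * d) *\<^sub>R B3)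
      \<le> \<bar>a * c\<bar> * ?x + \<bar>a * d + b * c\<bar> * ?y + \<bar>b * d\<bar> * ?z"
    by (intro norm_triangle_le add_mono) simp_all
  also have "\<dots> \<le> \<bar>a\<bar> * \<bar>c\<bar> * ?x + (\<bar>a\<bar> * \<bar>d\<bar> + \<bar>b\<bar> * \<bar>c\<bar>) * ?y + \<bar>b\<bar> * \<bar>d\<bar> * ?z"
    by (intro add_mono mult_right_mono) (auto simp: abs_mult intro: order_trans[OF abs_triangle_ineq])
  also have "\<dots> \<le> sqrt ((a\<^sup>2 + b\<^sup>2) * (c\<^sup>2 + d\<^sup>2) * (?x\<^sup>2 + 2 * ?y\<^sup>2 + ?z\<^sup>2))"
  proof (rule real_le_rsqrt)
    let ?p = "\<bar>a\<bar> * \<bar>c\<bar>" and ?q = "\<bar>a\<bar> * \<bar>d\<bar>" and ?r = "\<bar>b\<bar> * \<bar>c\<bar>" and ?s = "\<bar>b\<bar> * \<bar>d\<bar>"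
    \<comment> \<open>Lagrange's identity for the vectors (p, q, r, s) and (x, y, y, z); its six
      squares account for the defect in the Cauchy-Schwarz inequality.\<close>
    have "(?p * ?x + (?q + ?r) * ?y + ?s * ?z)\<^sup>2
      + ((?p * ?y - ?q * ?x)\<^sup>2 + (?p * ?y - ?r * ?x)\<^sup>2 + (?p * ?z - ?s * ?x)\<^sup>2
        + (?q * ?y - ?r * ?y)\<^sup>2 + (?q * ?z - ?s * ?y)\<^sup>2 + (?r * ?z - ?s * ?y)\<^sup>2)
      = (?p\<^sup>2 + ?q\<^sup>2 + ?r\<^sup>2 + ?s\<^sup>2) * (?x\<^sup>2 + 2 * ?y\<^sup>2 + ?z\<^sup>2)"
      by algebra
    moreover have sq: "?p\<^sup>2 + ?q\<^sup>2 + ?r\<^sup>2 + ?s\<^sup>2 = (a\<^sup>2 + b\<^sup>2) * (c\<^sup>2 + d\<^sup>2)"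
      by (simp add: power_mult_distrib algebra_simps)
    moreover have "(?p * ?y - ?q * ?x)\<^sup>2 + (?p * ?y - ?r * ?x)\<^sup>2 + (?p * ?z - ?s * ?x)\<^sup>2
        + (?q * ?y - ?r * ?y)\<^sup>2 + (?q * ?z - ?s * ?y)\<^sup>2 + (?r * ?z - ?s * ?y)\<^sup>2 \<ge> 0"
      by simp
    ultimately show "(?p * ?x + (?q + ?r) * ?y + ?s * ?z)\<^sup>2 \<le> (a\<^sup>2 + b\<^sup>2) * (c\<^sup>2 + d\<^sup>2) * (?x\<^sup>2 + 2 * ?y\<^sup>2 + ?z\<^sup>2)"
      unfolding sq by linarith
  qed
  also have "\<dots> \<le> sqrt ((a\<^sup>2 + b\<^sup>2) * (c\<^sup>2 + d\<^sup>2) * C\<^sup>2)"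
    using assms(1) by (intro real_sqrt_le_mono mult_left_mono) auto
  also have "\<dots> = C * sqrt (a\<^sup>2 + b\<^sup>2) * sqrt (c\<^sup>2 + d\<^sup>2)"
    using assms(2) by (simp add: real_sqrt_mult)
  finally show ?thesis .
qed

text \<open>The components of the form and of its arguments are taken with respect to the basis that
  arises from \<open>X1, X2\<close> by the Gram--Schmidt process.\<close>

lemma norm_second_form_le:
  fixes X1 X2 A11 A12 A22 :: "'b::real_inner"
  assumes d: "\<Delta> = (X1 \<bullet> X1) * (X2 \<bullet> X2) - (X1 \<bullet> X2)\<^sup>2" "\<Delta> > 0" and X1: "X1 \<bullet> X1 > 0"
    and trace: "norm ((1/\<Delta>) *\<^sub>R ((X2 \<bullet> X2) *\<^sub>R A11 - (2 * (X1 \<bullet> X2)) *\<^sub>R A12 + (X1 \<bullet> X1) *\<^sub>R A22)) \<le> c"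
    and gauss: "A11 \<bullet> A22 - A12 \<bullet> A12 \<ge> \<kappa> * \<Delta>" and C: "C \<ge> 0" "C\<^sup>2 \<ge> c\<^sup>2 - 2 * \<kappa>"
  shows "norm ((w1 * z1) *\<^sub>R A11 + (w1 * z2 + w2 * z1) *\<^sub>R A12 + (w2 * z2) *\<^sub>R A22)
    \<le> C * norm (w1 *\<^sub>R X1 + w2 *\<^sub>R X2) * norm (z1 *\<^sub>R X1 + z2 *\<^sub>R X2)"
proof -
  \<comment> \<open>For the orthonormal basis E1, E2 one has X1 = p E1 and X2 = s X1 + r E2. Only
    these three numbers are needed, not the vectors E1 and E2.\<close>
  define p r s where "p = sqrt (X1 \<bullet> X1)" and "r = sqrt (\<Delta> / (X1 \<bullet> X1))" and "s = (X1 \<bullet> X2) / (X1 \<bullet> X1)"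
  have p2: "p\<^sup>2 = X1 \<bullet> X1" and r2: "r\<^sup>2 = \<Delta> / (X1 \<bullet> X1)" and pos: "p > 0" "r > 0"
    using X1 d(2) by (auto simp: p_def r_def)
  have X12: "X1 \<bullet> X2 = s * p\<^sup>2" and X22: "X2 \<bullet> X2 = s\<^sup>2 * p\<^sup>2 + r\<^sup>2" and \<Delta>: "\<Delta> = p\<^sup>2 * r\<^sup>2"
    using X1 d(1) unfolding p2 r2 s_def by (auto simp: field_simps power2_eq_square)
  \<comment> \<open>The values of the form at (E1, E1), (E1, E2) and (E2, E2), obtained by solving
    the bilinear expansions of \<open>A11\<close>, \<open>A12\<close> and \<open>A22\<close> in
    turn.\<close>
  define B1 B2 B3 where "B1 = (1/p\<^sup>2) *\<^sub>R A11" and "B2 = (1/(p * r)) *\<^sub>R (A12 - s *\<^sub>R A11)"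
    and "B3 = (1/r\<^sup>2) *\<^sub>R (A22 - (2 * s * p * r) *\<^sub>R B2 - (s\<^sup>2 * p\<^sup>2) *\<^sub>R B1)"
  have A: "A11 = p\<^sup>2 *\<^sub>R B1" "A12 = (p * r) *\<^sub>R B2 + (s * p\<^sup>2) *\<^sub>R B1"
    "A22 = r\<^sup>2 *\<^sub>R B3 + (2 * s * p * r) *\<^sub>R B2 + (s\<^sup>2 * p\<^sup>2) *\<^sub>R B1"
  proof -
    show 11: "A11 = p\<^sup>2 *\<^sub>R B1"
      using pos by (simp add: B1_def)
    show 12: "A12 = (p * r) *\<^sub>R B2 + (s * p\<^sup>2) *\<^sub>R B1"
      using pos by (simp add: B2_def B1_def)
    show "A22 = r\<^sup>2 *\<^sub>R B3 + (2 * s * p * r) *\<^sub>R B2 + (s\<^sup>2 * p\<^sup>2) *\<^sub>R B1"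
      using pos by (simp add: B3_def)
  qed
  have "(X2 \<bullet> X2) *\<^sub>R A11 - (2 * (X1 \<bullet> X2)) *\<^sub>R A12 + (X1 \<bullet> X1) *\<^sub>R A22 = \<Delta> *\<^sub>R (B1 + B3)"
    unfolding A X12 X22 \<Delta> p2[symmetric]
    by (simp add: algebra_simps power2_eq_square) (simp add: scaleR_add_left[symmetric])
  then have tr: "norm (B1 + B3) \<le> c"
    using trace d(2) by simp
  have "A11 \<bullet> A22 - A12 \<bullet> A12 = \<Delta> * (B1 \<bullet> B3 - B2 \<bullet> B2)"
    unfolding A \<Delta> by (simp add: inner_simps inner_commute algebra_simps power2_eq_square)
  then have "\<kappa> \<le> B1 \<bullet> B3 - B2 \<bullet> B2"
    using gauss d(2) by (simp add: mult.commute[of \<kappa>])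
  moreover have "(norm (B1 + B3))\<^sup>2 = (norm B1)\<^sup>2 + (norm B3)\<^sup>2 + 2 * (B1 \<bullet> B3)"
    by (simp add: power2_norm_eq_inner inner_simps inner_commute)
  moreover have "(norm (B1 + B3))\<^sup>2 \<le> c\<^sup>2"
    using tr by (intro power_mono) auto
  ultimately have "(norm B1)\<^sup>2 + 2 * (norm B2)\<^sup>2 + (norm B3)\<^sup>2 \<le> C\<^sup>2"
    using C(2) by (simp add: power2_norm_eq_inner[of B2])
  \<comment> \<open>The positional instances follow the order of first occurrence in that lemma,
    which is a, c, d, b. The arguments are the coordinates of the two vectors in the basis E1,
    E2.\<close>
  from norm_bilinear_symmetric_le[OF this C(1), of "p * (w1 + s * w2)" "p * (z1 + s * z2)" "r * z2" "r * w2"]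
  have *: "norm (((p * (w1 + s * w2)) * (p * (z1 + s * z2))) *\<^sub>R B1
      + ((p * (w1 + s * w2)) * (r * z2) + (r * w2) * (p * (z1 + s * z2))) *\<^sub>R B2 + ((r * w2) * (r * z2)) *\<^sub>R B3)
    \<le> C * sqrt ((p * (w1 + s * w2))\<^sup>2 + (r * w2)\<^sup>2) * sqrt ((p * (z1 + s * z2))\<^sup>2 + (r * z2)\<^sup>2)" .
  have n: "norm (x1 *\<^sub>R X1 + x2 *\<^sub>R X2) = sqrt ((p * (x1 + s * x2))\<^sup>2 + (r * x2)\<^sup>2)" for x1 x2
  proof -
    have "(x1 *\<^sub>R X1 + x2 *\<^sub>R X2) \<bullet> (x1 *\<^sub>R X1 + x2 *\<^sub>R X2)
        = x1\<^sup>2 * (X1 \<bullet> X1) + 2 * x1 * x2 * (X1 \<bullet> X2) + x2\<^sup>2 * (X2 \<bullet> X2)"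
      by (simp add: inner_simps inner_commute algebra_simps power2_eq_square)
    also have "\<dots> = (p * (x1 + s * x2))\<^sup>2 + (r * x2)\<^sup>2"
      unfolding X12 X22 p2[symmetric] by algebra
    finally show ?thesis
      by (simp add: norm_eq_sqrt_inner)
  qed
  have "(w1 * z1) *\<^sub>R A11 + (w1 * z2 + w2 * z1) *\<^sub>R A12 + (w2 * z2) *\<^sub>R A22
    = ((p * (w1 + s * w2)) * (p * (z1 + s * z2))) *\<^sub>R B1
      + ((p * (w1 + s * w2)) * (r * z2) + (r * w2) * (p * (z1 + s * z2))) *\<^sub>R B2 + ((r * w2) * (r * z2)) *\<^sub>R B3"
    unfolding A by (simp add: algebra_simps power2_eq_square scaleR_2)
  then show ?thesis
    using * unfolding n by simp
qed

text \<open>At an interior maximum of \<open>\<phi> - \<theta> \<bar>f - y\<bar>\<^sup>2\<close> the gradient of \<open>\<phi>\<close> is small and so is its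
  Laplacian, which is the normal derivative of \<open>\<phi>\<close> along the trace of the second fundamental form.\<close>

context immersed_patch
begin

lemma penalised_height_max:
  fixes e y :: 'b
  assumes u: "u \<in> S'" and S': "open S'" "S' \<subseteq> S" and \<theta>: "\<theta> \<ge> 0"
    and max: "\<And>v. v \<in> S' \<Longrightarrow> f v \<bullet> e - \<theta> * (norm (f v - y))\<^sup>2 \<le> f u \<bullet> e - \<theta> * (norm (f u - y))\<^sup>2"
    and H: "2 *\<^sub>R mean_curvature f u = c *\<^sub>R normal_part f u e" and c: "c \<ge> 0" and e: "norm e = 1"
    and \<rho>: "2 * \<theta> * norm (f u - y) \<le> \<rho>"
  shows "c * (1 - \<rho>\<^sup>2 - \<rho>) \<le> 4 * \<theta>"
proof -
  have uS: "u \<in> S"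
    using u S' by blast
  let ?X = "\<lambda>i. pdiff i f u" and ?XX = "\<lambda>i j. pdiff i (pdiff j f) u"
  \<comment> \<open>The gradient in the ambient space of the penalised height. At the maximum it is
    normal to the surface, so only normal parts of second derivatives contribute when paired with
    it.\<close>
  define q where "q = e - (2 * \<theta>) *\<^sub>R (f u - y)"
  define D where "D v w = (tangent_vector f v w) \<bullet> (e - (2 * \<theta>) *\<^sub>R (f v - y))"
    for v and w :: "real^2"
  have dF: "((\<lambda>v. f v \<bullet> e - \<theta> * (norm (f v - y))\<^sup>2) has_derivative D v) (at v)" if "v \<in> S'" for v
  proof -
    have "v \<in> S"
      using that S' by blast
    note [derivative_intros] = has_derivative_pdiff[OF differentiable[OF this]]
    show ?thesis
      unfolding power2_norm_eq_inner
      by (rule derivative_eq_intros refl)+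
         (auto simp: D_def inner_simps inner_commute algebra_simps)
  qed
  define H2 where "H2 w x = (x$1 *\<^sub>R (w$1 *\<^sub>R ?XX 1 1 + w$2 *\<^sub>R ?XX 1 2) + x$2 *\<^sub>R (w$1 *\<^sub>R ?XX 2 1 + w$2 *\<^sub>R ?XX 2 2)) \<bullet> q
     - 2 * \<theta> * ((w$1 *\<^sub>R ?X 1 + w$2 *\<^sub>R ?X 2) \<bullet> (x$1 *\<^sub>R ?X 1 + x$2 *\<^sub>R ?X 2))" for w x :: "real^2"
  have dD: "((\<lambda>v. D v w) has_derivative H2 w) (at u)" for w
  proof -
    note [derivative_intros] = has_derivative_pdiff[OF differentiable[OF uS]]
      has_derivative_pdiff[OF differentiable_pdiff[OF uS]]
    show ?thesis
      unfolding D_def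
      by (rule derivative_eq_intros refl)+
         (auto simp: H2_def q_def inner_simps inner_commute algebra_simps)
  qed
  note test = second_derivative_test[OF S'(1) u dF dD max]
  have D0: "(w$1 *\<^sub>R ?X 1 + w$2 *\<^sub>R ?X 2) \<bullet> q = 0" for w :: "real^2"
    using fun_cong[OF test(1)] by (simp add: D_def q_def)
  then have grad: "\<tau> \<bullet> q = 0" if "\<tau> \<in> tangent_plane f u" for \<tau>
    using that unfolding tangent_plane_eq[OF uS] by auto
  have hess: "(w$1)\<^sup>2 * (?XX 1 1 \<bullet> q) + 2 * w$1 * w$2 * (?XX 1 2 \<bullet> q) + (w$2)\<^sup>2 * (?XX 2 2 \<bullet> q)
      \<le> 2 * \<theta> * ((w$1)\<^sup>2 * (?X 1 \<bullet> ?X 1) + 2 * w$1 * w$2 * (?X 1 \<bullet> ?X 2) + (w$2)\<^sup>2 * (?X 2 \<bullet> ?X 2))"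
    for w :: "real^2"
    using test(2)[of w] unfolding H2_def mixed_commute[OF uS, of 2 1]
    by (simp add: inner_simps inner_commute algebra_simps power2_eq_square)
  let ?h11 = "?X 1 \<bullet> ?X 1" and ?h12 = "?X 1 \<bullet> ?X 2" and ?h22 = "?X 2 \<bullet> ?X 2"
  have pos: "?h11 > 0" "metric_det u > 0"
    using metric_pos[OF uS] by auto
  \<comment> \<open>The coordinate vectors (1, 0) and (-h12, h11) are orthogonal for the induced
    metric. Adding the Hessian inequality for the first, weighted by the determinant, to that for
    the second gives h11 times the determinant times the trace, so no orthonormal frame is
    needed.\<close>
  have 1: "?XX 1 1 \<bullet> q \<le> 2 * \<theta> * ?h11"
    using hess[of "vector [1, 0]"] by simp
  have 2: "?h12\<^sup>2 * (?XX 1 1 \<bullet> q) - 2 * ?h12 * ?h11 * (?XX 1 2 \<bullet> q) + ?h11\<^sup>2 * (?XX 2 2 \<bullet> q)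
     \<le> 2 * \<theta> * (?h11 * metric_det u)"
    using hess[of "vector [- ?h12, ?h11]"] unfolding metric_det_def
    by (simp add: power2_eq_square algebra_simps)
  have "?h11 * (?h22 * (?XX 1 1 \<bullet> q) - 2 * ?h12 * (?XX 1 2 \<bullet> q) + ?h11 * (?XX 2 2 \<bullet> q))
    = metric_det u * (?XX 1 1 \<bullet> q) + (?h12\<^sup>2 * (?XX 1 1 \<bullet> q) - 2 * ?h12 * ?h11 * (?XX 1 2 \<bullet> q) + ?h11\<^sup>2 * (?XX 2 2 \<bullet> q))"
    unfolding metric_det_def by algebra
  also have "\<dots> \<le> metric_det u * (2 * \<theta> * ?h11) + 2 * \<theta> * (?h11 * metric_det u)"
    using 1 2 pos by (intro add_mono mult_left_mono) auto
  also have "\<dots> = ?h11 * (4 * \<theta> * metric_det u)"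
    by simp
  finally have lap: "?h22 * (?XX 1 1 \<bullet> q) - 2 * ?h12 * (?XX 1 2 \<bullet> q) + ?h11 * (?XX 2 2 \<bullet> q) \<le> 4 * \<theta> * metric_det u"
    using pos by simp
  have A: "second_fundamental_form f i j u \<bullet> q = ?XX i j \<bullet> q" for i j
    using D0[of "vector [tangential_coeff 1 u (?XX i j), tangential_coeff 2 u (?XX i j)]"]
    unfolding second_fundamental_form_def normal_part_eq[OF uS] by (simp add: inner_diff_left)
  define N where "N = normal_part f u e"
  have "c * (N \<bullet> q) = (2 *\<^sub>R mean_curvature f u) \<bullet> q"
    unfolding H N_def by simp
  also have "\<dots> = (?h22 * (?XX 1 1 \<bullet> q) - 2 * ?h12 * (?XX 1 2 \<bullet> q) + ?h11 * (?XX 2 2 \<bullet> q)) / metric_det u"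
    unfolding mean_curvature_eq[OF uS] by (simp add: inner_simps A)
  also have "\<dots> \<le> 4 * \<theta>"
    using lap pos by (simp add: field_simps)
  finally have cN: "c * (N \<bullet> q) \<le> 4 * \<theta>" .
  \<comment> \<open>\<open>T\<close> is the gradient of the height on the surface. From T . q = 0
    follows |T|^2 = 2 theta T . (f u - y), so |T| is at most rho and |N|^2 at least 1 - rho^2. The
    penalty term takes at most another rho from N . q.\<close>
  define T where "T = e - N"
  have "T = tangential_coeff 1 u e *\<^sub>R ?X 1 + tangential_coeff 2 u e *\<^sub>R ?X 2"
    unfolding T_def N_def normal_part_eq[OF uS] by simp
  then have Tq: "T \<bullet> q = 0" and TN: "N \<bullet> T = 0"
    using D0[of "vector [tangential_coeff 1 u e, tangential_coeff 2 u e]"] normal_part_inner_pdiff[OF uS]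
    by (simp_all add: N_def inner_simps)
  have eTN: "e = T + N"
    by (simp add: T_def)
  have "T \<bullet> T = (2 * \<theta>) * (T \<bullet> (f u - y))"
    using Tq TN unfolding q_def by (simp add: inner_simps eTN inner_commute)
  also have "\<dots> \<le> 2 * \<theta> * (norm T * norm (f u - y))"
    using \<theta> by (intro mult_left_mono norm_cauchy_schwarz) auto
  also have "\<dots> \<le> \<rho> * norm T"
    using mult_right_mono[OF \<rho>, of "norm T"] by (simp add: ac_simps)
  finally have "norm T * norm T \<le> \<rho> * norm T"
    by (simp add: dot_square_norm power2_eq_square)
  moreover have "\<rho> \<ge> 0"
    using \<rho> \<theta> by (meson mult_nonneg_nonneg norm_ge_zero order_trans zero_le_numeral)
  ultimately have nT: "norm T \<le> \<rho>"
    by (metis mult_le_cancel_right norm_ge_zero not_le order_le_less)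
  have "1 = (norm T)\<^sup>2 + (norm N)\<^sup>2"
    using e TN eTN norm_add_Pythagorean[of T N] by (simp add: orthogonal_def inner_commute)
  moreover have "(norm T)\<^sup>2 \<le> \<rho>\<^sup>2" "(norm T)\<^sup>2 \<ge> 0"
    using power_mono[OF nT, of 2] by simp_all
  ultimately have nN: "(norm N)\<^sup>2 \<ge> 1 - \<rho>\<^sup>2" and "(norm N)\<^sup>2 \<le> 1\<^sup>2"
    unfolding one_power2 by linarith+
  from this(2) have nN1: "norm N \<le> 1"
    by (rule power2_le_imp_le) simp
  have "N \<bullet> q = (norm N)\<^sup>2 - 2 * \<theta> * (N \<bullet> (f u - y))"
    unfolding q_def eTN using TN by (simp add: inner_simps power2_norm_eq_inner)
  moreover have "2 * \<theta> * (N \<bullet> (f u - y)) \<le> \<rho>"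
  proof -
    have "2 * \<theta> * (N \<bullet> (f u - y)) \<le> 2 * \<theta> * (1 * norm (f u - y))"
      using \<theta> nN1 by (intro mult_left_mono order_trans[OF norm_cauchy_schwarz] mult_right_mono) auto
    then show ?thesis
      using \<rho> by simp
  qed
  ultimately have "1 - \<rho>\<^sup>2 - \<rho> \<le> N \<bullet> q"
    using nN by linarith
  then show ?thesis
    using cN c mult_left_mono by fastforce
qed

lemma norm_second_fundamental_form_le:
  assumes u: "u \<in> S" and K: "\<kappa> \<le> gaussian_curvature (induced_metric f) u"
    and H: "norm (2 *\<^sub>R mean_curvature f u) \<le> c" and C: "C \<ge> 0" "C\<^sup>2 \<ge> c\<^sup>2 - 2 * \<kappa>"
  shows "norm (second_form f u w1 w2 z1 z2)
    \<le> C * norm (tangent_combination f u w1 w2) * norm (tangent_combination f u z1 z2)"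
proof (rule norm_second_form_le[OF metric_det_def metric_pos(3)[OF u] metric_pos(1)[OF u] _ _ C])
  show "norm ((1 / metric_det u) *\<^sub>R ((pdiff 2 f u \<bullet> pdiff 2 f u) *\<^sub>R second_fundamental_form f 1 1 u
      - (2 * (pdiff 1 f u \<bullet> pdiff 2 f u)) *\<^sub>R second_fundamental_form f 1 2 u
      + (pdiff 1 f u \<bullet> pdiff 1 f u) *\<^sub>R second_fundamental_form f 2 2 u)) \<le> c"
    using H unfolding mean_curvature_eq[OF u] .
  show "\<kappa> * metric_det u \<le> second_fundamental_form f 1 1 u \<bullet> second_fundamental_form f 2 2 u
      - second_fundamental_form f 1 2 u \<bullet> second_fundamental_form f 1 2 u"
    unfolding gauss_equation[OF u, symmetric] using K metric_pos(3)[OF u] by (intro mult_right_mono) auto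
qed

end

section \<open>Charts and tangent planes\<close>

locale projected_patch = immersed_patch f S
  for f :: "real^2 \<Rightarrow> 'b::euclidean_space" and S +
  fixes \<pi> :: "'b \<Rightarrow> real^2"
  assumes linear_proj: "linear \<pi>" and norm_proj: "norm (\<pi> y) \<le> norm y"
begin

definition proj_det :: "real^2 \<Rightarrow> real" where
  "proj_det u = \<pi> (pdiff 1 f u) $ 1 * \<pi> (pdiff 2 f u) $ 2 - \<pi> (pdiff 1 f u) $ 2 * \<pi> (pdiff 2 f u) $ 1"

text \<open>By Cramer's rule these are the coordinates of the tangent vector with projection \<open>a\<close>.\<close>

definition lift1 :: "real^2 \<Rightarrow> real^2 \<Rightarrow> real" where
  "lift1 a u = (a$1 * \<pi> (pdiff 2 f u) $ 2 - a$2 * \<pi> (pdiff 2 f u) $ 1) / proj_det u"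

definition lift2 :: "real^2 \<Rightarrow> real^2 \<Rightarrow> real" where
  "lift2 a u = (\<pi> (pdiff 1 f u) $ 1 * a$2 - \<pi> (pdiff 1 f u) $ 2 * a$1) / proj_det u"

text \<open>This is the directional derivative along \<open>a\<close> of the map whose image is the
  graph, see \<open>section_derivative\<close>. Its own derivative therefore measures the turning of
  the tangent planes.\<close>

definition frame :: "real^2 \<Rightarrow> real^2 \<Rightarrow> 'b" where
  "frame a u = lift1 a u *\<^sub>R pdiff 1 f u + lift2 a u *\<^sub>R pdiff 2 f u"

lemmas proj_simps = linear_add[OF linear_proj] linear_scale[OF linear_proj] linear_diff[OF linear_proj]

lemma bounded_linear_proj: "bounded_linear \<pi>"
  using linear_proj linear_conv_bounded_linear by blast

lemma has_derivative_proj_component: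
  assumes "(h has_derivative h') F"
  shows "((\<lambda>v. \<pi> (h v) $ i) has_derivative (\<lambda>v. \<pi> (h' v) $ i)) F"
  by (intro bounded_linear.has_derivative[OF bounded_linear_vec_nth]
      bounded_linear.has_derivative[OF bounded_linear_proj] assms)

lemma differentiable_proj_component:
  "h differentiable F \<Longrightarrow> (\<lambda>v. \<pi> (h v) $ i) differentiable F"
  unfolding differentiable_def using has_derivative_proj_component by blast

lemma proj_det_nonzero:
  assumes "\<And>w::real^2. \<pi> (tangent_vector f u w) = 0 \<Longrightarrow> w = 0"
  shows "proj_det u \<noteq> 0"
proof
  assume 0: "proj_det u = 0"
  let ?p = "\<pi> (pdiff 1 f u)" and ?q = "\<pi> (pdiff 2 f u)"
  have *: "a = 0 \<and> b = 0" if "a *\<^sub>R ?p + b *\<^sub>R ?q = 0" for a b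
  proof -
    have "vector [a, b] = (0 :: real^2)"
      by (rule assms) (use that in \<open>simp add: proj_simps\<close>)
    then show ?thesis
      by (simp add: vec_eq_iff forall_2)
  qed
  \<comment> \<open>If the determinant vanishes, (q2, -p2) and (q1, -p1) are mapped to zero, so by
    injectivity both columns p and q vanish, which contradicts injectivity once more.\<close>
  have "?q$2 = 0 \<and> - ?p$2 = 0"
    by (rule *) (use 0 in \<open>simp add: vec_eq_iff forall_2 proj_det_def algebra_simps\<close>)
  moreover have "?q$1 = 0 \<and> - ?p$1 = 0"
    by (rule *) (use 0 in \<open>simp add: vec_eq_iff forall_2 proj_det_def algebra_simps\<close>)
  ultimately have "?p = 0"
    by (simp add: vec_eq_iff forall_2)
  then show False
    using *[of 1 0] by simp
qed

lemma proj_frame: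
  assumes "proj_det u \<noteq> 0"
  shows "\<pi> (frame a u) = a"
proof -
  let ?p = "\<pi> (pdiff 1 f u)" and ?q = "\<pi> (pdiff 2 f u)"
  have "proj_det u * (lift1 a u * ?p$i + lift2 a u * ?q$i) = proj_det u * a$i" for i
  proof -
    have l: "proj_det u * lift1 a u = a$1 * ?q$2 - a$2 * ?q$1" "proj_det u * lift2 a u = ?p$1 * a$2 - ?p$2 * a$1"
      using assms by (simp_all add: lift1_def lift2_def)
    have "proj_det u * (lift1 a u * ?p$i + lift2 a u * ?q$i)
        = (a$1 * ?q$2 - a$2 * ?q$1) * ?p$i + (?p$1 * a$2 - ?p$2 * a$1) * ?q$i"
      unfolding l[symmetric] by algebra
    also have "\<dots> = proj_det u * a$i"
      using exhaust_2[of i] unfolding proj_det_def by (auto simp: algebra_simps)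
    finally show ?thesis .
  qed
  then show ?thesis
    using assms by (simp add: frame_def proj_simps vec_eq_iff)
qed

lemma lift_unique:
  fixes w :: "real^2"
  assumes "proj_det u \<noteq> 0" "\<pi> (tangent_vector f u w) = a"
  shows "w$1 = lift1 a u" "w$2 = lift2 a u"
proof -
  let ?p = "\<pi> (pdiff 1 f u)" and ?q = "\<pi> (pdiff 2 f u)"
  have a: "a$i = w$1 * ?p$i + w$2 * ?q$i" for i
    using assms(2) by (auto simp: proj_simps)
  have "w$1 * proj_det u = a$1 * ?q$2 - a$2 * ?q$1" "w$2 * proj_det u = ?p$1 * a$2 - ?p$2 * a$1"
    unfolding a proj_det_def by algebra+
  then show "w$1 = lift1 a u" "w$2 = lift2 a u"
    using assms(1) by (simp_all add: lift1_def lift2_def field_simps)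
qed

lemma continuous_on_proj_det: "continuous_on S proj_det"
  unfolding proj_det_def
  using smooth_map_on_continuous_on[OF smooth_map_on_pdiff[OF smooth]]
  by (intro continuous_intros linear_continuous_on_compose[OF _ linear_proj]) auto

lemma open_proj_det: "open {u \<in> S. proj_det u \<noteq> 0}"
  using continuous_open_preimage[OF continuous_on_proj_det open_S open_Compl[OF closed_singleton[of 0]]]
  by (simp add: vimage_def Int_def conj_commute)

lemma differentiable_lift:
  assumes "u \<in> S" "proj_det u \<noteq> 0"
  shows "lift1 a differentiable (at u)" "lift2 a differentiable (at u)"
proof -
  have c: "(\<lambda>v. \<pi> (pdiff i f v) $ j) differentiable (at u)" for i j
    by (rule differentiable_proj_component[OF differentiable_pdiff[OF assms(1)]])
  have d: "proj_det differentiable (at u)"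
    unfolding proj_det_def[abs_def] by (intro differentiable_diff differentiable_mult c)
  show "lift1 a differentiable (at u)" "lift2 a differentiable (at u)"
    unfolding lift1_def[abs_def] lift2_def[abs_def]
    by (intro differentiable_divide differentiable_diff differentiable_mult c d differentiable_const assms)+
qed

text \<open>As \<open>\<pi> \<circ> frame a\<close> is constant, the tangential part of the derivative of the frame is
  determined by its normal part, which is given by the second fundamental form.\<close>

lemma frame_derivative_bound:
  assumes u: "u \<in> S"
    and graphical: "\<And>w::real^2. norm (tangent_vector f u w)
          \<le> 2 * norm (\<pi> (tangent_vector f u w))"
    and A: "\<And>w1 w2 z1 z2. norm (second_form f u w1 w2 z1 z2)
    \<le> C * norm (tangent_combination f u w1 w2) * norm (tangent_combination f u z1 z2)"
  obtains Y where "(frame a has_derivative Y) (at u)"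
    "\<And>w. norm (Y w) \<le> 3 * C * norm (frame a u) * norm (tangent_vector f u w)"
proof -
  let ?X = "\<lambda>i. pdiff i f u" and ?XX = "\<lambda>i j. pdiff i (pdiff j f) u" and ?A = "\<lambda>i j. second_fundamental_form f i j u"
  have pd: "proj_det u \<noteq> 0"
  proof (rule proj_det_nonzero)
    fix w :: "real^2"
    assume "\<pi> (w$1 *\<^sub>R ?X 1 + w$2 *\<^sub>R ?X 2) = 0"
    then show "w = 0"
      using graphical[of w] derivative_eq_0_iff[OF u, of w] by simp
  qed
  obtain L1 L2 where L: "(lift1 a has_derivative L1) (at u)" "(lift2 a has_derivative L2) (at u)"
    using differentiable_lift[OF u pd] unfolding differentiable_def by blast
  define Y where "Y w = lift1 a u *\<^sub>R (w$1 *\<^sub>R ?XX 1 1 + w$2 *\<^sub>R ?XX 2 1) + L1 w *\<^sub>R ?X 1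
      + (lift2 a u *\<^sub>R (w$1 *\<^sub>R ?XX 1 2 + w$2 *\<^sub>R ?XX 2 2) + L2 w *\<^sub>R ?X 2)" for w :: "real^2"
  have Y: "(frame a has_derivative Y) (at u)"
    unfolding frame_def[abs_def] Y_def[abs_def]
    by (intro has_derivative_add has_derivative_scaleR L has_derivative_pdiff differentiable_pdiff[OF u])
  have "norm (Y w) \<le> 3 * C * norm (frame a u) * norm (w$1 *\<^sub>R ?X 1 + w$2 *\<^sub>R ?X 2)" for w
  proof -
    have "((\<lambda>v. \<pi> (frame a v)) has_derivative (\<lambda>w. \<pi> (Y w))) (at u)"
      by (rule bounded_linear.has_derivative[OF bounded_linear_proj Y])
    moreover have "((\<lambda>v. \<pi> (frame a v)) has_derivative (\<lambda>w. 0)) (at u)"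
      by (rule has_derivative_transform_within_open[OF has_derivative_const[of a] open_proj_det])
        (use u pd in \<open>auto simp: proj_frame\<close>)
    ultimately have "(\<lambda>w. \<pi> (Y w)) = (\<lambda>w. 0)"
      using has_derivative_unique by blast
    then have \<pi>Y: "\<pi> (Y w) = 0"
      by (rule fun_cong)
    define N where "N = (lift1 a u * w$1) *\<^sub>R ?A 1 1 + (lift1 a u * w$2 + lift2 a u * w$1) *\<^sub>R ?A 1 2
        + (lift2 a u * w$2) *\<^sub>R ?A 2 2"
    define z :: "real^2" where "z = vector
      [lift1 a u * w$1 * tangential_coeff 1 u (?XX 1 1) + (lift1 a u * w$2 + lift2 a u * w$1) * tangential_coeff 1 u (?XX 1 2)
         + lift2 a u * w$2 * tangential_coeff 1 u (?XX 2 2) + L1 w,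
       lift1 a u * w$1 * tangential_coeff 2 u (?XX 1 1) + (lift1 a u * w$2 + lift2 a u * w$1) * tangential_coeff 2 u (?XX 1 2)
         + lift2 a u * w$2 * tangential_coeff 2 u (?XX 2 2) + L2 w]"
    have YN: "Y w - N = z$1 *\<^sub>R ?X 1 + z$2 *\<^sub>R ?X 2"
      unfolding Y_def N_def z_def second_fundamental_form_def normal_part_eq[OF u] mixed_commute[OF u, of 2 1]
      by (simp add: algebra_simps)
    \<comment> \<open>\<open>Y w - N\<close> is tangent with coordinates \<open>z\<close>. Since
      \<open>Y w\<close> projects to 0, the slope bound gives |Y w - N| <= 2 |N|; together with
      \<open>N\<close> itself this is the factor 3.\<close>
    have "norm (Y w - N) \<le> 2 * norm (\<pi> (Y w - N))"
      unfolding YN by (rule graphical)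
    also have "\<dots> = 2 * norm (\<pi> N)"
      by (simp add: proj_simps \<pi>Y)
    also have "\<dots> \<le> 2 * norm N"
      using norm_proj by simp
    finally have "norm (Y w) \<le> 3 * norm N"
      using norm_triangle_sub[of "Y w" N] by simp
    also have "norm N \<le> C * norm (frame a u) * norm (w$1 *\<^sub>R ?X 1 + w$2 *\<^sub>R ?X 2)"
      unfolding N_def frame_def by (rule A)
    finally show ?thesis
      by simp
  qed
  with Y show thesis
    by (rule that)
qed

end

section \<open>Surfaces with an atlas and their tangent planes\<close>

locale immersed_surface =
  fixes L :: "'a topology" and A :: "'a chart set" and g :: "'a \<Rightarrow> 'b::euclidean_space"
  assumes surface: "smooth_surface L A" and immersion: "immersion A g"
begin

lemma chart:
  assumes "(U, x) \<in> A"
  shows chart_openin: "openin L U" and chart_open_image: "open (x ` U)"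
    and chart_homeomorphic: "homeomorphic_map (subtopology L U) (top_of_set (x ` U)) x"
    and chart_subset: "U \<subseteq> topspace L" and chart_inj: "inj_on x U"
  using surface assms unfolding smooth_surface_def smooth_atlas_def
  by (auto dest!: bspec[of A _ "(U, x)"] openin_subset homeomorphic_imp_injective_map
      simp: Int_absorb1 topspace_subtopology)

lemma chart_inverse [simp]:
  assumes "(U, x) \<in> A"
  shows "p \<in> U \<Longrightarrow> inv_into U x (x p) = p" "u \<in> x ` U \<Longrightarrow> inv_into U x u \<in> U"
    "u \<in> x ` U \<Longrightarrow> x (inv_into U x u) = u"
  using chart_inj[OF assms] by (simp_all add: inv_into_into f_inv_into_f)

lemma exists_chart:
  assumes "p \<in> topspace L"
  obtains U x where "(U, x) \<in> A" "p \<in> U"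
  using surface assms unfolding smooth_surface_def smooth_atlas_def by fastforce

lemma continuous_map_chart:
  assumes "(U, x) \<in> A"
  shows "continuous_map (subtopology L U) euclidean x"
  using homeomorphic_imp_continuous_map[OF chart_homeomorphic[OF assms]]
  by (simp add: continuous_map_in_subtopology)

lemma continuous_map_chart_inverse:
  assumes "(U, x) \<in> A"
  shows "continuous_map (top_of_set (x ` U)) L (inv_into U x)"
proof -
  obtain y where y: "homeomorphic_maps (subtopology L U) (top_of_set (x ` U)) x y"
    using chart_homeomorphic[OF assms] homeomorphic_map_maps by blast
  then have "continuous_map (top_of_set (x ` U)) L y"
    by (simp add: homeomorphic_maps_def continuous_map_in_subtopology)
  moreover have "y u = inv_into U x u" if u: "u \<in> x ` U" for u
  proof -
    obtain p where "p \<in> U" "u = x p"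
      using u by blast
    then show ?thesis
      using y chart_inverse(1)[OF assms] chart_subset[OF assms] by (auto simp: homeomorphic_maps_def)
  qed
  ultimately show ?thesis
    by (rule continuous_map_eq) simp
qed

lemma openin_chart_preimage:
  assumes "(U, x) \<in> A" "open O'"
  shows "openin L {p \<in> U. x p \<in> O'}"
proof -
  have "openin (subtopology L U) {p \<in> topspace (subtopology L U). x p \<in> O'}"
    using openin_continuous_map_preimage[OF continuous_map_chart[OF assms(1)]] assms(2) by simp
  then show ?thesis
    using chart_openin[OF assms(1)] chart_subset[OF assms(1)]
    by (simp add: openin_open_subtopology Int_absorb1 topspace_subtopology_subset)
qed

lemma open_chart_image:
  assumes "(U, x) \<in> A" "openin L V" "V \<subseteq> U"
  shows "open (x ` V)"
proof -
  have "openin (subtopology L U) V"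
    using assms(2,3) chart_openin[OF assms(1)] by (simp add: openin_open_subtopology)
  then have "openin (top_of_set (x ` U)) (x ` V)"
    using homeomorphic_map_openness_eq[OF chart_homeomorphic[OF assms(1)]] by blast
  then show ?thesis
    using chart_open_image[OF assms(1)] openin_open_eq by blast
qed

lemma immersed_patch_chart:
  assumes "(U, x) \<in> A"
  shows "immersed_patch (local_rep g (U, x)) (x ` U)"
  using immersion assms chart_open_image[OF assms] unfolding immersion_def
  by unfold_locales (auto dest!: bspec[of A _ "(U, x)"])

lemma local_rep_chart [simp]: "(U, x) \<in> A \<Longrightarrow> p \<in> U \<Longrightarrow> local_rep g (U, x) (x p) = g p"
  by (simp add: local_rep_def)

text \<open>The union is over planes that all coincide, by \<open>tangent_plane_transition\<close>;
  it names the tangent plane without choosing a chart.\<close>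

definition tangent_at :: "'a \<Rightarrow> 'b set" where
  "tangent_at p = (\<Union>(U, x)\<in>{(U, x) \<in> A. p \<in> U}. tangent_plane (local_rep g (U, x)) (x p))"

text \<open>Near \<open>x p\<close> the representation in the first chart is the one in the second
  chart after the transition map, so the chain rule gives the inclusion. Exchanging the charts gives
  equality.\<close>

lemma tangent_plane_transition:
  assumes U: "(U, x) \<in> A" "p \<in> U" and V: "(V, y) \<in> A" "p \<in> V"
  shows "tangent_plane (local_rep g (U, x)) (x p) \<subseteq> tangent_plane (local_rep g (V, y)) (y p)"
proof -
  interpret P: immersed_patch "local_rep g (U, x)" "x ` U"
    by (rule immersed_patch_chart[OF U(1)])
  interpret Q: immersed_patch "local_rep g (V, y)" "y ` V"
    by (rule immersed_patch_chart[OF V(1)])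
  let ?t = "y \<circ> inv_into U x"
  have "smooth_map_on ?t (x ` (U \<inter> V))"
    using surface U(1) V(1) unfolding smooth_surface_def smooth_atlas_def by fast
  then have t: "(?t has_derivative frechet_derivative ?t (at (x p))) (at (x p))"
    using smooth_map_on_differentiable[of ?t _ "x p"] U(2) V(2) frechet_derivative_works by blast
  have tp: "?t (x p) = y p"
    using U by simp
  have "(local_rep g (V, y) has_derivative frechet_derivative (local_rep g (V, y)) (at (y p))) (at (?t (x p)))"
    unfolding tp using Q.differentiable V(2) frechet_derivative_works by blast
  from has_derivative_compose[OF t this]
  have "((\<lambda>v. local_rep g (V, y) (?t v)) has_derivative
      (\<lambda>w. frechet_derivative (local_rep g (V, y)) (at (y p)) (frechet_derivative ?t (at (x p)) w))) (at (x p))" .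
  moreover have "openin L (U \<inter> V)"
    using chart_openin U(1) V(1) by blast
  then have "open (x ` (U \<inter> V))"
    by (rule open_chart_image[OF U(1)]) simp
  moreover have "local_rep g (V, y) (?t v) = local_rep g (U, x) v" if "v \<in> x ` (U \<inter> V)" for v
    using that U(1) V(1) by auto
  ultimately have "(local_rep g (U, x) has_derivative
      (\<lambda>w. frechet_derivative (local_rep g (V, y)) (at (y p)) (frechet_derivative ?t (at (x p)) w))) (at (x p))"
    using has_derivative_transform_within_open U(2) V(2) by blast
  then show ?thesis
    unfolding tangent_plane_def by (simp add: frechet_derivative_at[symmetric] image_subsetI)
qed

lemma tangent_at_eq:
  assumes "(U, x) \<in> A" "p \<in> U"
  shows "tangent_at p = tangent_plane (local_rep g (U, x)) (x p)"
  unfolding tangent_at_def using assms tangent_plane_transition by fast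

end

section \<open>Curves and the induced distance\<close>

text \<open>The derivatives are two-sided and at \<open>a\<close> and \<open>b\<close> also see
  values outside the interval, where the functions may differ. Both endpoints are therefore added to
  the finite exceptional set.\<close>

lemma piecewise_C1_differentiable_on_cong:
  fixes f h :: "real \<Rightarrow> 'b::real_normed_vector"
  assumes f: "f piecewise_C1_differentiable_on {a..b}" and eq: "\<And>t. t \<in> {a..b} \<Longrightarrow> f t = h t"
  shows "h piecewise_C1_differentiable_on {a..b}"
proof -
  obtain S where S: "continuous_on {a..b} f" "finite S" "f C1_differentiable_on ({a..b} - S)"
    using f unfolding piecewise_C1_differentiable_on_def by blast
  obtain D where D: "\<forall>t\<in>{a..b} - S. (f has_vector_derivative D t) (at t)" "continuous_on ({a..b} - S) D"
    using S(3) unfolding C1_differentiable_on_def by (elim exE conjE) (rule that)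
  have "(h has_vector_derivative D t) (at t)" if "t \<in> {a..b} - (S \<union> {a, b})" for t
  proof -
    have t: "t \<in> {a<..<b}" "t \<in> {a..b} - S"
      using that by auto
    show ?thesis
      by (rule has_vector_derivative_transform_within_open[OF bspec[OF D(1) t(2)] open_greaterThanLessThan t(1)])
        (use eq in simp)
  qed
  moreover have "continuous_on ({a..b} - (S \<union> {a, b})) D"
    by (rule continuous_on_subset[OF D(2)]) auto
  ultimately have "h C1_differentiable_on ({a..b} - (S \<union> {a, b}))"
    unfolding C1_differentiable_on_def by (intro exI[of _ D]) simp
  moreover have "continuous_on {a..b} h"
    by (rule continuous_on_eq[OF S(1) eq])
  ultimately show ?thesis
    unfolding piecewise_C1_differentiable_on_def using S(2)
    by (intro conjI exI[of _ "S \<union> {a, b}"]) simp_all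
qed

lemma has_vector_derivative_affine_reparam:
  fixes h :: "real \<Rightarrow> 'b::real_normed_vector"
  assumes "(h has_vector_derivative D) (at (m * t + k))" "open J" "t \<in> J" "\<And>s. s \<in> J \<Longrightarrow> f s = h (m * s + k)"
  shows "(f has_vector_derivative m *\<^sub>R D) (at t)"
proof -
  have "((\<lambda>s. m * s + k) has_vector_derivative m) (at t)"
    by (auto intro!: derivative_eq_intros)
  from vector_diff_chain_at[OF this assms(1)]
  have "((\<lambda>s. h (m * s + k)) has_vector_derivative m *\<^sub>R D) (at t)"
    by (simp add: o_def)
  then show ?thesis
    by (rule has_vector_derivative_transform_within_open[OF _ assms(2,3)]) (simp add: assms(4))
qed

text \<open>Used for the two halves of a concatenated curve. Where a derivative does not exist,
  \<open>vector_derivative\<close> is an arbitrary value, so the speeds are compared only off the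
  finite set \<open>S'\<close> and integrability is transferred across it.\<close>

lemma integrable_speed_affine_reparam:
  fixes h f :: "real \<Rightarrow> 'b::real_normed_vector"
  assumes int: "(\<lambda>t. norm (vector_derivative h (at t))) integrable_on {0..1}"
    and m: "m > 0" and ab: "m * a + k = 0" "m * b + k = 1"
    and S: "finite S" "\<And>t. t \<in> {0<..<1} - S \<Longrightarrow> h differentiable (at t)"
    and f: "\<And>t. t \<in> {a<..<b} \<Longrightarrow> f t = h (m * t + k)"
  obtains S' where "finite S'" "\<And>t. t \<in> {a<..<b} - S' \<Longrightarrow> f differentiable (at t)"
    "(\<lambda>t. norm (vector_derivative f (at t))) integrable_on {a..b}"
proof -
  define S' where "S' = (\<lambda>t. (t - k) / m) ` (S \<union> {0, 1})"
  have mem: "m * t + k \<in> {0<..<1} - S" "t \<in> {a<..<b}" if "t \<in> {a..b} - S'" for t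
  proof -
    have "m * t + k \<notin> S \<union> {0, 1}"
    proof
      assume "m * t + k \<in> S \<union> {0, 1}"
      then have "((m * t + k) - k) / m \<in> S'"
        unfolding S'_def by blast
      then show False
        using that m by simp
    qed
    moreover have "m * a + k \<le> m * t + k" "m * t + k \<le> m * b + k"
      using that m by auto
    ultimately show *: "m * t + k \<in> {0<..<1} - S"
      unfolding ab by (auto simp: order_le_less)
    then have "t \<noteq> a" "t \<noteq> b"
      using ab by auto
    then show "t \<in> {a<..<b}"
      using that by auto
  qed
  have D: "(f has_vector_derivative m *\<^sub>R vector_derivative h (at (m * t + k))) (at t)" if "t \<in> {a..b} - S'" for t
    by (rule has_vector_derivative_affine_reparam[OF
          vector_derivative_works[THEN iffD1, OF S(2)[OF mem(1)[OF that]]] open_greaterThanLessThan mem(2)[OF that]])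
      (rule f)
  have "(\<lambda>t. norm (vector_derivative h (at (m * t + k)))) integrable_on
      ((\<lambda>x. (1 / m) *\<^sub>R x + -((1/m) *\<^sub>R k)) ` cbox 0 1)"
    using integrable_affinity[of "\<lambda>t. norm (vector_derivative h (at t))" 0 1 m k] int m by simp
  moreover have "(\<lambda>x. (1 / m) *\<^sub>R x + -((1/m) *\<^sub>R k)) ` cbox 0 1 = {a..b}"
  proof -
    have "a = - k / m" "b = (1 - k) / m"
      using ab m by (auto simp: field_simps)
    then show ?thesis
      using m image_affinity_cbox[of "1/m" "-((1/m) *\<^sub>R k)" 0 "1::real"]
      by (simp add: diff_divide_distrib algebra_simps)
  qed
  ultimately have "(\<lambda>t. m *\<^sub>R norm (vector_derivative h (at (m * t + k)))) integrable_on {a..b}"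
    by (intro integrable_cmul) simp
  then have int': "(\<lambda>t. m * norm (vector_derivative h (at (m * t + k)))) integrable_on {a..b}"
    by simp
  have fin: "finite S'"
    using S(1) by (simp add: S'_def)
  have "norm (vector_derivative f (at t)) = m * norm (vector_derivative h (at (m * t + k)))"
    if "t \<in> {a..b} - S'" for t
    unfolding vector_derivative_at[OF D[OF that]] using m by simp
  from integrable_spike_finite[OF fin this int']
  have "(\<lambda>t. norm (vector_derivative f (at t))) integrable_on {a..b}" .
  moreover have "f differentiable (at t)" if "t \<in> {a<..<b} - S'" for t
    by (rule differentiableI_vector[OF D]) (use that in auto)
  ultimately show thesis
    by (intro that[OF fin])
qed

section \<open>Parametrised pieces and the lengths of their segments\<close>

context immersed_surface
begin

text \<open>In effect a C1 map from a plane open set to the surface, tested in every chart. Inverse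
  charts and graph maps are both instances, so that curves and lengths are treated once for the two
  of them.\<close>

definition smooth_param :: "(real^2) set \<Rightarrow> (real^2 \<Rightarrow> 'a) \<Rightarrow> bool" where
  "smooth_param W \<sigma> \<longleftrightarrow> open W \<and> continuous_map (top_of_set W) L \<sigma> \<and>
     (\<forall>(U, x)\<in>A. (\<forall>v\<in>W. \<sigma> v \<in> U \<longrightarrow> (x \<circ> \<sigma>) differentiable (at v)) \<and>
        (\<forall>a. continuous_on {v \<in> W. \<sigma> v \<in> U} (\<lambda>v. frechet_derivative (x \<circ> \<sigma>) (at v) a)))"

lemma smooth_param_openin:
  assumes "continuous_map (top_of_set W) L \<sigma>" "open W" "openin L V"
  shows "open {v \<in> W. \<sigma> v \<in> V}"
  using openin_continuous_map_preimage[OF assms(1,3)] assms(2) openin_open_eq by (simp add: openin_open_eq)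

lemma smooth_param_chart:
  assumes "(U, x) \<in> A"
  shows "smooth_param (x ` U) (inv_into U x)"
proof -
  have "(\<forall>v\<in>x ` U. inv_into U x v \<in> V \<longrightarrow> (y \<circ> inv_into U x) differentiable (at v)) \<and>
        (\<forall>a. continuous_on {v \<in> x ` U. inv_into U x v \<in> V} (\<lambda>v. frechet_derivative (y \<circ> inv_into U x) (at v) a))"
    if "(V, y) \<in> A" for V y
  proof -
    have "smooth_map_on (y \<circ> inv_into U x) (x ` (U \<inter> V))"
      using surface assms that unfolding smooth_surface_def smooth_atlas_def by fast
    moreover have "{v \<in> x ` U. inv_into U x v \<in> V} = x ` (U \<inter> V)"
      using assms by auto
    ultimately have *: "smooth_map_on (y \<circ> inv_into U x) {v \<in> x ` U. inv_into U x v \<in> V}"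
      by simp
    then have "times_differentiable_on (Suc 0) (y \<circ> inv_into U x) {v \<in> x ` U. inv_into U x v \<in> V}"
      unfolding smooth_map_on_def by blast
    then show ?thesis
      by simp
  qed
  then show ?thesis
    unfolding smooth_param_def using assms chart_open_image continuous_map_chart_inverse by blast
qed

lemma smooth_param_derivative:
  assumes \<sigma>: "smooth_param W \<sigma>" and v: "v \<in> W" and U: "(U, x) \<in> A" "\<sigma> v \<in> U"
  shows "((g \<circ> \<sigma>) has_derivative (\<lambda>a. frechet_derivative (local_rep g (U, x)) (at (x (\<sigma> v)))
       (frechet_derivative (x \<circ> \<sigma>) (at v) a))) (at v)"
proof -
  interpret P: immersed_patch "local_rep g (U, x)" "x ` U"
    by (rule immersed_patch_chart[OF U(1)])
  have 1: "((x \<circ> \<sigma>) has_derivative frechet_derivative (x \<circ> \<sigma>) (at v)) (at v)"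
    using \<sigma> v U frechet_derivative_works unfolding smooth_param_def by blast
  have 2: "(local_rep g (U, x) has_derivative frechet_derivative (local_rep g (U, x)) (at (x (\<sigma> v)))) (at ((x \<circ> \<sigma>) v))"
    using P.differentiable U(2) frechet_derivative_works by auto
  have "open {v \<in> W. \<sigma> v \<in> U}"
    using \<sigma> smooth_param_openin chart_openin[OF U(1)] unfolding smooth_param_def by blast
  from has_derivative_transform_within_open[OF has_derivative_compose[OF 1 2] this]
  show ?thesis
    using U v by simp
qed

lemma smooth_param_differentiable:
  assumes "smooth_param W \<sigma>" "v \<in> W"
  shows "(g \<circ> \<sigma>) differentiable (at v)"
proof -
  have "\<sigma> v \<in> topspace L"
    using assms unfolding smooth_param_def continuous_map_def by auto
  then obtain U x where "(U, x) \<in> A" "\<sigma> v \<in> U"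
    by (rule exists_chart)
  then show ?thesis
    using smooth_param_derivative[OF assms] unfolding differentiable_def by blast
qed

lemma smooth_param_continuous_derivative:
  assumes \<sigma>: "smooth_param W \<sigma>"
  shows "continuous_on W (\<lambda>v. frechet_derivative (g \<circ> \<sigma>) (at v) a)"
  unfolding continuous_on_eq_continuous_at[OF conjunct1[OF \<sigma>[unfolded smooth_param_def]]]
proof
  fix v assume v: "v \<in> W"
  have W: "open W" "continuous_map (top_of_set W) L \<sigma>"
    using \<sigma> unfolding smooth_param_def by auto
  have "\<sigma> v \<in> topspace L"
    using v W(2) unfolding continuous_map_def by auto
  then obtain U x where U: "(U, x) \<in> A" "\<sigma> v \<in> U"
    by (rule exists_chart)
  interpret P: immersed_patch "local_rep g (U, x)" "x ` U"
    by (rule immersed_patch_chart[OF U(1)])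
  let ?W = "{v \<in> W. \<sigma> v \<in> U}"
  have op: "open ?W"
    using W smooth_param_openin chart_openin[OF U(1)] by blast
  have cx: "continuous_on ?W (x \<circ> \<sigma>)"
    by (rule continuous_at_imp_continuous_on)
      (use \<sigma> U in \<open>auto simp: smooth_param_def intro!: differentiable_imp_continuous_within\<close>)
  have cd: "continuous_on ?W (\<lambda>v. frechet_derivative (x \<circ> \<sigma>) (at v) a)"
    using \<sigma> U unfolding smooth_param_def by blast
  have cf: "continuous_on ?W (\<lambda>v. pdiff i (local_rep g (U, x)) (x (\<sigma> v)))" for i
    using continuous_on_compose2[OF smooth_map_on_continuous_on[OF smooth_map_on_pdiff[OF P.smooth]] cx, of i] by auto
  have "continuous_on ?W (\<lambda>v. (frechet_derivative (x \<circ> \<sigma>) (at v) a)$1 *\<^sub>R pdiff 1 (local_rep g (U, x)) (x (\<sigma> v))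
       + (frechet_derivative (x \<circ> \<sigma>) (at v) a)$2 *\<^sub>R pdiff 2 (local_rep g (U, x)) (x (\<sigma> v)))"
    by (intro continuous_intros cd cf)
  moreover have "frechet_derivative (g \<circ> \<sigma>) (at v) a = (frechet_derivative (x \<circ> \<sigma>) (at v) a)$1 *\<^sub>R pdiff 1 (local_rep g (U, x)) (x (\<sigma> v))
       + (frechet_derivative (x \<circ> \<sigma>) (at v) a)$2 *\<^sub>R pdiff 2 (local_rep g (U, x)) (x (\<sigma> v))" if "v \<in> ?W" for v
    using frechet_derivative_at[OF smooth_param_derivative[OF \<sigma> _ U(1), of v], symmetric] that
      P.derivative_eq[of "x (\<sigma> v)"] by simp
  ultimately have "continuous_on ?W (\<lambda>v. frechet_derivative (g \<circ> \<sigma>) (at v) a)"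
    by (metis (no_types, lifting) continuous_on_cong)
  then show "isCont (\<lambda>v. frechet_derivative (g \<circ> \<sigma>) (at v) a) v"
    using op U v by (simp add: continuous_on_eq_continuous_at)
qed

lemma piecewise_C1_curveI:
  assumes "continuous_map (top_of_set {0..1}) L c"
    and "\<And>U x a b. (U, x) \<in> A \<Longrightarrow> {a..b} \<subseteq> {0..1} \<Longrightarrow> c ` {a..b} \<subseteq> U
      \<Longrightarrow> (x \<circ> c) piecewise_C1_differentiable_on {a..b}"
  shows "piecewise_C1_curve L A c"
  unfolding piecewise_C1_curve_def using assms by (auto simp del: atLeastatMost_subset_iff)

lemma smooth_param_segment:
  assumes \<sigma>: "smooth_param W \<sigma>" and seg: "closed_segment v w \<subseteq> W"
  defines "c \<equiv> \<lambda>t. \<sigma> (v + t *\<^sub>R (w - v))"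
  shows "piecewise_C1_curve L A c"
    and "\<And>t. t \<in> {0..1} \<Longrightarrow> ((g \<circ> c) has_vector_derivative
           frechet_derivative (g \<circ> \<sigma>) (at (v + t *\<^sub>R (w - v))) (w - v)) (at t)"
    and "(\<lambda>t. norm (vector_derivative (g \<circ> c) (at t))) integrable_on {0..1}"
proof -
  let ?\<gamma> = "\<lambda>t. v + t *\<^sub>R (w - v)"
  have \<gamma>W: "?\<gamma> t \<in> W" if "t \<in> {0..1}" for t
  proof -
    have "?\<gamma> t \<in> closed_segment v w"
      unfolding closed_segment_def using that by (auto simp: algebra_simps intro!: exI[of _ t])
    then show ?thesis
      using seg by blast
  qed
  have \<gamma>': "(?\<gamma> has_vector_derivative (w - v)) (at t)" for t
    by (auto intro!: derivative_eq_intros)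
  have chain: "((h \<circ> ?\<gamma>) has_vector_derivative frechet_derivative h (at (?\<gamma> t)) (w - v)) (at t)"
    if "h differentiable (at (?\<gamma> t))" for h :: "real^2 \<Rightarrow> 'c::real_normed_vector" and t
    using vector_derivative_diff_chain_within[OF \<gamma>'[of t], of h "frechet_derivative h (at (?\<gamma> t))"]
      has_derivative_at_withinI[OF frechet_derivative_works[THEN iffD1, OF that]] by simp
  have c\<gamma>: "continuous_on X ?\<gamma>" for X
    by (intro continuous_intros)
  have "continuous_map (top_of_set {0..1}) L (\<sigma> \<circ> ?\<gamma>)"
  proof (rule continuous_map_compose)
    show "continuous_map (top_of_set {0..1}) (top_of_set W) ?\<gamma>"
      using c\<gamma> \<gamma>W by (simp add: continuous_map_in_subtopology image_subset_iff)
    show "continuous_map (top_of_set W) L \<sigma>"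
      using \<sigma> unfolding smooth_param_def by blast
  qed
  moreover have "(x \<circ> c) piecewise_C1_differentiable_on {a..b}"
    if "(U, x) \<in> A" "{a..b} \<subseteq> {0..1}" "c ` {a..b} \<subseteq> U" for U x a b
  proof -
    have mem: "?\<gamma> t \<in> {v \<in> W. \<sigma> v \<in> U}" if "t \<in> {a..b}" for t
      using that \<open>{a..b} \<subseteq> {0..1}\<close> \<open>c ` {a..b} \<subseteq> U\<close> \<gamma>W unfolding c_def by blast
    have "((x \<circ> \<sigma> \<circ> ?\<gamma>) has_vector_derivative frechet_derivative (x \<circ> \<sigma>) (at (?\<gamma> t)) (w - v)) (at t)"
      if "t \<in> {a..b}" for t
      by (rule chain) (use \<sigma> \<open>(U, x) \<in> A\<close> mem[OF that] in \<open>auto simp: smooth_param_def\<close>)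
    moreover have "continuous_on {v \<in> W. \<sigma> v \<in> U} (\<lambda>v'. frechet_derivative (x \<circ> \<sigma>) (at v') (w - v))"
      using \<sigma> \<open>(U, x) \<in> A\<close> unfolding smooth_param_def by blast
    then have "continuous_on {a..b} (\<lambda>t. frechet_derivative (x \<circ> \<sigma>) (at (?\<gamma> t)) (w - v))"
      by (rule continuous_on_compose2[OF _ c\<gamma>]) (use mem in blast)
    ultimately have "(x \<circ> \<sigma> \<circ> ?\<gamma>) C1_differentiable_on {a..b}"
      unfolding C1_differentiable_on_def
      by (intro exI[of _ "\<lambda>t. frechet_derivative (x \<circ> \<sigma>) (at (?\<gamma> t)) (w - v)"]) simp
    then have "(x \<circ> \<sigma> \<circ> ?\<gamma>) piecewise_C1_differentiable_on {a..b}"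
      by (rule C1_differentiable_imp_piecewise)
    then show ?thesis
      by (simp add: c_def o_def)
  qed
  moreover have "\<sigma> \<circ> ?\<gamma> = c"
    by (simp add: c_def o_def)
  ultimately show "piecewise_C1_curve L A c"
    by (intro piecewise_C1_curveI) simp_all
  show D: "((g \<circ> c) has_vector_derivative frechet_derivative (g \<circ> \<sigma>) (at (?\<gamma> t)) (w - v)) (at t)" if "t \<in> {0..1}" for t
    using chain[OF smooth_param_differentiable[OF \<sigma> \<gamma>W[OF that]]] by (simp add: c_def o_def)
  have "continuous_on {0..1} (\<lambda>t. frechet_derivative (g \<circ> \<sigma>) (at (?\<gamma> t)) (w - v))"
    by (rule continuous_on_compose2[OF smooth_param_continuous_derivative[OF \<sigma>] c\<gamma>]) (use \<gamma>W in blast)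
  then have "continuous_on {0..1} (\<lambda>t. norm (vector_derivative (g \<circ> c) (at t)))"
    by (rule continuous_on_eq[OF continuous_on_norm]) (simp add: vector_derivative_at[OF D])
  then show "(\<lambda>t. norm (vector_derivative (g \<circ> c) (at t))) integrable_on {0..1}"
    by (rule integrable_continuous_real)
qed

lemma curve_lengths_nonneg: "len \<in> curve_lengths L A g p r \<Longrightarrow> 0 \<le> len"
  unfolding curve_lengths_def by (auto intro: integral_nonneg)

text \<open>A bound on the derivative of a parametrisation becomes one on the distance. This shows
  that the points over a convergent sequence on a ray form a Cauchy sequence.\<close>

lemma induced_dist_segment_le:
  assumes \<sigma>: "smooth_param W \<sigma>" and seg: "closed_segment v w \<subseteq> W"
    and K: "\<And>z. z \<in> closed_segment v w \<Longrightarrow> norm (frechet_derivative (g \<circ> \<sigma>) (at z) (w - v)) \<le> K"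
  shows "induced_dist L A g (\<sigma> v) (\<sigma> w) \<le> K"
proof -
  let ?c = "\<lambda>t. \<sigma> (v + t *\<^sub>R (w - v))"
  let ?len = "integral {0..1} (\<lambda>t. norm (vector_derivative (g \<circ> ?c) (at t)))"
  note c = smooth_param_segment[OF \<sigma> seg]
  have "?len \<in> curve_lengths L A g (\<sigma> v) (\<sigma> w)"
    unfolding curve_lengths_def using c(1,3) by (intro CollectI exI[of _ ?c]) simp
  moreover have "bdd_below (curve_lengths L A g (\<sigma> v) (\<sigma> w))"
    using curve_lengths_nonneg by (intro bdd_belowI)
  ultimately have "induced_dist L A g (\<sigma> v) (\<sigma> w) \<le> ?len"
    unfolding induced_dist_def by (rule cInf_lower)
  also have "?len \<le> integral {0..1::real} (\<lambda>t. K)"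
  proof (rule integral_le[OF c(3)])
    fix t :: real assume t: "t \<in> {0..1}"
    have "v + t *\<^sub>R (w - v) \<in> closed_segment v w"
      unfolding closed_segment_def using t by (auto simp: algebra_simps intro!: exI[of _ t])
    then show "norm (vector_derivative (g \<circ> ?c) (at t)) \<le> K"
      using K vector_derivative_at[OF c(2)[OF t]] by simp
  qed (rule integrable_const_ivl)
  finally show ?thesis
    by simp
qed

section \<open>Any two points are joined by a curve of finite length\<close>

lemma piecewise_C1_curve_chart:
  assumes "piecewise_C1_curve L A c" "(U, x) \<in> A" "{a..b} \<subseteq> {0..1}" "c ` {a..b} \<subseteq> U"
  shows "(x \<circ> c) piecewise_C1_differentiable_on {a..b}"
  using bspec[OF conjunct2[OF assms(1)[unfolded piecewise_C1_curve_def]] assms(2),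
      unfolded prod.case, rule_format, OF conjI[OF assms(3,4)]] .

text \<open>Needed to see that \<open>curve_lengths\<close> is nonempty, since the infimum of the
  empty set carries no information. The finite set is recorded because rescaling a curve requires to
  know where its image under \<open>g\<close> is differentiable.\<close>

definition joined :: "'a \<Rightarrow> 'a \<Rightarrow> bool" where
  "joined p r \<longleftrightarrow> (\<exists>c S. piecewise_C1_curve L A c \<and> c 0 = p \<and> c 1 = r \<and> finite S \<and>
     (\<forall>t\<in>{0<..<1} - S. (g \<circ> c) differentiable (at t)) \<and>
     (\<lambda>t. norm (vector_derivative (g \<circ> c) (at t))) integrable_on {0..1})"

lemma joined_segment:
  assumes "smooth_param W \<sigma>" "closed_segment v w \<subseteq> W"
  shows "joined (\<sigma> v) (\<sigma> w)"
proof -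
  let ?c = "\<lambda>t. \<sigma> (v + t *\<^sub>R (w - v))"
  show ?thesis
    unfolding joined_def
  proof (intro exI conjI ballI)
    show "piecewise_C1_curve L A ?c" "?c 0 = \<sigma> v" "?c 1 = \<sigma> w" "finite ({} :: real set)"
      "(\<lambda>t. norm (vector_derivative (g \<circ> ?c) (at t))) integrable_on {0..1}"
      using smooth_param_segment(1,3)[OF assms] by simp_all
    show "(g \<circ> ?c) differentiable (at t)" if "t \<in> {0<..<1} - {}" for t
      by (rule differentiableI_vector[OF smooth_param_segment(2)[OF assms]]) (use that in simp)
  qed
qed

lemma joined_trans:
  assumes "joined p q" "joined q r"
  shows "joined p r"
proof -
  obtain c1 S1 where *: "piecewise_C1_curve L A c1 \<and> c1 0 = p \<and> c1 1 = q \<and> finite S1 \<and>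
     (\<forall>t\<in>{0<..<1} - S1. (g \<circ> c1) differentiable (at t)) \<and>
     (\<lambda>t. norm (vector_derivative (g \<circ> c1) (at t))) integrable_on {0..1}"
    using assms(1) unfolding joined_def by (elim exE) (rule that)
  then have c1: "piecewise_C1_curve L A c1" "c1 0 = p" "c1 1 = q" "finite S1"
    "\<And>t. t \<in> {0<..<1} - S1 \<Longrightarrow> (g \<circ> c1) differentiable (at t)"
    "(\<lambda>t. norm (vector_derivative (g \<circ> c1) (at t))) integrable_on {0..1}"
    by blast+
  obtain c2 S2 where *: "piecewise_C1_curve L A c2 \<and> c2 0 = q \<and> c2 1 = r \<and> finite S2 \<and>
     (\<forall>t\<in>{0<..<1} - S2. (g \<circ> c2) differentiable (at t)) \<and>
     (\<lambda>t. norm (vector_derivative (g \<circ> c2) (at t))) integrable_on {0..1}"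
    using assms(2) unfolding joined_def by (elim exE) (rule that)
  then have c2: "piecewise_C1_curve L A c2" "c2 0 = q" "c2 1 = r" "finite S2"
    "\<And>t. t \<in> {0<..<1} - S2 \<Longrightarrow> (g \<circ> c2) differentiable (at t)"
    "(\<lambda>t. norm (vector_derivative (g \<circ> c2) (at t))) integrable_on {0..1}"
    by blast+
  define c where "c t = (if t \<le> 1/2 then c1 (2 * t) else c2 (2 * t - 1))" for t
  have eq1: "c t = c1 (2 * t)" if "t \<le> 1/2" for t
    using that by (simp add: c_def)
  have eq2: "c t = c2 (2 * t - 1)" if "t \<ge> 1/2" for t
  proof (cases "t = 1/2")
    case True
    show ?thesis
      unfolding True c_def using c1(3) c2(2) by simp
  qed (use that in \<open>simp add: c_def\<close>)
  have cont: "continuous_map (top_of_set {0..1}) L c"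
    unfolding c_def
  proof (rule continuous_map_cases_le)
    show "continuous_map (subtopology (top_of_set {0..1}) {x \<in> topspace (top_of_set {0..1}). x \<le> 1/2}) L (\<lambda>t. c1 (2 * t))"
      by (rule continuous_map_compose[of _ "top_of_set {0..1}" "\<lambda>t. 2 * t" L c1, unfolded o_def])
        (use c1(1) in \<open>auto simp: piecewise_C1_curve_def continuous_map_in_subtopology subtopology_subtopology
            intro!: continuous_intros\<close>)
    show "continuous_map (subtopology (top_of_set {0..1}) {x \<in> topspace (top_of_set {0..1}). 1/2 \<le> x}) L (\<lambda>t. c2 (2 * t - 1))"
      by (rule continuous_map_compose[of _ "top_of_set {0..1}" "\<lambda>t. 2 * t - 1" L c2, unfolded o_def])
        (use c2(1) in \<open>auto simp: piecewise_C1_curve_def continuous_map_in_subtopology subtopology_subtopology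
            intro!: continuous_intros\<close>)
    show "c1 (2 * t) = c2 (2 * t - 1)" if "t \<in> topspace (top_of_set {0..1})" "t = 1/2" for t
      unfolding that(2) using c1(3) c2(2) by simp
  qed auto
  have chart1: "(x \<circ> c) piecewise_C1_differentiable_on {a..b}"
    if U: "(U, x) \<in> A" "c ` {a..b} \<subseteq> U" and ab: "0 \<le> a" "a \<le> b" "b \<le> 1/2" for U x a b
  proof -
    have "c1 ` {2 * a..2 * b} \<subseteq> U"
    proof
      fix z assume "z \<in> c1 ` {2 * a..2 * b}"
      then obtain s where "s \<in> {2 * a..2 * b}" "z = c1 s"
        by blast
      then have "z = c (s / 2)" "s / 2 \<in> {a..b}"
        using ab by (auto simp: c_def)
      then show "z \<in> U"
        using U(2) by blast
    qed
    moreover have "{2 * a..2 * b} \<subseteq> {0..1}"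
      using ab by auto
    ultimately have "(x \<circ> c1) piecewise_C1_differentiable_on {2 * a..2 * b}"
      by (intro piecewise_C1_curve_chart[OF c1(1) U(1)])
    then have "((x \<circ> c1) \<circ> (\<lambda>t. 2 *\<^sub>R t + 0)) piecewise_C1_differentiable_on {a..b}"
      using ab by (intro piecewise_C1_differentiable_affine) (simp add: image_affinity_atLeastAtMost)
    then show ?thesis
      by (rule piecewise_C1_differentiable_on_cong) (use ab eq1 in auto)
  qed
  have chart2: "(x \<circ> c) piecewise_C1_differentiable_on {a..b}"
    if U: "(U, x) \<in> A" "c ` {a..b} \<subseteq> U" and ab: "1/2 \<le> a" "a \<le> b" "b \<le> 1" for U x a b
  proof -
    have "c2 ` {2 * a - 1..2 * b - 1} \<subseteq> U"
    proof
      fix z assume "z \<in> c2 ` {2 * a - 1..2 * b - 1}"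
      then obtain s where s: "s \<in> {2 * a - 1..2 * b - 1}" "z = c2 s"
        by blast
      have "2 * ((s + 1) / 2) - 1 = s"
        by (simp add: field_simps)
      then have "z = c ((s + 1) / 2)" "(s + 1) / 2 \<in> {a..b}"
        using s ab eq2[of "(s + 1) / 2"] by auto
      then show "z \<in> U"
        using U(2) by blast
    qed
    moreover have "{2 * a - 1..2 * b - 1} \<subseteq> {0..1}"
      using ab by auto
    ultimately have "(x \<circ> c2) piecewise_C1_differentiable_on {2 * a - 1..2 * b - 1}"
      by (intro piecewise_C1_curve_chart[OF c2(1) U(1)])
    then have "((x \<circ> c2) \<circ> (\<lambda>t. 2 *\<^sub>R t + - 1)) piecewise_C1_differentiable_on {a..b}"
      using ab by (intro piecewise_C1_differentiable_affine) (simp add: image_affinity_atLeastAtMost_diff)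
    then show ?thesis
      by (rule piecewise_C1_differentiable_on_cong) (use ab eq2 in auto)
  qed
  have "(x \<circ> c) piecewise_C1_differentiable_on {a..b}"
    if U: "(U, x) \<in> A" and ab: "{a..b} \<subseteq> {0..1}" and cU: "c ` {a..b} \<subseteq> U" for U x a b
  proof (cases "a \<le> b")
    case True
    then have 01: "0 \<le> a" "b \<le> 1"
      using ab by auto
    \<comment> \<open>A curve must be piecewise C1 on every interval that it maps into a chart; an
      interval around 1/2 is cut there and the halves are glued.\<close>
    consider "b \<le> 1/2" | "1/2 \<le> a" | "a \<le> 1/2" "1/2 \<le> b"
      by linarith
    then show ?thesis
    proof cases
      case 1
      then show ?thesis
        by (rule chart1[OF U cU 01(1) True])
    next
      case 2
      then show ?thesis
        by (rule chart2[OF U cU _ True 01(2)])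
    next
      case 3
      have "c ` {a..1/2} \<subseteq> U" "c ` {1/2..b} \<subseteq> U"
        using 3 cU by (auto simp: image_subset_iff)
      note halves = chart1[OF U this(1) 01(1) 3(1) order_refl] chart2[OF U this(2) order_refl 3(2) 01(2)]
      from piecewise_C1_differentiable_cases[OF halves 3 refl] show ?thesis
        by (simp add: o_def)
    qed
  next
    case False
    then show ?thesis
      by (auto simp: piecewise_C1_differentiable_on_def)
  qed
  then have curve: "piecewise_C1_curve L A c"
    by (rule piecewise_C1_curveI[OF cont])
  obtain S1' where S1': "finite S1'" "\<And>t. t \<in> {0<..<1/2} - S1' \<Longrightarrow> (g \<circ> c) differentiable (at t)"
    "(\<lambda>t. norm (vector_derivative (g \<circ> c) (at t))) integrable_on {0..1/2}"
    by (rule integrable_speed_affine_reparam[of "g \<circ> c1" 2 0 0 "1/2" S1 "g \<circ> c", OF c1(6) _ _ _ c1(4,5)],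
        simp, simp, simp, assumption, use eq1 in simp, rule that)
  obtain S2' where S2': "finite S2'" "\<And>t. t \<in> {1/2<..<1} - S2' \<Longrightarrow> (g \<circ> c) differentiable (at t)"
    "(\<lambda>t. norm (vector_derivative (g \<circ> c) (at t))) integrable_on {1/2..1}"
    by (rule integrable_speed_affine_reparam[of "g \<circ> c2" 2 "1/2" "-1" 1 S2 "g \<circ> c", OF c2(6) _ _ _ c2(4,5)],
        simp, simp, simp, assumption, use eq2 in simp, rule that)
  show ?thesis
    unfolding joined_def
  proof (intro exI conjI ballI)
    show "piecewise_C1_curve L A c"
      by (rule curve)
    show "c 0 = p" "c 1 = r"
      using c1(2) c2(3) by (auto simp: c_def)
    \<comment> \<open>At the junction 1/2 the one-sided derivatives may differ, so it becomes
      exceptional.\<close>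
    show "finite (S1' \<union> S2' \<union> {1/2})"
      using S1'(1) S2'(1) by simp
    show "(g \<circ> c) differentiable (at t)" if "t \<in> {0<..<1} - (S1' \<union> S2' \<union> {1/2})" for t
      using S1'(2)[of t] S2'(2)[of t] that by (cases "t < 1/2") auto
    show "(\<lambda>t. norm (vector_derivative (g \<circ> c) (at t))) integrable_on {0..1}"
      by (rule Henstock_Kurzweil_Integration.integrable_combine[OF _ _ S1'(3) S2'(3)]) auto
  qed
qed

text \<open>A coordinate segment can be run through in either direction. Obtaining both directions
  here replaces the reversal of arbitrary curves.\<close>

lemma joined_neighbourhood:
  assumes "p \<in> topspace L"
  obtains V where "openin L V" "p \<in> V" "\<And>r. r \<in> V \<Longrightarrow> joined p r \<and> joined r p"
proof -
  obtain U x where U: "(U, x) \<in> A" "p \<in> U"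
    using assms by (rule exists_chart)
  obtain d where d: "d > 0" "ball (x p) d \<subseteq> x ` U"
    using chart_open_image[OF U(1)] U(2) open_contains_ball by blast
  have "joined p r \<and> joined r p" if "r \<in> {r \<in> U. x r \<in> ball (x p) d}" for r
  proof -
    have "closed_segment (x p) (x r) \<subseteq> x ` U" "closed_segment (x r) (x p) \<subseteq> x ` U"
      using that d closed_segment_subset[OF _ _ convex_ball, of "x p" "x p" d "x r"]
      by (auto simp: closed_segment_commute)
    from this[THEN joined_segment[OF smooth_param_chart[OF U(1)]]]
    show ?thesis
      using that U by simp
  qed
  then show thesis
    using that[OF openin_chart_preimage[OF U(1) open_ball[of "x p" d]]] U(2) d(1) by simp
qed

text \<open>The points reachable from \<open>p\<close> form an open set, and so do the others: a
  neighbour that could be reached would make the point itself reachable. Connectedness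
  concludes.\<close>

lemma joined_topspace:
  assumes p: "p \<in> topspace L" and r: "r \<in> topspace L"
  shows "joined p r"
proof -
  let ?R = "{z \<in> topspace L. joined p z}"
  have refl: "joined p p"
    using joined_neighbourhood[OF p] by blast
  have op: "openin L ?R"
  proof (subst openin_subopen, intro ballI)
    fix z assume z: "z \<in> ?R"
    then have "z \<in> topspace L"
      by simp
    obtain V where V: "openin L V" "z \<in> V" "\<And>r. r \<in> V \<Longrightarrow> joined z r \<and> joined r z"
      by (rule joined_neighbourhood[OF \<open>z \<in> topspace L\<close>]) (rule that)
    have "r \<in> ?R" if "r \<in> V" for r
      using V(3)[OF that] z joined_trans[of p z r] openin_subset[OF V(1)] that by auto
    then show "\<exists>T. openin L T \<and> z \<in> T \<and> T \<subseteq> ?R"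
      using V(1,2) by (intro exI[of _ V]) auto
  qed
  have cl: "openin L (topspace L - ?R)"
  proof (subst openin_subopen, intro ballI)
    fix z assume z: "z \<in> topspace L - ?R"
    then have "z \<in> topspace L"
      by simp
    obtain V where V: "openin L V" "z \<in> V" "\<And>r. r \<in> V \<Longrightarrow> joined z r \<and> joined r z"
      by (rule joined_neighbourhood[OF \<open>z \<in> topspace L\<close>]) (rule that)
    have "r \<in> topspace L - ?R" if "r \<in> V" for r
      using V(3)[OF that] z joined_trans[of p r z] openin_subset[OF V(1)] that by auto
    then show "\<exists>T. openin L T \<and> z \<in> T \<and> T \<subseteq> topspace L - ?R"
      using V(1,2) by (intro exI[of _ V]) auto
  qed
  have "connected_space L"
    using surface unfolding smooth_surface_def by blast
  moreover have "closedin L ?R"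
    using cl by (simp add: closedin_def)
  ultimately have "?R = {} \<or> ?R = topspace L"
    using op unfolding connected_space_clopen_in by blast
  then show ?thesis
    using p r refl by blast
qed

lemma curve_lengths_nonempty:
  assumes "p \<in> topspace L" "r \<in> topspace L"
  shows "curve_lengths L A g p r \<noteq> {}"
proof -
  obtain c S where "piecewise_C1_curve L A c \<and> c 0 = p \<and> c 1 = r \<and> finite S \<and>
     (\<forall>t\<in>{0<..<1} - S. (g \<circ> c) differentiable (at t)) \<and>
     (\<lambda>t. norm (vector_derivative (g \<circ> c) (at t))) integrable_on {0..1}"
    using joined_topspace[OF assms] unfolding joined_def by (elim exE) (rule that)
  then have "integral {0..1} (\<lambda>t. norm (vector_derivative (g \<circ> c) (at t))) \<in> curve_lengths L A g p r"
    unfolding curve_lengths_def by (intro CollectI exI[of _ c]) simp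
  then show ?thesis
    by (rule ex_in_conv[THEN iffD1, OF exI])
qed

end

section \<open>Convergence in the induced distance implies convergence in the topology\<close>

lemma (in immersed_patch) derivative_bounded_below:
  assumes K: "compact K" "K \<subseteq> S"
  obtains m where "m > 0" "\<And>u (w::real^2). u \<in> K \<Longrightarrow> m * norm w \<le> norm (tangent_vector f u w)"
proof (cases "K = {}")
  case True
  then show thesis
    using that[of 1] by simp
next
  case False
  \<comment> \<open>By homogeneity it suffices to take the minimum over unit vectors; it is attained
    by compactness and positive by injectivity of the derivative.\<close>
  let ?h = "\<lambda>z. norm (snd z $ 1 *\<^sub>R pdiff 1 f (fst z) + snd z $ 2 *\<^sub>R pdiff 2 f (fst z))"
  let ?C = "K \<times> sphere (0 :: real^2) 1"
  have cont: "continuous_on K (pdiff i f)" for i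
    using smooth_map_on_continuous_on[OF smooth_map_on_pdiff[OF smooth]] K(2) continuous_on_subset by blast
  have "continuous_on ?C (\<lambda>z. pdiff i f (fst z))" for i
    by (rule continuous_on_compose2[OF cont]) (auto intro!: continuous_intros)
  then have "continuous_on ?C ?h"
    by (intro continuous_intros)
  moreover have "compact ?C"
    using K(1) by (intro compact_Times compact_sphere)
  moreover have "?C \<noteq> {}"
    using False by simp
  ultimately obtain z where z: "z \<in> ?C" "\<And>y. y \<in> ?C \<Longrightarrow> ?h z \<le> ?h y"
    using continuous_attains_inf[of ?C ?h] by blast
  have "fst z \<in> S" "snd z \<noteq> 0"
    using z(1) K(2) by auto
  then have pos: "?h z > 0"
    using derivative_eq_0_iff[of "fst z" "snd z"] by simp
  show thesis
  proof (rule that[OF pos])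
    fix u and w :: "real^2" assume u: "u \<in> K"
    show "?h z * norm w \<le> norm (tangent_vector f u w)"
    proof (cases "w = 0")
      case False
      then have "?h z \<le> ?h (u, (1 / norm w) *\<^sub>R w)"
        using u by (intro z(2)) simp
      also have "?h (u, (1 / norm w) *\<^sub>R w) = norm ((1 / norm w) *\<^sub>R (tangent_vector f u w))"
        by (simp only: fst_conv snd_conv vector_scaleR_component scaleR_right_distrib scaleR_scaleR real_scaleR_def)
      also have "\<dots> = norm (tangent_vector f u w) / norm w"
        by simp
      finally show ?thesis
        by (rule pos_le_divide_eq[THEN iffD1, rotated]) (use False in simp)
    qed simp
  qed
qed

context immersed_surface
begin

lemma curve_in_chart_length:
  assumes c: "piecewise_C1_curve L A c" and U: "(U, x) \<in> A" and t: "0 \<le> t" "t \<le> 1"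
    and cU: "c ` {t..1} \<subseteq> U"
    and int: "(\<lambda>t. norm (vector_derivative (g \<circ> c) (at t))) integrable_on {0..1}"
    and m: "m > 0" "\<And>s (w::real^2). s \<in> {t..1} \<Longrightarrow> m * norm w \<le>
        norm (tangent_vector (local_rep g (U, x)) (x (c s)) w)"
  shows "m * norm (x (c 1) - x (c t)) \<le> integral {0..1} (\<lambda>t. norm (vector_derivative (g \<circ> c) (at t)))"
proof -
  interpret P: immersed_patch "local_rep g (U, x)" "x ` U"
    by (rule immersed_patch_chart[OF U])
  let ?h = "x \<circ> c" and ?v = "\<lambda>s. norm (vector_derivative (g \<circ> c) (at s))"
  have sub: "{t..1} \<subseteq> {0..1}"
    using t by auto
  have "?h piecewise_C1_differentiable_on {t..1}"
    by (rule piecewise_C1_curve_chart[OF c U sub cU])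
  then have "continuous_on {t..1} ?h \<and> (\<exists>S. finite S \<and> ?h C1_differentiable_on ({t..1} - S))"
    unfolding piecewise_C1_differentiable_on_def .
  then obtain S where S: "continuous_on {t..1} ?h" "finite S" "?h C1_differentiable_on ({t..1} - S)"
    by blast
  obtain D where D: "\<forall>s\<in>{t..1} - S. (?h has_vector_derivative D s) (at s)"
    using S(3) unfolding C1_differentiable_on_def by (elim exE conjE) (rule that)
  \<comment> \<open>The value 0 at the exceptional points makes the bound by the speed hold at every
    parameter, and the fundamental theorem tolerates the finitely many changes.\<close>
  define D' where "D' s = (if s \<in> S \<union> {t, 1} then 0 else D s)" for s
  have hD: "(?h has_vector_derivative D' s) (at s)" if "s \<in> {t<..<1} - (S \<union> {t, 1})" for s
  proof -
    have "s \<in> {t..1} - S" "s \<notin> S \<union> {t, 1}"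
      using that by auto
    then show ?thesis
      using D by (simp add: D'_def)
  qed
  have "(D' has_integral (?h 1 - ?h t)) {t..1}"
    by (rule fundamental_theorem_of_calculus_interior_strong[where S = "S \<union> {t, 1}" and f = "?h"])
      (use S(1,2) t hD in simp_all)
  then have intD: "D' integrable_on {t..1}" "integral {t..1} D' = ?h 1 - ?h t"
    by (auto simp: has_integral_integrable_integral)
  have intv: "?v integrable_on {t..1}"
    by (rule integrable_on_subinterval[OF int sub])
  have bound: "norm (D' s) \<le> ?v s / m" if s: "s \<in> {t..1}" for s
  proof (cases "s \<in> S \<union> {t, 1}")
    case True
    then show ?thesis
      using m(1) by (simp add: D'_def)
  next
    case False
    then have st: "s \<in> {t<..<1}"
      using s by auto
    then have "(?h has_vector_derivative D' s) (at s)"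
      using hD False by blast
    then have h': "(?h has_derivative (\<lambda>y. y *\<^sub>R D' s)) (at s)"
      by (simp add: has_vector_derivative_def)
    have xs: "x (c s) \<in> x ` U"
      using cU s by blast
    have f': "(local_rep g (U, x) has_derivative
        (\<lambda>w. tangent_vector (local_rep g (U, x)) (x (c s)) w)) (at (?h s))"
      using has_derivative_pdiff[OF P.differentiable[OF xs]] by simp
    have "((\<lambda>s. local_rep g (U, x) (?h s)) has_derivative
        (\<lambda>y. (y *\<^sub>R D' s)$1 *\<^sub>R pdiff 1 (local_rep g (U, x)) (x (c s)) + (y *\<^sub>R D' s)$2 *\<^sub>R pdiff 2 (local_rep g (U, x)) (x (c s)))) (at s)"
      by (rule has_derivative_compose[OF h' f'])
    then have "((g \<circ> c) has_derivative
        (\<lambda>y. (y *\<^sub>R D' s)$1 *\<^sub>R pdiff 1 (local_rep g (U, x)) (x (c s)) + (y *\<^sub>R D' s)$2 *\<^sub>R pdiff 2 (local_rep g (U, x)) (x (c s)))) (at s)"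
      by (rule has_derivative_transform_within_open[OF _ open_greaterThanLessThan st])
        (use cU U in \<open>auto simp: image_subset_iff\<close>)
    then have "((g \<circ> c) has_vector_derivative
        (D' s$1 *\<^sub>R pdiff 1 (local_rep g (U, x)) (x (c s)) + D' s$2 *\<^sub>R pdiff 2 (local_rep g (U, x)) (x (c s)))) (at s)"
      by (simp add: has_vector_derivative_def scaleR_right_distrib)
    from vector_derivative_at[OF this] have "m * norm (D' s) \<le> ?v s"
      using m(2)[OF s, of "D' s"] by simp
    then show ?thesis
      using m(1) by (simp add: field_simps)
  qed
  have "norm (?h 1 - ?h t) \<le> integral {t..1} (\<lambda>s. ?v s / m)"
    unfolding intD(2)[symmetric]
    by (rule integral_norm_bound_integral[OF intD(1) _ bound]) (rule integrable_on_divide[OF intv])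
  also have "\<dots> = integral {t..1} ?v / m"
    by simp
  also have "integral {t..1} ?v \<le> integral {0..1} ?v"
    by (rule integral_subset_le[OF sub intv int]) simp
  finally show ?thesis
    using m(1) by (simp add: field_simps)
qed

text \<open>A continuity argument run backwards from \<open>q\<close>. On a closed coordinate ball
  the metric dominates m times the Euclidean one. As long as a curve of length len < m rho has not
  left the ball of radius rho, it is therefore confined to the strictly smaller radius len / m, so
  it never leaves.\<close>

lemma short_curves_near_endpoint:
  assumes q: "q \<in> topspace L" and V: "openin L V" "q \<in> V"
  obtains \<epsilon> where "\<epsilon> > 0" "\<And>p len. len \<in> curve_lengths L A g p q \<Longrightarrow> len < \<epsilon> \<Longrightarrow> p \<in> V"
proof -
  obtain U x where U: "(U, x) \<in> A" "q \<in> U"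
    using q by (rule exists_chart)
  interpret P: immersed_patch "local_rep g (U, x)" "x ` U"
    by (rule immersed_patch_chart[OF U(1)])
  have "openin L (U \<inter> V)"
    using chart_openin[OF U(1)] V(1) by blast
  then have "open (x ` (U \<inter> V))"
    by (rule open_chart_image[OF U(1)]) simp
  then obtain \<rho> where \<rho>: "\<rho> > 0" "cball (x q) \<rho> \<subseteq> x ` (U \<inter> V)"
    using U(2) V(2) open_contains_cball by blast
  obtain m where m: "m > 0" "\<And>u (w::real^2). u \<in> cball (x q) \<rho> \<Longrightarrow> m * norm w \<le>
      norm (tangent_vector (local_rep g (U, x)) u w)"
    by (rule P.derivative_bounded_below[OF compact_cball, of "x q" \<rho>]) (use \<rho>(2) in blast, rule that)
  let ?B = "\<lambda>r. {p \<in> U. x p \<in> ball (x q) r}"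
  have BV: "?B \<rho> \<subseteq> V"
  proof
    fix p assume p: "p \<in> ?B \<rho>"
    then have "x p \<in> x ` (U \<inter> V)"
      using \<rho>(2) by auto
    then obtain p' where "x p = x p'" "p' \<in> U \<inter> V"
      by (rule imageE)
    then have "p' = p"
      using inj_onD[OF chart_inj[OF U(1)], of p' p] p by simp
    then show "p \<in> V"
      using \<open>p' \<in> U \<inter> V\<close> by simp
  qed
  show thesis
  proof (rule that[of "m * \<rho>"])
    show "m * \<rho> > 0"
      using m \<rho> by simp
    fix p len assume len: "len \<in> curve_lengths L A g p q" "len < m * \<rho>"
    obtain c where c: "len = integral {0..1} (\<lambda>t. norm (vector_derivative (g \<circ> c) (at t)))"
      "piecewise_C1_curve L A c" "c 0 = p" "c 1 = q"
      "(\<lambda>t. norm (vector_derivative (g \<circ> c) (at t))) integrable_on {0..1}"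
      using len(1) unfolding curve_lengths_def by (elim CollectE exE conjE) (rule that)
    have cc: "continuous_map (top_of_set {0..1}) L c"
      using c(2) unfolding piecewise_C1_curve_def by blast
    \<comment> \<open>The parameters after which the curve stays in the ball. The confining set
      \<open>?K\<close> is compact, hence closed in the Hausdorff space \<open>L\<close>, so the
      point at the infimum of \<open>T\<close> lies in it; openness of the larger ball then
      continues \<open>T\<close> downwards unless the infimum is 0.\<close>
    define T where "T = {t \<in> {0..1}. c ` {t..1} \<subseteq> ?B \<rho>}"
    let ?K = "inv_into U x ` cball (x q) (len / m)"
    have lenm: "0 \<le> len / m" "len / m < \<rho>"
      using curve_lengths_nonneg[OF len(1)] m(1) len(2) by (auto simp: field_simps)
    have "cball (x q) (len / m) \<subseteq> x ` (U \<inter> V)"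
      by (rule order_trans[OF subset_cball \<rho>(2)]) (use lenm in simp)
    then have Ksub: "cball (x q) (len / m) \<subseteq> x ` U"
      by blast
    have "compactin L ?K"
      by (rule image_compactin[OF _ continuous_map_chart_inverse[OF U(1)]])
        (use Ksub in \<open>simp add: compactin_subtopology\<close>)
    then have Kcl: "closedin L ?K"
      using surface compactin_imp_closedin unfolding smooth_surface_def by blast
    have KB: "?K \<subseteq> ?B \<rho>"
    proof
      fix p' assume "p' \<in> ?K"
      then obtain u where u: "p' = inv_into U x u" "u \<in> cball (x q) (len / m)"
        by (rule imageE)
      then have "u \<in> x ` U"
        using Ksub by blast
      then show "p' \<in> ?B \<rho>"
        using u lenm chart_inverse(2,3)[OF U(1)] by simp
    qed
    have 1: "1 \<in> T"
      using c(4) U(2) \<rho>(1) by (simp add: T_def)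
    have inK: "c t \<in> ?K" if "t \<in> T" for t
    proof -
      have t: "0 \<le> t" "t \<le> 1" and B: "c ` {t..1} \<subseteq> ?B \<rho>"
        using that by (auto simp: T_def)
      have "m * norm (x (c 1) - x (c t)) \<le> len"
        unfolding c(1)
      proof (rule curve_in_chart_length[OF c(2) U(1) t _ c(5) m(1)])
        show "c ` {t..1} \<subseteq> U"
          using B by blast
        fix s and w :: "real^2" assume "s \<in> {t..1}"
        then have "x (c s) \<in> cball (x q) \<rho>"
          using B by (auto simp: image_subset_iff less_imp_le)
        then show "m * norm w \<le> norm (tangent_vector (local_rep g (U, x)) (x (c s)) w)"
          by (rule m(2))
      qed
      then have "x (c t) \<in> cball (x q) (len / m)"
        using m(1) c(4) by (simp add: dist_norm field_simps)
      moreover have "c t \<in> U"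
        using B t by (auto simp: image_subset_iff)
      then have "c t = inv_into U x (x (c t))"
        using U(1) by simp
      ultimately show ?thesis
        by (rule rev_image_eqI)
    qed
    define t0 where "t0 = Inf T"
    have bdd: "bdd_below T"
      by (rule bdd_belowI[of _ 0]) (simp add: T_def)
    have Tne: "T \<noteq> {}"
      using 1 by blast
    have t0: "0 \<le> t0" "t0 \<le> 1"
      unfolding t0_def by (rule cInf_greatest[OF Tne], simp add: T_def, rule cInf_lower[OF 1 bdd])
    have after: "s \<in> T" if s: "t0 < s" "s \<le> 1" for s
    proof -
      obtain t where "t \<in> T" "t < s"
        using cInf_lessD[OF Tne s(1)[unfolded t0_def]] by (elim bexE) (rule that)
      then show ?thesis
        using s(2) by (auto simp: T_def image_subset_iff)
    qed
    have "c t0 \<in> ?K"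
    proof (cases "t0 = 1")
      case True
      then show ?thesis
        using inK[OF 1] by simp
    next
      case False
      have "closedin (top_of_set {0..1}) {t \<in> topspace (top_of_set {0..1}). c t \<in> ?K}"
        by (rule closedin_continuous_map_preimage[OF cc Kcl])
      then have cl: "closed {t \<in> {0..1}. c t \<in> ?K}"
        by (simp add: closedin_closed_eq)
      have "t0 < 1"
        using False t0 by simp
      then have "t0 \<in> closure {t0<..<1}"
        by simp
      moreover have "{t0<..<1} \<subseteq> {t \<in> {0..1}. c t \<in> ?K}"
        using inK after t0 by auto
      ultimately have "t0 \<in> {t \<in> {0..1}. c t \<in> ?K}"
        using closure_minimal[OF _ cl] by blast
      then show ?thesis
        by blast
    qed
    then have "c t0 \<in> ?B \<rho>"
      using KB by blast
    have "openin (top_of_set {0..1}) {t \<in> topspace (top_of_set {0..1}). c t \<in> ?B \<rho>}"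
      by (rule openin_continuous_map_preimage[OF cc openin_chart_preimage[OF U(1) open_ball]])
    then obtain O' where O': "open O'" "{t \<in> {0..1}. c t \<in> ?B \<rho>} = {0..1} \<inter> O'"
      unfolding openin_open by auto
    have "t0 \<in> O'"
    proof -
      have "t0 \<in> {t \<in> {0..1}. c t \<in> ?B \<rho>}"
        using t0 \<open>c t0 \<in> ?B \<rho>\<close> by simp
      then show ?thesis
        unfolding O'(2) by simp
    qed
    then obtain \<delta> where \<delta>: "\<delta> > 0" "ball t0 \<delta> \<subseteq> O'"
      using O'(1) open_contains_ball by blast
    have step: "s \<in> T" if s: "s \<in> {0..1}" "t0 - \<delta> < s" "s \<le> t0" for s
    proof -
      have "c r \<in> ?B \<rho>" if r: "r \<in> {s..1}" for r
      proof (cases "r \<le> t0")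
        case True
        then have "r \<in> ball t0 \<delta>"
          using r s by (simp add: dist_real_def)
        then have "r \<in> {0..1} \<inter> O'"
          using \<delta>(2) r s by auto
        then show ?thesis
          using O'(2) by blast
      next
        case False
        then show ?thesis
          using after[of r] r by (auto simp: T_def image_subset_iff)
      qed
      then show ?thesis
        using s(1) unfolding T_def by blast
    qed
    have "t0 = 0"
    proof (rule ccontr)
      assume "t0 \<noteq> 0"
      define s where "s = max 0 (t0 - \<delta> / 2)"
      have "s \<in> T"
        by (rule step) (use t0 \<delta>(1) \<open>t0 \<noteq> 0\<close> in \<open>auto simp: s_def\<close>)
      then have "t0 \<le> s"
        unfolding t0_def using bdd by (rule cInf_lower)
      then show False
        using \<delta>(1) t0 \<open>t0 \<noteq> 0\<close> by (simp add: s_def max_def split: if_splits)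
    qed
    then show "p \<in> V"
      using \<open>c t0 \<in> ?B \<rho>\<close> c(3) BV by blast
  qed
qed

text \<open>Completeness provides limits in the induced distance, while charts, sections and slope
  bounds are continuous for the topology of \<open>L\<close>. This is the passage from one to the
  other.\<close>

lemma induced_dist_imp_limitin:
  assumes q: "q \<in> topspace L" and p: "range p \<subseteq> topspace L"
    and lim: "(\<lambda>n. induced_dist L A g (p n) q) \<longlonglongrightarrow> 0"
  shows "limitin L p q sequentially"
  unfolding limitin_def
proof (intro conjI allI impI q)
  fix V assume V: "openin L V \<and> q \<in> V"
  obtain \<epsilon> where \<epsilon>: "\<epsilon> > 0" "\<And>p len. len \<in> curve_lengths L A g p q \<Longrightarrow> len < \<epsilon> \<Longrightarrow> p \<in> V"
    by (rule short_curves_near_endpoint[OF q conjunct1[OF V] conjunct2[OF V]]) (rule that)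
  have "\<forall>\<^sub>F n in sequentially. induced_dist L A g (p n) q < \<epsilon>"
    using lim \<epsilon>(1) by (rule order_tendstoD(2))
  then show "\<forall>\<^sub>F n in sequentially. p n \<in> V"
  proof eventually_elim
    case (elim n)
    have "p n \<in> topspace L"
      using p by blast
    then obtain len where "len \<in> curve_lengths L A g (p n) q" "len < \<epsilon>"
      using elim cInf_lessD[OF curve_lengths_nonempty[OF _ q]] unfolding induced_dist_def by blast
    then show ?case
      by (rule \<epsilon>(2))
  qed
qed

end

section \<open>Graphs over a tangent plane\<close>

locale projected_surface = immersed_surface L A g
  for L :: "'a topology" and A :: "'a chart set" and g :: "'a \<Rightarrow> 'b::euclidean_space" +
  fixes \<pi> :: "'b \<Rightarrow> real^2" and q :: 'a
  assumes linear_proj: "linear \<pi>" and norm_proj: "norm (\<pi> y) \<le> norm y" and q: "q \<in> topspace L"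
begin

definition shadow :: "'a \<Rightarrow> real^2" where
  "shadow p = \<pi> (g p - g q)"

text \<open>A slope bound. Three values of the constant occur: 1 at the centre \<open>q\<close>, 2
  as the standing requirement on a graph, and 3/2 as the bound proved for it, which is a closed
  condition and leaves a margin to 2.\<close>

definition graphical :: "real \<Rightarrow> 'a \<Rightarrow> bool" where
  "graphical c p \<longleftrightarrow> (\<forall>\<tau>\<in>tangent_at p. norm \<tau> \<le> c * norm (\<pi> \<tau>))"

lemma graphical_chart:
  assumes "(U, x) \<in> A" "p \<in> U"
  shows "graphical c p \<longleftrightarrow> (\<forall>w::real^2.
      norm (tangent_vector (local_rep g (U, x)) (x p) w)
      \<le> c * norm (\<pi> (tangent_vector (local_rep g (U, x)) (x p) w)))"
proof -
  interpret P: immersed_patch "local_rep g (U, x)" "x ` U"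
    by (rule immersed_patch_chart[OF assms(1)])
  show ?thesis
    unfolding graphical_def tangent_at_eq[OF assms] P.tangent_plane_eq[OF imageI[OF assms(2)]] by simp
qed

lemma projected_patch_chart:
  assumes "(U, x) \<in> A"
  shows "projected_patch (local_rep g (U, x)) (x ` U) \<pi>"
  unfolding projected_patch_def projected_patch_axioms_def
  using immersed_patch_chart[OF assms] linear_proj norm_proj by blast

lemma graphical_proj_det:
  assumes U: "(U, x) \<in> A" "p \<in> U" and p: "graphical c p"
  shows "projected_patch.proj_det (local_rep g (U, x)) \<pi> (x p) \<noteq> 0"
proof -
  interpret P: projected_patch "local_rep g (U, x)" "x ` U" \<pi>
    by (rule projected_patch_chart[OF U(1)])
  show ?thesis
  proof (rule P.proj_det_nonzero)
    fix w :: "real^2"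
    assume 0: "\<pi> (tangent_vector (local_rep g (U, x)) (x p) w) = 0"
    have "norm (tangent_vector (local_rep g (U, x)) (x p) w) \<le> c * 0"
      using p[unfolded graphical_chart[OF U], rule_format, of w] unfolding 0 by simp
    then show "w = 0"
      using P.derivative_eq_0_iff[of "x p" w] U(2) by simp
  qed
qed

text \<open>The inverse function theorem for the projection read in a chart. The slope bound makes
  its derivative injective, hence invertible in dimension two.\<close>

lemma local_inverse:
  assumes U: "(U, x) \<in> A" "p \<in> U" and p: "graphical c p"
  obtains V B \<sigma> where "openin L V" "p \<in> V" "V \<subseteq> U" "open B" "shadow p \<in> B" "continuous_map (top_of_set B) L \<sigma>"
    "\<And>b. b \<in> B \<Longrightarrow> \<sigma> b \<in> V \<and> shadow (\<sigma> b) = b" "\<And>r. r \<in> V \<Longrightarrow> shadow r \<in> B \<and> \<sigma> (shadow r) = r"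
    "\<And>b. b \<in> B \<Longrightarrow> (x \<circ> \<sigma>) differentiable (at b)"
proof -
  interpret P: projected_patch "local_rep g (U, x)" "x ` U" \<pi>
    by (rule projected_patch_chart[OF U(1)])
  let ?f = "local_rep g (U, x)" and ?u = "x p"
  have u: "?u \<in> x ` U"
    using U(2) by blast
  define F where "F v = \<pi> (?f v - g q)" for v
  define D where "D v w = \<pi> (tangent_vector ?f v w)" for v and w :: "real^2"
  have dF: "(F has_derivative D v) (at v)" if v: "v \<in> x ` U" for v
  proof -
    have "((\<lambda>v. ?f v - g q) has_derivative (\<lambda>w. tangent_vector ?f v w - 0)) (at v)"
      by (intro has_derivative_diff has_derivative_pdiff has_derivative_const P.differentiable v)
    from bounded_linear.has_derivative[OF P.bounded_linear_proj this] show ?thesis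
      by (simp add: F_def[abs_def] D_def[abs_def])
  qed
  then have blD: "bounded_linear (D v)" if "v \<in> x ` U" for v
    using has_derivative_bounded_linear that by blast
  define F' where "F' v = Blinfun (D v)" for v
  have F': "blinfun_apply (F' v) = D v" if "v \<in> x ` U" for v
    unfolding F'_def by (rule bounded_linear_Blinfun_apply[OF blD[OF that]])
  have cont: "continuous_on (x ` U) F'"
  proof (rule continuous_on_blinfun_componentwise)
    fix i :: "real^2"
    have "continuous_on (x ` U) (pdiff j ?f)" for j
      by (rule smooth_map_on_continuous_on[OF smooth_map_on_pdiff[OF P.smooth]])
    then have "continuous_on (x ` U) (\<lambda>v. D v i)"
      unfolding D_def by (intro linear_continuous_on_compose[OF _ linear_proj] continuous_intros)
    then show "continuous_on (x ` U) (\<lambda>v. blinfun_apply (F' v) i)"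
      by (rule continuous_on_eq) (simp add: F')
  qed
  have inj: "inj (D ?u)"
  proof (rule injI)
    fix w z :: "real^2" assume "D ?u w = D ?u z"
    then show "w = z"
      using P.lift_unique[OF graphical_proj_det[OF U p], of w "D ?u w"]
        P.lift_unique[OF graphical_proj_det[OF U p], of z "D ?u w"]
      by (simp add: D_def vec_eq_iff forall_2)
  qed
  have "linear (D ?u)"
    using blD[OF u] by (simp add: linear_conv_bounded_linear)
  from linear_injective_left_inverse[OF this inj] obtain J where J: "linear J" "J \<circ> D ?u = id"
    by (elim exE conjE) (rule that)
  have invJ: "Blinfun J o\<^sub>L F' ?u = id_blinfun"
  proof (rule blinfun_eqI)
    fix i
    have "blinfun_apply (Blinfun J) = J"
      using J(1) by (intro bounded_linear_Blinfun_apply) (simp add: linear_conv_bounded_linear)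
    then show "blinfun_apply (Blinfun J o\<^sub>L F' ?u) i = blinfun_apply id_blinfun i"
      using J(2) by (simp add: F'[OF u] fun_eq_iff)
  qed
  have dF': "(F has_derivative blinfun_apply (F' v)) (at v)" if "v \<in> x ` U" for v
    using dF[OF that] F'[OF that] by simp
  obtain U' B h h' where H: "open U'" "U' \<subseteq> x ` U" "?u \<in> U'" "open B" "F ?u \<in> B" "homeomorphism U' B F h"
    and h': "\<And>y. y \<in> B \<Longrightarrow> (h has_derivative h' y) (at y)"
      "\<And>y. y \<in> B \<Longrightarrow> h' y = inv (blinfun_apply (F' (h y)))" "\<And>y. y \<in> B \<Longrightarrow> bij (blinfun_apply (F' (h y)))"
    by (rule inverse_function_theorem[OF P.open_S dF' cont u invJ], assumption, rule that)
  let ?V = "{r \<in> U. x r \<in> U'}" and ?\<sigma> = "inv_into U x \<circ> h"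
  have Fx: "F (x r) = shadow r" if "r \<in> U" for r
    using that U(1) by (simp add: F_def shadow_def)
  have hB: "h b \<in> U'" "F (h b) = b" if "b \<in> B" for b
    using H(6) that by (auto simp: homeomorphism_def)
  have hF: "F v \<in> B" "h (F v) = v" if "v \<in> U'" for v
    using H(6) that by (auto simp: homeomorphism_def)
  have \<sigma>: "?\<sigma> b \<in> U" "x (?\<sigma> b) = h b" if "b \<in> B" for b
    using hB(1)[OF that] H(2) U(1) by (auto simp: subset_iff)
  show thesis
  proof (rule that[of ?V B ?\<sigma>])
    show "openin L ?V"
      by (rule openin_chart_preimage[OF U(1) H(1)])
    show "p \<in> ?V" "?V \<subseteq> U" "open B"
      using U(2) H(3,4) by auto
    show "shadow p \<in> B"
      using H(5) Fx[OF U(2)] by simp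
    show "continuous_map (top_of_set B) L ?\<sigma>"
    proof (rule continuous_map_compose[OF _ continuous_map_chart_inverse[OF U(1)]])
      have "continuous_on B h"
        using H(6) by (simp add: homeomorphism_def)
      then show "continuous_map (top_of_set B) (top_of_set (x ` U)) h"
        using hB(1) H(2) by (simp add: continuous_map_in_subtopology image_subset_iff subset_iff)
    qed
    show "?\<sigma> b \<in> ?V \<and> shadow (?\<sigma> b) = b" if "b \<in> B" for b
      using \<sigma>[OF that] hB[OF that] Fx[OF \<sigma>(1)[OF that]] by simp
    show "shadow r \<in> B \<and> ?\<sigma> (shadow r) = r" if "r \<in> ?V" for r
    proof -
      have r: "r \<in> U" "x r \<in> U'"
        using that by auto
      show ?thesis
        using hF[OF r(2)] U(1) r(1) unfolding Fx[OF r(1)] by simp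
    qed
    show "(x \<circ> ?\<sigma>) differentiable (at b)" if "b \<in> B" for b
    proof -
      have "((x \<circ> ?\<sigma>) has_derivative h' b) (at b)"
        by (rule has_derivative_transform_within_open[OF h'(1)[OF that] H(4) that]) (use \<sigma>(2) in simp)
      then show ?thesis
        by (rule differentiableI)
    qed
  qed
qed

text \<open>Only continuity is required. Near each point the section coincides with a local inverse
  of \<open>shadow\<close>, so it is automatically C1, see \<open>section_smooth_param\<close>; this
  makes gluing sections easy.\<close>

definition graph_section :: "(real^2) set \<Rightarrow> (real^2 \<Rightarrow> 'a) \<Rightarrow> bool" where
  "graph_section W s \<longleftrightarrow> open W \<and> continuous_map (top_of_set W) L s \<and>
     (\<forall>v\<in>W. shadow (s v) = v \<and> graphical 2 (s v))"

lemma graph_sectionD: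
  assumes "graph_section W s"
  shows "open W" "continuous_map (top_of_set W) L s"
    and "v \<in> W \<Longrightarrow> shadow (s v) = v" "v \<in> W \<Longrightarrow> graphical 2 (s v)" "v \<in> W \<Longrightarrow> s v \<in> topspace L"
  using assms unfolding graph_section_def continuous_map_def by auto

text \<open>Near \<open>v\<close> the section agrees with the differentiable local inverse, so a
  derivative exists. Differentiating the identity that the projection undoes the section shows which
  one, by Cramer's rule.\<close>

lemma section_chart_derivative:
  assumes s: "graph_section W s" and v: "v \<in> W" and U: "(U, x) \<in> A" "s v \<in> U"
  shows "((x \<circ> s) has_derivative (\<lambda>a. vector
    [projected_patch.lift1 (local_rep g (U, x)) \<pi> a (x (s v)), projected_patch.lift2 (local_rep g (U, x)) \<pi> a (x (s v))])) (at v)"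
proof -
  interpret P: projected_patch "local_rep g (U, x)" "x ` U" \<pi>
    by (rule projected_patch_chart[OF U(1)])
  let ?f = "local_rep g (U, x)"
  note sD = graph_sectionD[OF s]
  obtain V B \<sigma> where V: "openin L V" "s v \<in> V" "V \<subseteq> U" "open B" "shadow (s v) \<in> B"
    and "continuous_map (top_of_set B) L \<sigma>" "\<And>b. b \<in> B \<Longrightarrow> \<sigma> b \<in> V \<and> shadow (\<sigma> b) = b"
    and \<sigma>: "\<And>r. r \<in> V \<Longrightarrow> shadow r \<in> B \<and> \<sigma> (shadow r) = r" "\<And>b. b \<in> B \<Longrightarrow> (x \<circ> \<sigma>) differentiable (at b)"
    by (rule local_inverse[OF U sD(4)[OF v]]) (rule that)
  let ?W = "{v \<in> W. s v \<in> V}"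
  have W: "open ?W" "v \<in> ?W"
    using smooth_param_openin[OF sD(2,1) V(1)] v V(2) by auto
  have s\<sigma>: "(x \<circ> \<sigma>) z = (x \<circ> s) z" if "z \<in> ?W" for z
  proof -
    have "s z = \<sigma> z"
      using \<sigma>(1)[of "s z"] sD(3)[of z] that by auto
    then show ?thesis
      by simp
  qed
  obtain D where "((x \<circ> \<sigma>) has_derivative D) (at v)"
    using \<sigma>(2)[OF V(5)] sD(3)[OF v] by (auto simp: differentiable_def)
  then have D: "((x \<circ> s) has_derivative D) (at v)"
    by (rule has_derivative_transform_within_open[OF _ W s\<sigma>])
  have xs: "x (s v) \<in> x ` U"
    using U(2) by blast
  have "(?f has_derivative (\<lambda>w. tangent_vector ?f (x (s v)) w)) (at ((x \<circ> s) v))"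
    using has_derivative_pdiff[OF P.differentiable[OF xs]] by simp
  from has_derivative_compose[OF D this]
  have "((\<lambda>z. ?f ((x \<circ> s) z) - g q) has_derivative
      (\<lambda>a. D a$1 *\<^sub>R pdiff 1 ?f (x (s v)) + D a$2 *\<^sub>R pdiff 2 ?f (x (s v)) - 0)) (at v)"
    by (intro has_derivative_diff has_derivative_const)
  from bounded_linear.has_derivative[OF P.bounded_linear_proj this]
  have 1: "((\<lambda>z. \<pi> (?f ((x \<circ> s) z) - g q)) has_derivative
      (\<lambda>a. \<pi> (D a$1 *\<^sub>R pdiff 1 ?f (x (s v)) + D a$2 *\<^sub>R pdiff 2 ?f (x (s v))))) (at v)"
    by simp
  have "((\<lambda>z. \<pi> (?f ((x \<circ> s) z) - g q)) has_derivative (\<lambda>a. a)) (at v)"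
  proof (rule has_derivative_transform_within_open[OF has_derivative_ident W])
    fix z assume z: "z \<in> ?W"
    then have "s z \<in> U"
      using V(3) by blast
    then show "z = \<pi> (?f ((x \<circ> s) z) - g q)"
      using sD(3)[of z] z U(1) by (simp add: shadow_def)
  qed
  from has_derivative_unique[OF 1 this]
  have "\<pi> (D a$1 *\<^sub>R pdiff 1 ?f (x (s v)) + D a$2 *\<^sub>R pdiff 2 ?f (x (s v))) = a" for a
    by (rule fun_cong)
  from P.lift_unique[OF graphical_proj_det[OF U sD(4)[OF v]] this]
  have "D a = vector [P.lift1 a (x (s v)), P.lift2 a (x (s v))]" for a
    by (simp add: vec_eq_iff forall_2)
  then have "D = (\<lambda>a. vector [P.lift1 a (x (s v)), P.lift2 a (x (s v))])"
    by (rule ext)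
  with D show ?thesis
    by simp
qed

lemma section_derivative:
  assumes s: "graph_section W s" and v: "v \<in> W" and U: "(U, x) \<in> A" "s v \<in> U"
  shows "((g \<circ> s) has_derivative (\<lambda>a. projected_patch.frame (local_rep g (U, x)) \<pi> a (x (s v)))) (at v)"
proof -
  interpret P: projected_patch "local_rep g (U, x)" "x ` U" \<pi>
    by (rule projected_patch_chart[OF U(1)])
  let ?f = "local_rep g (U, x)"
  note sD = graph_sectionD[OF s]
  have xs: "x (s v) \<in> x ` U"
    using U(2) by blast
  have "(?f has_derivative (\<lambda>w. tangent_vector ?f (x (s v)) w)) (at ((x \<circ> s) v))"
    using has_derivative_pdiff[OF P.differentiable[OF xs]] by simp
  from has_derivative_compose[OF section_chart_derivative[OF s v U] this]
  have "((\<lambda>z. ?f ((x \<circ> s) z)) has_derivative (\<lambda>a. P.frame a (x (s v)))) (at v)"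
    by (simp add: P.frame_def)
  moreover have "open {v \<in> W. s v \<in> U}"
    by (rule smooth_param_openin[OF sD(2,1) chart_openin[OF U(1)]])
  ultimately show ?thesis
    by (rule has_derivative_transform_within_open) (use v U in auto)
qed

lemma section_smooth_param:
  assumes s: "graph_section W s"
  shows "smooth_param W s"
proof -
  note sD = graph_sectionD[OF s]
  have d: "(x \<circ> s) differentiable (at v)" if "(U, x) \<in> A" "v \<in> W" "s v \<in> U" for U x v
    using section_chart_derivative[OF s that(2,1,3)] by (rule differentiableI)
  have c: "continuous_on {v \<in> W. s v \<in> U} (\<lambda>v. frechet_derivative (x \<circ> s) (at v) a)"
    if U: "(U, x) \<in> A" for U x a
  proof -
    interpret P: projected_patch "local_rep g (U, x)" "x ` U" \<pi>
      by (rule projected_patch_chart[OF U])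
    let ?W = "{v \<in> W. s v \<in> U}" and ?S = "{u \<in> x ` U. P.proj_det u \<noteq> 0}"
    have cx: "continuous_on ?W (x \<circ> s)"
      by (rule continuous_at_imp_continuous_on) (use d U in \<open>blast intro: differentiable_imp_continuous_within\<close>)
    have sub: "(x \<circ> s) ` ?W \<subseteq> ?S"
      using graphical_proj_det[OF U] sD(4) by auto
    have l: "continuous_on ?S (P.lift1 a)" "continuous_on ?S (P.lift2 a)"
      by (rule continuous_at_imp_continuous_on,
          use P.differentiable_lift in \<open>blast intro: differentiable_imp_continuous_within\<close>)+
    have 1: "continuous_on ?W (\<lambda>v. P.lift1 a (x (s v)))" "continuous_on ?W (\<lambda>v. P.lift2 a (x (s v)))"
      using continuous_on_compose2[OF l(1) cx sub] continuous_on_compose2[OF l(2) cx sub] by simp_all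
    have "continuous_on ?W (\<lambda>v. P.lift1 a (x (s v)) *\<^sub>R axis 1 1 + P.lift2 a (x (s v)) *\<^sub>R axis 2 1 :: real^2)"
      by (intro continuous_on_add continuous_on_scaleR continuous_on_const 1)
    then show ?thesis
    proof (rule continuous_on_eq)
      fix v assume "v \<in> ?W"
      then have "frechet_derivative (x \<circ> s) (at v) = (\<lambda>a. vector [P.lift1 a (x (s v)), P.lift2 a (x (s v))])"
        using frechet_derivative_at[OF section_chart_derivative[OF s _ U], of v] by simp
      then show "P.lift1 a (x (s v)) *\<^sub>R axis 1 1 + P.lift2 a (x (s v)) *\<^sub>R axis 2 1 = frechet_derivative (x \<circ> s) (at v) a"
        by (simp add: vec_eq_iff forall_2 axis_def)
    qed
  qed
  show ?thesis
    unfolding smooth_param_def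
  proof (intro conjI sD(1,2) ballI)
    fix ch assume ch: "ch \<in> A"
    obtain U x where "ch = (U, x)"
      by (rule prod.exhaust)
    then show "case ch of (U, x) \<Rightarrow> (\<forall>v\<in>W. s v \<in> U \<longrightarrow> (x \<circ> s) differentiable (at v)) \<and>
        (\<forall>a. continuous_on {v \<in> W. s v \<in> U} (\<lambda>v. frechet_derivative (x \<circ> s) (at v) a))"
      using c[of U x] d[of U x] ch by simp
  qed
qed

lemma section_derivative_props:
  assumes s: "graph_section W s" and v: "v \<in> W"
  shows "frechet_derivative (g \<circ> s) (at v) a \<in> tangent_at (s v)"
    and "\<pi> (frechet_derivative (g \<circ> s) (at v) a) = a"
    and "norm (frechet_derivative (g \<circ> s) (at v) a) \<le> 2 * norm a"
proof -
  obtain U x where U: "(U, x) \<in> A" "s v \<in> U"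
    using graph_sectionD(5)[OF s v] by (rule exists_chart)
  interpret P: projected_patch "local_rep g (U, x)" "x ` U" \<pi>
    by (rule projected_patch_chart[OF U(1)])
  note gr = graph_sectionD(4)[OF s v]
  have eq: "frechet_derivative (g \<circ> s) (at v) a = P.frame a (x (s v))"
    by (simp add: frechet_derivative_at[OF section_derivative[OF s v U], symmetric])
  have "P.frame a (x (s v)) \<in> tangent_plane (local_rep g (U, x)) (x (s v))"
    unfolding P.tangent_plane_eq[OF imageI[OF U(2)]] P.frame_def
    by (rule range_eqI[of _ _ "vector [P.lift1 a (x (s v)), P.lift2 a (x (s v))]"]) simp
  then show T: "frechet_derivative (g \<circ> s) (at v) a \<in> tangent_at (s v)"
    unfolding eq tangent_at_eq[OF U] .
  show pa: "\<pi> (frechet_derivative (g \<circ> s) (at v) a) = a"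
    unfolding eq by (rule P.proj_frame[OF graphical_proj_det[OF U gr]])
  show "norm (frechet_derivative (g \<circ> s) (at v) a) \<le> 2 * norm a"
    using bspec[OF gr[unfolded graphical_def] T] pa by simp
qed

text \<open>The set of agreement is closed because \<open>L\<close> is Hausdorff and open because
  \<open>shadow\<close> is injective near each point of a section.\<close>

lemma sections_agree:
  assumes s: "graph_section W s" and s': "graph_section W' s'"
    and C: "connected C" "C \<subseteq> W" "C \<subseteq> W'" and z: "z \<in> C" "s z = s' z" and w: "w \<in> C"
  shows "s w = s' w"
proof -
  note sD = graph_sectionD[OF s] and sD' = graph_sectionD[OF s']
  let ?E = "{z \<in> C. s z = s' z}"
  have cs: "continuous_map (top_of_set C) L s" "continuous_map (top_of_set C) L s'"
    using continuous_map_from_subtopology_mono[OF sD(2) C(2)] continuous_map_from_subtopology_mono[OF sD'(2) C(3)] .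
  have "Hausdorff_space L"
    using surface unfolding smooth_surface_def by blast
  from closedin_continuous_maps_eq[OF this cs]
  have cl: "closedin (top_of_set C) ?E"
    by simp
  have op: "openin (top_of_set C) ?E"
  proof (subst openin_subopen, intro ballI)
    fix v assume v: "v \<in> ?E"
    then have vW: "v \<in> W" "v \<in> C" "s v = s' v"
      using C by auto
    obtain U x where U: "(U, x) \<in> A" "s v \<in> U"
      using sD(5)[OF vW(1)] by (rule exists_chart)
    obtain V B \<sigma> where V: "openin L V" "s v \<in> V" "V \<subseteq> U" "open B" "shadow (s v) \<in> B"
      and "continuous_map (top_of_set B) L \<sigma>" "\<And>b. b \<in> B \<Longrightarrow> \<sigma> b \<in> V \<and> shadow (\<sigma> b) = b"
      and \<sigma>: "\<And>r. r \<in> V \<Longrightarrow> shadow r \<in> B \<and> \<sigma> (shadow r) = r" "\<And>b. b \<in> B \<Longrightarrow> (x \<circ> \<sigma>) differentiable (at b)"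
      by (rule local_inverse[OF U sD(4)[OF vW(1)]]) (rule that)
    let ?T = "{z \<in> topspace (top_of_set C). s z \<in> V} \<inter> {z \<in> topspace (top_of_set C). s' z \<in> V}"
    have "openin (top_of_set C) ?T"
      by (intro openin_Int openin_continuous_map_preimage[OF cs(1) V(1)] openin_continuous_map_preimage[OF cs(2) V(1)])
    moreover have "v \<in> ?T"
      using vW V(2) by simp
    moreover have "?T \<subseteq> ?E"
    proof
      fix z assume z: "z \<in> ?T"
      then have zC: "z \<in> C" "s z \<in> V" "s' z \<in> V"
        by auto
      then have "shadow (s z) = z" "shadow (s' z) = z"
        using sD(3) sD'(3) C by auto
      then have "s z = s' z"
        using \<sigma>(1)[OF zC(2)] \<sigma>(1)[OF zC(3)] by simp
      then show "z \<in> ?E"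
        using zC(1) by simp
    qed
    ultimately show "\<exists>T. openin (top_of_set C) T \<and> v \<in> T \<and> T \<subseteq> ?E"
      by (intro exI[of _ ?T] conjI)
  qed
  have "?E = {} \<or> ?E = C"
    using C(1)[unfolded connected_clopen, rule_format, OF conjI[OF op cl]] .
  then show ?thesis
    using z w by blast
qed

end

context immersed_surface
begin

definition second_form_le :: "real \<Rightarrow> 'a \<Rightarrow> bool" where
  "second_form_le C p \<longleftrightarrow> (\<forall>(U, x)\<in>A. p \<in> U \<longrightarrow> (\<forall>w1 w2 z1 z2.
     norm (second_form (local_rep g (U, x)) (x p) w1 w2 z1 z2)
     \<le> C * norm (tangent_combination (local_rep g (U, x)) (x p) w1 w2)
        * norm (tangent_combination (local_rep g (U, x)) (x p) z1 z2)))"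

lemma second_form_leD:
  assumes "second_form_le C p" "(U, x) \<in> A" "p \<in> U"
  shows "norm (second_form (local_rep g (U, x)) (x p) w1 w2 z1 z2)
     \<le> C * norm (tangent_combination (local_rep g (U, x)) (x p) w1 w2)
        * norm (tangent_combination (local_rep g (U, x)) (x p) z1 z2)"
  using bspec[OF assms(1)[unfolded second_form_le_def] assms(2), unfolded prod.case] assms(3) by simp

lemma continuous_map_immersion: "continuous_map L euclidean g"
  unfolding continuous_map_def
proof (intro conjI allI impI)
  show "g \<in> topspace L \<rightarrow> topspace euclidean"
    by simp
  fix O' :: "'b set" assume "openin euclidean O'"
  then have O': "open O'"
    by simp
  show "openin L {p \<in> topspace L. g p \<in> O'}"
  proof (subst openin_subopen, intro ballI)
    fix p assume p: "p \<in> {p \<in> topspace L. g p \<in> O'}"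
    then have "p \<in> topspace L"
      by simp
    then obtain U x where U: "(U, x) \<in> A" "p \<in> U"
      by (rule exists_chart)
    interpret P: immersed_patch "local_rep g (U, x)" "x ` U"
      by (rule immersed_patch_chart[OF U(1)])
    let ?S = "x ` U \<inter> local_rep g (U, x) -` O'"
    have "open ?S"
      by (rule continuous_open_preimage[OF smooth_map_on_continuous_on[OF P.smooth] P.open_S O'])
    then have "openin L {r \<in> U. x r \<in> ?S}"
      by (rule openin_chart_preimage[OF U(1)])
    moreover have "{r \<in> U. x r \<in> ?S} \<subseteq> {p \<in> topspace L. g p \<in> O'}"
    proof
      fix r assume "r \<in> {r \<in> U. x r \<in> ?S}"
      then have "r \<in> U" "local_rep g (U, x) (x r) \<in> O'"
        by auto
      then show "r \<in> {p \<in> topspace L. g p \<in> O'}"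
        using chart_subset[OF U(1)] U(1) by auto
    qed
    moreover have "p \<in> {r \<in> U. x r \<in> ?S}"
      using p U by auto
    ultimately show "\<exists>T. openin L T \<and> p \<in> T \<and> T \<subseteq> {p \<in> topspace L. g p \<in> O'}"
      by (intro exI[of _ "{r \<in> U. x r \<in> ?S}"] conjI)
  qed
qed

end

section \<open>How the slope of a graph varies\<close>

context projected_surface
begin

lemma continuous_map_shadow: "continuous_map L euclidean shadow"
proof -
  have "continuous_on UNIV (\<lambda>y. \<pi> (y - g q))"
    by (intro linear_continuous_on_compose[OF _ linear_proj] continuous_intros)
  then have "continuous_map euclidean euclidean (\<lambda>y. \<pi> (y - g q))"
    by simp
  from continuous_map_compose[OF continuous_map_immersion this] show ?thesis
    by (simp add: shadow_def[abs_def] o_def)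
qed

lemma openin_shadow_preimage:
  assumes "openin L V" "open O'"
  shows "openin L {r \<in> V. shadow r \<in> O'}"
proof -
  have "openin L {r \<in> topspace L. shadow r \<in> O'}"
    using openin_continuous_map_preimage[OF continuous_map_shadow] assms(2) by simp
  moreover have "{r \<in> V. shadow r \<in> O'} = V \<inter> {r \<in> topspace L. shadow r \<in> O'}"
    using openin_subset[OF assms(1)] by blast
  ultimately show ?thesis
    using assms(1) by (simp add: openin_Int)
qed

text \<open>Keeps a graph over a disc of radius r within distance 2 r of its centre, where the bound
  on the second fundamental form is available.\<close>

lemma section_displacement:
  assumes s: "graph_section W s" and seg: "closed_segment z v \<subseteq> W"
  shows "norm (g (s v) - g (s z)) \<le> 2 * norm (v - z)"
proof -
  have "norm ((g \<circ> s) v - (g \<circ> s) z) \<le> 2 * norm (v - z)"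
  proof (rule differentiable_bound[OF convex_closed_segment])
    fix y assume "y \<in> closed_segment z v"
    then have y: "y \<in> W"
      using seg by blast
    show "((g \<circ> s) has_derivative frechet_derivative (g \<circ> s) (at y)) (at y within closed_segment z v)"
      by (rule has_derivative_at_withinI[OF frechet_derivative_works[THEN iffD1,
            OF smooth_param_differentiable[OF section_smooth_param[OF s] y]]])
    show "onorm (frechet_derivative (g \<circ> s) (at y)) \<le> 2"
      by (rule onorm_le) (rule section_derivative_props(3)[OF s y])
  qed auto
  then show ?thesis
    by simp
qed

lemma tangent_eq_section_derivative:
  assumes s: "graph_section W s" and v: "v \<in> W" and \<tau>: "\<tau> \<in> tangent_at (s v)"
  shows "\<tau> = frechet_derivative (g \<circ> s) (at v) (\<pi> \<tau>)"
proof -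
  obtain U x where U: "(U, x) \<in> A" "s v \<in> U"
    using graph_sectionD(5)[OF s v] by (rule exists_chart)
  interpret P: projected_patch "local_rep g (U, x)" "x ` U" \<pi>
    by (rule projected_patch_chart[OF U(1)])
  obtain w :: "real^2" where w: "\<tau> = tangent_vector (local_rep g (U, x)) (x (s v)) w"
    using \<tau> unfolding tangent_at_eq[OF U] P.tangent_plane_eq[OF imageI[OF U(2)]] by (elim rangeE) (rule that)
  note l = P.lift_unique[OF graphical_proj_det[OF U graph_sectionD(4)[OF s v]] arg_cong[OF w[symmetric], of \<pi>]]
  have "\<tau> = P.frame (\<pi> \<tau>) (x (s v))"
    unfolding P.frame_def l[symmetric] by (rule w)
  then show ?thesis
    by (simp add: frechet_derivative_at[OF section_derivative[OF s v U], symmetric])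
qed

lemma section_second_derivative_bound:
  assumes s: "graph_section W s" and v: "v \<in> W" and C: "second_form_le C (s v)" "C \<ge> 0"
  obtains Y where "((\<lambda>z. frechet_derivative (g \<circ> s) (at z) a) has_derivative Y) (at v)"
    "\<And>b. norm (Y b) \<le> 12 * C * norm a * norm b"
proof -
  obtain U x where U: "(U, x) \<in> A" "s v \<in> U"
    using graph_sectionD(5)[OF s v] by (rule exists_chart)
  interpret P: projected_patch "local_rep g (U, x)" "x ` U" \<pi>
    by (rule projected_patch_chart[OF U(1)])
  let ?f = "local_rep g (U, x)" and ?u = "x (s v)"
  note sD = graph_sectionD[OF s]
  have eq: "frechet_derivative (g \<circ> s) (at z) b = P.frame b (x (s z))" if "z \<in> W" "s z \<in> U" for z b
    by (simp add: frechet_derivative_at[OF section_derivative[OF s that(1) U(1) that(2)], symmetric])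
  obtain Y where Y: "(P.frame a has_derivative Y) (at ?u)"
    "\<And>w. norm (Y w) \<le> 3 * C * norm (P.frame a ?u) * norm (tangent_vector ?f ?u w)"
    by (rule P.frame_derivative_bound[OF imageI[OF U(2)] sD(4)[OF v, unfolded graphical_chart[OF U], rule_format]
          second_form_leD[OF C(1) U]]) (rule that)
  let ?D = "\<lambda>b. vector [P.lift1 b ?u, P.lift2 b ?u] :: real^2"
  have "((\<lambda>z. P.frame a ((x \<circ> s) z)) has_derivative (\<lambda>b. Y (?D b))) (at v)"
    by (rule has_derivative_compose[OF section_chart_derivative[OF s v U]]) (use Y(1) in simp)
  then have 1: "((\<lambda>z. frechet_derivative (g \<circ> s) (at z) a) has_derivative (\<lambda>b. Y (?D b))) (at v)"
  proof (rule has_derivative_transform_within_open)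
    show "open {z \<in> W. s z \<in> U}"
      by (rule smooth_param_openin[OF sD(2,1) chart_openin[OF U(1)]])
    show "v \<in> {z \<in> W. s z \<in> U}"
      using v U by simp
    show "P.frame a ((x \<circ> s) z) = frechet_derivative (g \<circ> s) (at z) a" if "z \<in> {z \<in> W. s z \<in> U}" for z
      using eq[of z a] that by simp
  qed
  show thesis
  proof (rule that[OF 1])
    fix b
    have "norm (Y (?D b)) \<le> 3 * C * norm (P.frame a ?u) * norm (P.frame b ?u)"
      using Y(2)[of "?D b"] by (simp add: P.frame_def)
    \<comment> \<open>The constant 12 is 3 from \<open>frame_derivative_bound\<close> times a slope
      bound of 2 for each of the directions \<open>a\<close> and \<open>b\<close>.\<close>
    also have "\<dots> \<le> 3 * C * (2 * norm a) * (2 * norm b)"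
      using section_derivative_props(3)[OF s v, unfolded eq[OF v U(2)]] C(2)
      by (intro mult_mono mult_left_mono) auto
    finally show "norm (Y (?D b)) \<le> 12 * C * norm a * norm b"
      by simp
  qed
qed

lemma graphical_limit:
  assumes lim: "limitin L p p' sequentially" and p: "\<And>n. graphical c (p n)" "\<And>n. p n \<in> topspace L"
  shows "graphical c p'"
proof -
  have p': "p' \<in> topspace L"
    using lim by (simp add: limitin_def)
  obtain U x where U: "(U, x) \<in> A" "p' \<in> U"
    using p' by (rule exists_chart)
  interpret P: projected_patch "local_rep g (U, x)" "x ` U" \<pi>
    by (rule projected_patch_chart[OF U(1)])
  let ?f = "local_rep g (U, x)"
  have ev: "\<forall>\<^sub>F n in sequentially. p n \<in> U"
    using lim chart_openin[OF U(1)] U(2) by (simp add: limitin_def)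
  have xlim: "(\<lambda>n. x (p n)) \<longlonglongrightarrow> x p'"
  proof (rule topological_tendstoI)
    fix O' assume O': "open O'" "x p' \<in> O'"
    have "openin L {r \<in> U. x r \<in> O'}"
      by (rule openin_chart_preimage[OF U(1) O'(1)])
    then have "\<forall>\<^sub>F n in sequentially. p n \<in> {r \<in> U. x r \<in> O'}"
      using conjunct2[OF lim[unfolded limitin_def], rule_format, of "{r \<in> U. x r \<in> O'}"] U(2) O'(2) by blast
    then show "\<forall>\<^sub>F n in sequentially. x (p n) \<in> O'"
      by eventually_elim simp
  qed
  have "isCont (pdiff i ?f) (x p')" for i
    by (rule bspec[OF continuous_on_eq_continuous_at[OF P.open_S, THEN iffD1,
            OF smooth_map_on_continuous_on[OF smooth_map_on_pdiff[OF P.smooth]]] imageI[OF U(2)]])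
  then have flim: "(\<lambda>n. pdiff i ?f (x (p n))) \<longlonglongrightarrow> pdiff i ?f (x p')" for i
    by (rule isCont_tendsto_compose[OF _ xlim])
  show ?thesis
    unfolding graphical_chart[OF U]
  proof
    fix w :: "real^2"
    let ?h = "\<lambda>n. tangent_vector ?f (x (p n)) w"
    let ?l = "tangent_vector ?f (x p') w"
    have h: "?h \<longlonglongrightarrow> ?l"
      by (intro tendsto_intros flim)
    show "norm ?l \<le> c * norm (\<pi> ?l)"
    proof (rule tendsto_le[OF trivial_limit_sequentially])
      show "(\<lambda>n. c * norm (\<pi> (?h n))) \<longlonglongrightarrow> c * norm (\<pi> ?l)"
        by (intro tendsto_intros bounded_linear.tendsto[OF P.bounded_linear_proj] flim)
      show "(\<lambda>n. norm (?h n)) \<longlonglongrightarrow> norm ?l"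
        by (rule tendsto_norm[OF h])
      show "\<forall>\<^sub>F n in sequentially. norm (?h n) \<le> c * norm (\<pi> (?h n))"
        using ev
      proof eventually_elim
        case (elim n)
        show ?case
          by (rule p(1)[of n, unfolded graphical_chart[OF U(1) elim], rule_format])
      qed
    qed
  qed
qed

lemma graphical_neighbourhood:
  assumes p: "p \<in> topspace L" "graphical (3/2) p"
  obtains V where "openin L V" "p \<in> V" "\<And>r. r \<in> V \<Longrightarrow> graphical 2 r"
proof -
  obtain U x where U: "(U, x) \<in> A" "p \<in> U"
    using p(1) by (rule exists_chart)
  interpret P: projected_patch "local_rep g (U, x)" "x ` U" \<pi>
    by (rule projected_patch_chart[OF U(1)])
  let ?f = "local_rep g (U, x)" and ?u = "x p"
  let ?D = "\<lambda>u (w::real^2). tangent_vector ?f u w"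
  have "{?u} \<subseteq> x ` U"
    using U(2) by blast
  then obtain m where m: "m > 0" "\<And>u w. u \<in> {?u} \<Longrightarrow> m * norm w \<le> norm (?D u w)"
    by (rule P.derivative_bounded_below[OF compact_sing]) (rule that)
  have cont: "continuous_on (x ` U) (pdiff i ?f)" for i
    by (rule smooth_map_on_continuous_on[OF smooth_map_on_pdiff[OF P.smooth]])
  \<comment> \<open>Let P be the length of the projected vector at \<open>p\<close>. The
    perturbation is at most 2/23 m |w| and hence at most 3/23 P. So the new vector has length at
    most 75/46 P, and twice its projection at least 80/46 P. Any divisor from 18 on would
    do.\<close>
  let ?O = "\<lambda>i. x ` U \<inter> pdiff i ?f -` ball (pdiff i ?f ?u) (m / 23)"
  have "open (?O i)" for i
    by (rule continuous_open_preimage[OF cont P.open_S open_ball])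
  then have "open (?O 1 \<inter> ?O 2)"
    by blast
  then have op: "openin L {r \<in> U. x r \<in> ?O 1 \<inter> ?O 2}"
    by (rule openin_chart_preimage[OF U(1)])
  have mem: "p \<in> {r \<in> U. x r \<in> ?O 1 \<inter> ?O 2}"
    using U m(1) by simp
  show thesis
  proof (rule that[OF op mem])
    fix r assume r: "r \<in> {r \<in> U. x r \<in> ?O 1 \<inter> ?O 2}"
    then have rU: "r \<in> U"
      by simp
    have close: "norm (pdiff i ?f (x r) - pdiff i ?f ?u) \<le> m / 23" if "i \<in> {1, 2}" for i
      using r that by (auto simp: dist_norm norm_minus_commute)
    show "graphical 2 r"
      unfolding graphical_chart[OF U(1) rU]
    proof
      fix w :: "real^2"
      let ?d = "?D (x r) w - ?D ?u w"
      have "?d = w$1 *\<^sub>R (pdiff 1 ?f (x r) - pdiff 1 ?f ?u) + w$2 *\<^sub>R (pdiff 2 ?f (x r) - pdiff 2 ?f ?u)"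
        by (simp add: algebra_simps)
      then have "norm ?d \<le> \<bar>w$1\<bar> * norm (pdiff 1 ?f (x r) - pdiff 1 ?f ?u) + \<bar>w$2\<bar> * norm (pdiff 2 ?f (x r) - pdiff 2 ?f ?u)"
        using norm_triangle_ineq[of "w$1 *\<^sub>R (pdiff 1 ?f (x r) - pdiff 1 ?f ?u)" "w$2 *\<^sub>R (pdiff 2 ?f (x r) - pdiff 2 ?f ?u)"]
        by simp
      also have "\<dots> \<le> norm w * (m / 23) + norm w * (m / 23)"
        using component_le_norm_cart[of w 1] component_le_norm_cart[of w 2] close m(1)
        by (intro add_mono mult_mono) auto
      finally have d: "norm ?d \<le> 2 / 23 * (m * norm w)"
        by (simp add: algebra_simps)
      have \<pi>d: "norm (\<pi> (?D (x r) w) - \<pi> (?D ?u w)) \<le> 2 / 23 * (m * norm w)"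
        using d norm_proj[of ?d] by (simp add: linear_diff[OF linear_proj])
      have "norm (?D ?u w) \<le> 3/2 * norm (\<pi> (?D ?u w))"
        using p(2)[unfolded graphical_chart[OF U], rule_format, of w] by simp
      moreover have "m * norm w \<le> norm (?D ?u w)"
        by (rule m(2)) simp
      moreover have "norm (?D (x r) w) \<le> norm (?D ?u w) + norm ?d"
        by (rule norm_triangle_sub)
      moreover have "norm (\<pi> (?D ?u w)) \<le> norm (\<pi> (?D (x r) w)) + norm (\<pi> (?D (x r) w) - \<pi> (?D ?u w))"
        using norm_triangle_sub[of "\<pi> (?D ?u w)" "\<pi> (?D (x r) w)"] unfolding norm_minus_commute[of "\<pi> (?D ?u w)"] .
      ultimately show "norm (?D (x r) w) \<le> 2 * norm (\<pi> (?D (x r) w))"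
        using d \<pi>d norm_ge_zero[of "\<pi> (?D (x r) w)"] by linarith
    qed
  qed
qed

text \<open>Besides a section over a disc it yields a neighbourhood of \<open>p\<close> in the
  surface that lies on this section. The latter identifies the new section with an existing one near
  a limit point.\<close>

lemma local_section:
  assumes p: "p \<in> topspace L" "graphical (3/2) p"
  obtains \<rho> V \<sigma> where "\<rho> > 0" "graph_section (ball (shadow p) \<rho>) \<sigma>" "\<sigma> (shadow p) = p"
    "openin L V" "p \<in> V" "\<And>r. r \<in> V \<Longrightarrow> shadow r \<in> ball (shadow p) \<rho> \<and> \<sigma> (shadow r) = r"
proof -
  obtain U x where U: "(U, x) \<in> A" "p \<in> U"
    using p(1) by (rule exists_chart)
  obtain V B \<sigma> where V: "openin L V" "p \<in> V" "V \<subseteq> U" "open B" "shadow p \<in> B"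
    and c\<sigma>: "continuous_map (top_of_set B) L \<sigma>" and B: "\<And>b. b \<in> B \<Longrightarrow> \<sigma> b \<in> V \<and> shadow (\<sigma> b) = b"
    and \<sigma>: "\<And>r. r \<in> V \<Longrightarrow> shadow r \<in> B \<and> \<sigma> (shadow r) = r" "\<And>b. b \<in> B \<Longrightarrow> (x \<circ> \<sigma>) differentiable (at b)"
    by (rule local_inverse[OF U p(2)]) (rule that)
  obtain V' where V': "openin L V'" "p \<in> V'" "\<And>r. r \<in> V' \<Longrightarrow> graphical 2 r"
    by (rule graphical_neighbourhood[OF p]) (rule that)
  have \<sigma>p: "\<sigma> (shadow p) = p"
    using \<sigma>(1)[OF V(2)] by blast
  have "open {b \<in> B. \<sigma> b \<in> V'}"
    by (rule smooth_param_openin[OF c\<sigma> V(4) V'(1)])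
  moreover have "shadow p \<in> {b \<in> B. \<sigma> b \<in> V'}"
    using V(5) V'(2) \<sigma>p by simp
  ultimately obtain \<rho> where \<rho>: "\<rho> > 0" "ball (shadow p) \<rho> \<subseteq> {b \<in> B. \<sigma> b \<in> V'}"
    using open_contains_ball by blast
  have "graph_section (ball (shadow p) \<rho>) \<sigma>"
    unfolding graph_section_def
  proof (intro conjI ballI)
    show "continuous_map (top_of_set (ball (shadow p) \<rho>)) L \<sigma>"
      by (rule continuous_map_from_subtopology_mono[OF c\<sigma>]) (use \<rho>(2) in blast)
    fix v assume "v \<in> ball (shadow p) \<rho>"
    then have v: "v \<in> B" "\<sigma> v \<in> V'"
      using \<rho>(2) by blast+
    show "shadow (\<sigma> v) = v" "graphical 2 (\<sigma> v)"
      using B[OF v(1)] V'(3)[OF v(2)] by auto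
  qed simp
  moreover have "openin L {r \<in> V. shadow r \<in> ball (shadow p) \<rho>}"
    by (rule openin_shadow_preimage[OF V(1) open_ball])
  ultimately show thesis
    using \<rho>(1) \<sigma>p V(2) \<sigma>(1) by (intro that[of \<rho> \<sigma> "{r \<in> V. shadow r \<in> ball (shadow p) \<rho>}"]) auto
qed

end

section \<open>Graphs over discs of a fixed radius\<close>

text \<open>Along the graph over a ray from the origin the tangent planes turn at a rate controlled by
  the second fundamental form, so that over a disc of radius \<open>1 / (24 C)\<close> they stay within a
  fixed angle of the plane at \<open>q\<close>. Completeness then keeps the graph from ending early.\<close>

locale tame_surface = projected_surface L A g \<pi> q
  for L :: "'a topology" and A :: "'a chart set" and g :: "'a \<Rightarrow> 'b::euclidean_space" and \<pi> q +
  fixes C r :: real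
  assumes isometric_at: "\<tau> \<in> tangent_at q \<Longrightarrow> norm (\<pi> \<tau>) = norm \<tau>"
    and C: "C \<ge> 0" and r: "r > 0" "24 * C * r \<le> 1"
    and second_form: "p \<in> topspace L \<Longrightarrow> norm (g p - g q) \<le> 2 * r \<Longrightarrow> second_form_le C p"
    and complete: "complete_surface L A g"
begin

text \<open>Segments from the origin serve twice: the second fundamental form is integrated along
  them, and they are connected sets on which two sections with the same value at 0 are
  compared.\<close>

definition star_section :: "(real^2) set \<Rightarrow> (real^2 \<Rightarrow> 'a) \<Rightarrow> bool" where
  "star_section W s \<longleftrightarrow> graph_section W s \<and> 0 \<in> W \<and> W \<subseteq> ball 0 r \<and> s 0 = q \<and>
     (\<forall>v\<in>W. closed_segment 0 v \<subseteq> W)"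

lemma star_sectionD:
  assumes "star_section W s"
  shows "graph_section W s" "0 \<in> W" "W \<subseteq> ball 0 r" "s 0 = q" "v \<in> W \<Longrightarrow> closed_segment 0 v \<subseteq> W"
  using assms unfolding star_section_def by blast+

text \<open>The bootstrap. With slope bound 2, the derivative of the graph map in direction
  \<open>a\<close> changes between 0 and \<open>v\<close> by at most 12 C |v| |a|, which is at most
  |a|/2 by the choice of \<open>r\<close>. At 0 it preserves lengths, so the slope bound improves to
  1 + 1/2.\<close>

lemma star_section_graphical:
  assumes s: "star_section W s" and v: "v \<in> W"
  shows "graphical (3/2) (s v)"
proof -
  note S = star_sectionD[OF s] and sD = graph_sectionD[OF star_sectionD(1)[OF s]]
  let ?G = "\<lambda>z. frechet_derivative (g \<circ> s) (at z)"
  have vr: "norm v < r"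
    using v S(3) by auto
  have bound: "norm (?G v a) \<le> 3/2 * norm a" for a
  proof -
    \<comment> \<open>The mean value inequality asks for one function giving the derivative at each
      point of the segment, so the derivatives that exist pointwise are chosen uniformly.\<close>
    define DY where "DY z = (SOME Y. ((\<lambda>z. ?G z a) has_derivative Y) (at z) \<and> (\<forall>b. norm (Y b) \<le> 12 * C * norm a * norm b))" for z
    have "norm (?G v a - ?G 0 a) \<le> (12 * C * norm a) * norm (v - 0)"
    proof (rule differentiable_bound[OF convex_closed_segment, of 0 v "\<lambda>z. ?G z a" DY])
      fix z assume "z \<in> closed_segment 0 v"
      then have "z \<in> W" "norm z \<le> norm v"
        using S(5)[OF v] segment_bound1[of z 0 v] by auto
      note z = this(1) S(5)[OF this(1)] this(2)
      have "norm (g (s z) - g q) \<le> 2 * norm z"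
        using section_displacement[OF S(1) z(2)] S(4) by simp
      also have "\<dots> \<le> 2 * r"
        using z(3) vr by simp
      finally have "second_form_le C (s z)"
        by (rule second_form[OF sD(5)[OF z(1)]])
      then obtain Y where "((\<lambda>z. ?G z a) has_derivative Y) (at z)" "\<And>b. norm (Y b) \<le> 12 * C * norm a * norm b"
        by (rule section_second_derivative_bound[OF S(1) z(1) _ C]) (rule that)
      then have "\<exists>Y. ((\<lambda>z. ?G z a) has_derivative Y) (at z) \<and> (\<forall>b. norm (Y b) \<le> 12 * C * norm a * norm b)"
        by (intro exI[of _ Y]) simp
      note Y = someI_ex[OF this, folded DY_def]
      show "((\<lambda>z. ?G z a) has_derivative DY z) (at z within closed_segment 0 v)"
        by (rule has_derivative_at_withinI[OF conjunct1[OF Y]])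
      show "onorm (DY z) \<le> 12 * C * norm a"
        by (rule onorm_le) (rule conjunct2[OF Y, rule_format])
    qed simp_all
    also have "\<dots> = 12 * C * norm v * norm a"
      by simp
    also have "\<dots> \<le> 1/2 * norm a"
    proof (rule mult_right_mono)
      have "C * norm v \<le> C * r"
        using vr C by (intro mult_left_mono) auto
      then show "12 * C * norm v \<le> 1/2"
        using r(2) by simp
    qed simp
    finally have "norm (?G v a) \<le> norm (?G 0 a) + 1/2 * norm a"
      using norm_triangle_sub[of "?G v a" "?G 0 a"] by linarith
    moreover have "norm (?G 0 a) = norm a"
      using isometric_at[of "?G 0 a"] section_derivative_props(1,2)[OF S(1,2), of a] unfolding S(4) by simp
    ultimately show ?thesis
      by simp
  qed
  show ?thesis
    unfolding graphical_def
  proof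
    fix \<tau> assume "\<tau> \<in> tangent_at (s v)"
    from tangent_eq_section_derivative[OF S(1) v this] show "norm \<tau> \<le> 3/2 * norm (\<pi> \<tau>)"
      using bound[of "\<pi> \<tau>"] by simp
  qed
qed

section \<open>The maximal star-shaped graph\<close>

lemma star_sections_agree:
  assumes s: "star_section W s" and s': "star_section W' s'" and v: "v \<in> W" "v \<in> W'"
  shows "s v = s' v"
proof (rule sections_agree[OF star_sectionD(1)[OF s] star_sectionD(1)[OF s'] connected_segment])
  show "closed_segment 0 v \<subseteq> W" "closed_segment 0 v \<subseteq> W'"
    using star_sectionD(5)[OF s v(1)] star_sectionD(5)[OF s' v(2)] .
  show "s 0 = s' 0"
    using star_sectionD(4)[OF s] star_sectionD(4)[OF s'] by simp
qed auto

text \<open>Star-shaped sections agree on common points, so their union is again a section and no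
  appeal to Zorn's lemma is needed. The choice in \<open>max_section\<close> is thus no real
  choice.\<close>

definition max_domain :: "(real^2) set" where
  "max_domain = \<Union>{W. \<exists>s. star_section W s}"

definition max_section :: "real^2 \<Rightarrow> 'a" where
  "max_section v = (SOME p. \<exists>W s. star_section W s \<and> v \<in> W \<and> p = s v)"

lemma max_section_eq:
  assumes "star_section W s" "v \<in> W"
  shows "max_section v = s v"
proof -
  have "\<exists>p W s. star_section W s \<and> v \<in> W \<and> p = s v"
    by (intro exI conjI) (rule assms(1), rule assms(2), rule refl)
  from someI_ex[OF this, folded max_section_def]
  obtain W' s' where W': "star_section W' s'" "v \<in> W'" "max_section v = s' v"
    by (elim exE conjE) (rule that)
  then show ?thesis
    using star_sections_agree[OF assms(1) W'(1) assms(2) W'(2)] by simp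
qed

lemma max_domainE:
  assumes "v \<in> max_domain"
  obtains W s where "star_section W s" "v \<in> W"
  using assms unfolding max_domain_def by (elim UnionE CollectE exE) (rule that)

lemma max_domain_upper: "star_section W s \<Longrightarrow> W \<subseteq> max_domain"
  unfolding max_domain_def by (rule Union_upper) (rule CollectI, rule exI)

lemma graph_section_Un:
  assumes op: "open W" and loc: "\<And>v. v \<in> W \<Longrightarrow> \<exists>W' s'. graph_section W' s' \<and> v \<in> W' \<and> W' \<subseteq> W \<and> (\<forall>z\<in>W'. s z = s' z)"
  shows "graph_section W s"
  unfolding graph_section_def
proof (intro conjI ballI op)
  show "continuous_map (top_of_set W) L s"
    unfolding continuous_map_def
  proof (intro conjI allI impI)
    show "s \<in> topspace (top_of_set W) \<rightarrow> topspace L"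
    proof
      fix v assume "v \<in> topspace (top_of_set W)"
      then have "v \<in> W"
        by simp
      from loc[OF this] obtain W' s' where "graph_section W' s'" "v \<in> W'" "W' \<subseteq> W" "\<forall>z\<in>W'. s z = s' z"
        by (elim exE conjE) (rule that)
      then show "s v \<in> topspace L"
        using graph_sectionD(5)[of W' s' v] by simp
    qed
    fix V assume V: "openin L V"
    have "open {v \<in> W. s v \<in> V}"
    proof (subst open_subopen, intro ballI)
      fix v assume v: "v \<in> {v \<in> W. s v \<in> V}"
      then have "v \<in> W"
        by simp
      from loc[OF this] obtain W' s' where W': "graph_section W' s'" "v \<in> W'" "W' \<subseteq> W" "\<forall>z\<in>W'. s z = s' z"
        by (elim exE conjE) (rule that)
      have "open {z \<in> W'. s' z \<in> V}"
        by (rule smooth_param_openin[OF graph_sectionD(2,1)[OF W'(1)] V])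
      moreover have "v \<in> {z \<in> W'. s' z \<in> V}"
        using v W' by simp
      moreover have "{z \<in> W'. s' z \<in> V} \<subseteq> {v \<in> W. s v \<in> V}"
        using W' by auto
      ultimately show "\<exists>T. open T \<and> v \<in> T \<and> T \<subseteq> {v \<in> W. s v \<in> V}"
        by (intro exI[of _ "{z \<in> W'. s' z \<in> V}"] conjI)
    qed
    then show "openin (top_of_set W) {v \<in> topspace (top_of_set W). s v \<in> V}"
      using open_subset[of "{v \<in> W. s v \<in> V}" W] by auto
  qed
  fix v assume "v \<in> W"
  from loc[OF this] obtain W' s' where W': "graph_section W' s'" "v \<in> W'" "W' \<subseteq> W" "\<forall>z\<in>W'. s z = s' z"
    by (elim exE conjE) (rule that)
  then show "shadow (s v) = v" "graphical 2 (s v)"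
    using graph_sectionD(3,4)[OF W'(1,2)] by simp_all
qed

lemma exists_star_section: "\<exists>W s. star_section W s"
proof -
  have g: "graphical (3/2) q"
    unfolding graphical_def
  proof
    fix \<tau> assume "\<tau> \<in> tangent_at q"
    from isometric_at[OF this] show "norm \<tau> \<le> 3/2 * norm (\<pi> \<tau>)"
      by simp
  qed
  have q0: "shadow q = 0"
    by (simp add: shadow_def linear_0[OF linear_proj])
  obtain \<rho> V \<sigma> where \<sigma>: "\<rho> > 0" "graph_section (ball (shadow q) \<rho>) \<sigma>" "\<sigma> (shadow q) = q"
    "openin L V" "q \<in> V" "\<And>r. r \<in> V \<Longrightarrow> shadow r \<in> ball (shadow q) \<rho> \<and> \<sigma> (shadow r) = r"
    by (rule local_section[OF q g]) (rule that)
  let ?B = "ball 0 (min \<rho> r) :: (real^2) set"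
  have sub: "?B \<subseteq> ball (shadow q) \<rho>"
    by (auto simp: q0)
  have "graph_section ?B \<sigma>"
    unfolding graph_section_def
    using continuous_map_from_subtopology_mono[OF graph_sectionD(2)[OF \<sigma>(2)] sub] graph_sectionD(3,4)[OF \<sigma>(2)] sub
    by (intro conjI ballI) auto
  moreover have "closed_segment 0 v \<subseteq> ?B" if "v \<in> ?B" for v
    by (rule closed_segment_subset[OF _ that convex_ball]) (use \<sigma>(1) r(1) in simp)
  ultimately have "star_section ?B \<sigma>"
    unfolding star_section_def using \<sigma>(1,3) r(1) q0 by (intro conjI ballI) auto
  then show ?thesis
    by blast
qed

lemma star_section_max: "star_section max_domain max_section"
  unfolding star_section_def
proof (intro conjI ballI)
  obtain W s where s: "star_section W s"
    using exists_star_section by (elim exE) (rule that)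
  show "0 \<in> max_domain"
    using star_sectionD(2)[OF s] max_domain_upper[OF s] by (rule rev_subsetD)
  show "max_section 0 = q"
    using max_section_eq[OF s star_sectionD(2)[OF s]] star_sectionD(4)[OF s] by simp
  show "max_domain \<subseteq> ball 0 r"
  proof
    fix v assume "v \<in> max_domain"
    then obtain W s where W: "star_section W s" "v \<in> W"
      by (rule max_domainE)
    show "v \<in> ball 0 r"
      using W(2) star_sectionD(3)[OF W(1)] by (rule rev_subsetD)
  qed
  show "closed_segment 0 v \<subseteq> max_domain" if v: "v \<in> max_domain" for v
  proof -
    obtain W s where W: "star_section W s" "v \<in> W"
      using v by (rule max_domainE)
    show ?thesis
      using star_sectionD(5)[OF W] max_domain_upper[OF W(1)] by (rule order_trans)
  qed
  show "graph_section max_domain max_section"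
  proof (rule graph_section_Un)
    show "open max_domain"
    proof (subst open_subopen, intro ballI)
      fix v assume "v \<in> max_domain"
      then obtain W s where W: "star_section W s" "v \<in> W"
        by (rule max_domainE)
      then show "\<exists>T. open T \<and> v \<in> T \<and> T \<subseteq> max_domain"
        using graph_sectionD(1)[OF star_sectionD(1)[OF W(1)]] max_domain_upper[OF W(1)] by (intro exI[of _ W] conjI)
    qed
    fix v assume "v \<in> max_domain"
    then obtain W s where W: "star_section W s" "v \<in> W"
      by (rule max_domainE)
    have "\<forall>z\<in>W. max_section z = s z"
      using max_section_eq[OF W(1)] by (intro ballI)
    then show "\<exists>W' s'. graph_section W' s' \<and> v \<in> W' \<and> W' \<subseteq> max_domain \<and> (\<forall>z\<in>W'. max_section z = s' z)"
      using star_sectionD(1)[OF W(1)] W(2) max_domain_upper[OF W(1)] by (intro exI[of _ W] exI[of _ s] conjI)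
  qed
qed

end

section \<open>Continuation of the maximal graph to the whole disc\<close>

context projected_surface
begin

lemma graph_section_subset:
  assumes s: "graph_section W s" and W': "open W'" "W' \<subseteq> W"
  shows "graph_section W' s"
  unfolding graph_section_def
proof (intro conjI ballI W'(1))
  show "continuous_map (top_of_set W') L s"
    by (rule continuous_map_from_subtopology_mono[OF graph_sectionD(2)[OF s] W'(2)])
  show "shadow (s v) = v" "graphical 2 (s v)" if "v \<in> W'" for v
    using graph_sectionD(3,4)[OF s subsetD[OF W'(2) that]] .
qed

end

context tame_surface
begin

lemma max_domain_eq: "max_domain = ball 0 r"
proof (rule antisym[OF star_sectionD(3)[OF star_section_max]], rule ccontr)
  note S = star_sectionD[OF star_section_max] and sD = graph_sectionD[OF star_sectionD(1)[OF star_section_max]]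
  assume "\<not> ball 0 r \<subseteq> max_domain"
  then obtain v0 where "v0 \<in> ball 0 r" "v0 \<notin> max_domain"
    by blast
  then have v0: "norm v0 < r" "v0 \<notin> max_domain"
    by simp_all
  \<comment> \<open>The exit parameters on the ray to \<open>v0\<close>. The set is closed because
    \<open>max_domain\<close> is open, so there is a first exit point \<open>v\<close>, with the
    whole ray before it inside the domain.\<close>
  define E where "E = {0..1} \<inter> (\<lambda>t. t *\<^sub>R v0) -` (- max_domain)"
  have "closed E"
    unfolding E_def using sD(1) by (intro closed_Int closed_vimage continuous_intros) auto
  moreover have "1 \<in> E"
    using v0(2) by (simp add: E_def)
  moreover have bdd: "bdd_below E"
    by (rule bdd_belowI[of _ 0]) (simp add: E_def)
  ultimately have T: "Inf E \<in> E"
    by (intro closed_contains_Inf) auto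
  define v where "v = Inf E *\<^sub>R v0"
  have vW: "v \<notin> max_domain" and T01: "0 \<le> Inf E" "Inf E \<le> 1"
    using T by (auto simp: E_def v_def)
  have T0: "Inf E > 0"
    using vW S(2) T01(1) by (cases "Inf E = 0") (auto simp: v_def)
  have "norm v \<le> 1 * norm v0"
    unfolding v_def norm_scaleR using T01 by (intro mult_right_mono) auto
  then have vr: "norm v < r"
    using v0(1) by simp
  have ray: "t *\<^sub>R v \<in> max_domain" if t: "0 \<le> t" "t < 1" for t
  proof (rule ccontr)
    assume "t *\<^sub>R v \<notin> max_domain"
    moreover have "t * Inf E \<le> 1 * 1"
      using t T01 by (intro mult_mono) auto
    ultimately have "t * Inf E \<in> E"
      using t T01 by (simp add: E_def v_def)
    from cInf_lower[OF this bdd] show False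
      using mult_strict_right_mono[OF t(2) T0] by simp
  qed
  \<comment> \<open>This is 1 - 1/(n + 2). The shift by 2 makes already \<open>t 0\<close> positive,
    since \<open>v\<close> is recovered below as 1 / \<open>t n\<close> times the point
    \<open>w\<close>.\<close>
  define t where "t n = 1 + - inverse (real (Suc (Suc n)))" for n :: nat
  have t: "0 < t n" "t n < 1" for n
    by (auto simp: t_def field_simps)
  have tlim: "t \<longlonglongrightarrow> 1"
    unfolding t_def by (rule LIMSEQ_Suc[OF LIMSEQ_inverse_real_of_nat_add_minus])
  define p where "p n = max_section (t n *\<^sub>R v)" for n
  have pt: "p n \<in> topspace L" "shadow (p n) = t n *\<^sub>R v" "graphical (3/2) (p n)" for n
  proof -
    have *: "t n *\<^sub>R v \<in> max_domain"
      using t[of n] by (intro ray) auto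
    show "p n \<in> topspace L" "shadow (p n) = t n *\<^sub>R v" "graphical (3/2) (p n)"
      unfolding p_def using sD(5)[OF *] sD(3)[OF *] star_section_graphical[OF star_section_max *] .
  qed
  have dist_le: "induced_dist L A g (p m) (p n) \<le> 2 * norm v * dist (t m) (t n)" for m n
    unfolding p_def
  proof (rule induced_dist_segment_le[OF section_smooth_param[OF S(1)]])
    show seg: "closed_segment (t m *\<^sub>R v) (t n *\<^sub>R v) \<subseteq> max_domain"
    proof
      fix z assume "z \<in> closed_segment (t m *\<^sub>R v) (t n *\<^sub>R v)"
      then obtain a where a: "0 \<le> a" "a \<le> 1" "z = (1 - a) *\<^sub>R (t m *\<^sub>R v) + a *\<^sub>R (t n *\<^sub>R v)"
        unfolding closed_segment_def by blast
      have "z = ((1 - a) * t m + a * t n) *\<^sub>R v"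
        unfolding a(3) by (simp add: scaleR_add_left)
      moreover have "0 \<le> (1 - a) * t m + a * t n"
        using a t[of m] t[of n] by simp
      moreover have "(1 - a) * t m + a * t n < 1"
        using a t[of m] t[of n] by (intro convex_bound_lt) auto
      ultimately show "z \<in> max_domain"
        using ray by simp
    qed
    fix z assume "z \<in> closed_segment (t m *\<^sub>R v) (t n *\<^sub>R v)"
    then have "z \<in> max_domain"
      using seg by (rule rev_subsetD)
    from section_derivative_props(3)[OF S(1) this, of "t n *\<^sub>R v - t m *\<^sub>R v"]
    show "norm (frechet_derivative (g \<circ> max_section) (at z) (t n *\<^sub>R v - t m *\<^sub>R v)) \<le> 2 * norm v * dist (t m) (t n)"
      by (simp add: scaleR_diff_left[symmetric] dist_real_def abs_minus_commute ac_simps)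
  qed
  have "\<exists>N. \<forall>m\<ge>N. \<forall>n\<ge>N. induced_dist L A g (p m) (p n) < \<epsilon>" if "\<epsilon> > 0" for \<epsilon>
  proof -
    \<comment> \<open>The summand 1 keeps the denominator positive without a case distinction on
      \<open>v\<close>.\<close>
    have "\<epsilon> / (2 * norm v + 1) > 0"
      using that by (simp add: add_nonneg_pos)
    then obtain N where N: "\<And>m n. m \<ge> N \<Longrightarrow> n \<ge> N \<Longrightarrow> dist (t m) (t n) < \<epsilon> / (2 * norm v + 1)"
      using metric_CauchyD[OF LIMSEQ_imp_Cauchy[OF tlim]] by meson
    have "induced_dist L A g (p m) (p n) < \<epsilon>" if "m \<ge> N" "n \<ge> N" for m n
    proof -
      have "2 * norm v * dist (t m) (t n) \<le> (2 * norm v + 1) * dist (t m) (t n)"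
        by (intro mult_right_mono) auto
      also have "\<dots> < \<epsilon>"
        using pos_less_divide_eq[of "2 * norm v + 1", THEN iffD1, OF _ N[OF that]]
        by (simp add: add_nonneg_pos mult.commute)
      finally show ?thesis
        using dist_le[of m n] by simp
    qed
    then show ?thesis
      by (intro exI[of _ N]) simp
  qed
  moreover have rp: "range p \<subseteq> topspace L"
    using pt(1) by (rule image_subsetI)
  ultimately have "\<exists>p'\<in>topspace L. (\<lambda>n. induced_dist L A g (p n) p') \<longlonglongrightarrow> 0"
    using complete unfolding complete_surface_def by simp
  then obtain p' where p': "p' \<in> topspace L" "(\<lambda>n. induced_dist L A g (p n) p') \<longlonglongrightarrow> 0"
    by (elim bexE) (rule that)
  have lim: "limitin L p p' sequentially"
    by (rule induced_dist_imp_limitin[OF p'(1) rp p'(2)])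
  have gr: "graphical (3/2) p'"
    by (rule graphical_limit[OF lim pt(3,1)])
  have "(\<lambda>n. t n *\<^sub>R v) \<longlonglongrightarrow> shadow p'"
    using continuous_map_limit[OF continuous_map_shadow lim] pt(2) by (simp add: limitin_canonical_iff o_def)
  moreover have "(\<lambda>n. t n *\<^sub>R v) \<longlonglongrightarrow> 1 *\<^sub>R v"
    by (intro tendsto_intros tlim)
  ultimately have sp': "shadow p' = v"
    using LIMSEQ_unique by fastforce
  obtain \<rho> V \<sigma> where \<sigma>: "\<rho> > 0" "graph_section (ball (shadow p') \<rho>) \<sigma>" "\<sigma> (shadow p') = p'"
    "openin L V" "p' \<in> V" "\<And>r. r \<in> V \<Longrightarrow> shadow r \<in> ball (shadow p') \<rho> \<and> \<sigma> (shadow r) = r"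
    by (rule local_section[OF p'(1) gr]) (rule that)
  let ?B = "ball v \<rho>"
  have \<sigma>B: "graph_section ?B \<sigma>"
    using \<sigma>(2) sp' by simp
  have "\<forall>\<^sub>F n in sequentially. p n \<in> V"
    using conjunct2[OF lim[unfolded limitin_def], rule_format, OF conjI[OF \<sigma>(4,5)]] .
  then obtain n where n: "p n \<in> V"
    using eventually_happens trivial_limit_sequentially by blast
  define w where "w = t n *\<^sub>R v"
  have w: "w \<in> max_domain" "w \<in> ?B" "max_section w = \<sigma> w"
    using ray[of "t n"] t[of n] \<sigma>(6)[OF n] pt(2)[of n] sp' by (auto simp: w_def p_def)
  have "open (max_domain \<inter> ?B)"
    using sD(1) by blast
  then obtain \<delta> where \<delta>: "\<delta> > 0" "ball w \<delta> \<subseteq> max_domain \<inter> ?B"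
    using w open_contains_ball by blast
  have near_w: "max_section y = \<sigma> y" if "y \<in> ball w \<delta>" for y
    by (rule sections_agree[OF S(1) \<sigma>B connected_ball _ _ _ w(3) that]) (use \<delta> in auto)
  \<comment> \<open>Adding the whole disc \<open>?B\<close> could destroy star-shapedness and would
    leave agreement on the overlap open. Only outward multiples of points near \<open>w\<close> are
    added: each is joined inside \<open>?B\<close> to a point near \<open>w\<close>, where both
    sections agree, and from there to 0 inside \<open>max_domain\<close>.\<close>
  define Z where "Z = (\<Union>l\<in>{1..}. (\<lambda>z. l *\<^sub>R z) ` ball w \<delta>) \<inter> ?B \<inter> ball 0 r"
  have opZ: "open Z"
    unfolding Z_def by (intro open_Int open_UN ballI open_scaling open_ball) auto
  have ZE: "\<exists>l y. 1 \<le> l \<and> y \<in> ball w \<delta> \<and> z = l *\<^sub>R y" if "z \<in> Z" for z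
    using that unfolding Z_def by auto
  have Z_agree: "max_section z = \<sigma> z" if z: "z \<in> Z" "z \<in> max_domain" for z
  proof -
    obtain l y where l: "1 \<le> l" "y \<in> ball w \<delta>" "z = l *\<^sub>R y"
      using ZE[OF z(1)] by (elim exE conjE) (rule that)
    have y: "y \<in> max_domain" "y \<in> ?B"
      using subsetD[OF \<delta>(2) l(2)] by auto
    show ?thesis
    proof (rule sections_agree[OF S(1) \<sigma>B connected_segment(1)[of y z] _ _ _ near_w[OF l(2)]])
      show "closed_segment y z \<subseteq> max_domain"
      proof
        fix u assume "u \<in> closed_segment y z"
        then obtain a where a: "0 \<le> a" "a \<le> 1" "u = (1 - a) *\<^sub>R y + a *\<^sub>R z"
          unfolding closed_segment_def by blast
        \<comment> \<open>As z = l y, the point \<open>u\<close> is ((1 - a) + a l) y and hence this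
          multiple of \<open>z\<close>; so it lies on the segment from 0 to
          \<open>z\<close>.\<close>
        let ?b = "((1 - a) + a * l) / l"
        have "(1 - a) * 1 \<le> (1 - a) * l"
          using a l by (intro mult_left_mono) auto
        then have num: "(1 - a) + a * l \<le> l"
          by (simp add: algebra_simps)
        have "0 \<le> (1 - a) + a * l"
          using a(1,2) l(1) by (intro add_nonneg_nonneg mult_nonneg_nonneg) auto
        then have "0 \<le> ?b" "?b \<le> 1"
          using l(1) num by (auto intro: divide_nonneg_nonneg simp: divide_le_eq_1)
        moreover have "u = (1 - ?b) *\<^sub>R 0 + ?b *\<^sub>R z"
          unfolding a(3) l(3) using l(1) by (simp add: scaleR_add_left)
        ultimately have "u \<in> closed_segment 0 z"
          unfolding closed_segment_def by blast
        then show "u \<in> max_domain"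
          using S(5)[OF z(2)] by (rule rev_subsetD)
      qed
      show "closed_segment y z \<subseteq> ?B"
        by (rule closed_segment_subset[OF y(2) _ convex_ball]) (use z(1) in \<open>simp add: Z_def\<close>)
    qed auto
  qed
  define s' where "s' z = (if z \<in> max_domain then max_section z else \<sigma> z)" for z
  have ZB: "Z \<subseteq> ?B"
    by (auto simp: Z_def)
  have "graph_section (max_domain \<union> Z) s'"
  proof (rule graph_section_Un)
    show "open (max_domain \<union> Z)"
      using sD(1) opZ by (rule open_Un)
    fix u assume u: "u \<in> max_domain \<union> Z"
    show "\<exists>W' s''. graph_section W' s'' \<and> u \<in> W' \<and> W' \<subseteq> max_domain \<union> Z \<and> (\<forall>z\<in>W'. s' z = s'' z)"
    proof (cases "u \<in> max_domain")
      case True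
      then show ?thesis
        using S(1) by (intro exI[of _ max_domain] exI[of _ max_section]) (simp add: s'_def)
    next
      case False
      have "s' z = \<sigma> z" if "z \<in> Z" for z
        using Z_agree[OF that] by (simp add: s'_def)
      then show ?thesis
        using graph_section_subset[OF \<sigma>B opZ ZB] u False
        by (intro exI[of _ Z] exI[of _ \<sigma>]) simp
    qed
  qed
  moreover have "closed_segment 0 u \<subseteq> max_domain \<union> Z" if u: "u \<in> max_domain \<union> Z" for u
  proof (cases "u \<in> max_domain")
    case True
    then show ?thesis
      using S(5) by blast
  next
    case False
    then have uZ: "u \<in> Z"
      using u by blast
    obtain l y where l: "1 \<le> l" "y \<in> ball w \<delta>" "u = l *\<^sub>R y"
      using ZE[OF uZ] by (elim exE conjE) (rule that)
    have y: "y \<in> max_domain" "y \<in> ?B"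
      using subsetD[OF \<delta>(2) l(2)] by auto
    show ?thesis
    proof
      fix z assume "z \<in> closed_segment 0 u"
      then obtain b where b: "0 \<le> b" "b \<le> 1" "z = b *\<^sub>R u"
        unfolding closed_segment_def by auto
      \<comment> \<open>Here z = b l y. Up to \<open>y\<close>, that is for b l at most 1, it lies
        on a segment of the old domain; beyond \<open>y\<close> it is an outward multiple of
        \<open>y\<close> and belongs to \<open>Z\<close>.\<close>
      show "z \<in> max_domain \<union> Z"
      proof (cases "b * l \<le> 1")
        case True
        have "z = (1 - b * l) *\<^sub>R 0 + (b * l) *\<^sub>R y"
          by (simp add: b(3) l(3))
        moreover have "0 \<le> b * l"
          using b l by simp
        ultimately have "z \<in> closed_segment 0 y"
          unfolding closed_segment_def using True by blast
        then show ?thesis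
          using S(5)[OF y(1)] by blast
      next
        case False
        have "l > 1"
        proof (rule ccontr)
          assume "\<not> l > 1"
          then have "b * l \<le> 1 * 1"
            using b l by (intro mult_mono) auto
          then show False
            using False by simp
        qed
        \<comment> \<open>The solution of (1 - a) + a l = b l, which places \<open>z\<close> between
          \<open>y\<close> and \<open>u\<close>.\<close>
        let ?a = "(b * l - 1) / (l - 1)"
        have a: "0 \<le> ?a" "?a \<le> 1"
          using False \<open>l > 1\<close> b mult_right_mono[of b 1 l] by (auto simp: field_simps)
        have "(1 - x) + x * l = 1 + x * (l - 1)" for x
          by (simp add: algebra_simps)
        then have "(1 - ?a) + ?a * l = 1 + ?a * (l - 1)"
          .
        also have "\<dots> = b * l"
          using \<open>l > 1\<close> by simp
        finally have eq: "(1 - ?a) + ?a * l = b * l" .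
        have "(1 - ?a) *\<^sub>R y + ?a *\<^sub>R u = ((1 - ?a) + ?a * l) *\<^sub>R y"
          by (simp only: l(3) scaleR_add_left scaleR_scaleR)
        also have "\<dots> = z"
          unfolding eq b(3) l(3) by simp
        finally have "z = (1 - ?a) *\<^sub>R y + ?a *\<^sub>R u"
          by (rule sym)
        then have "z \<in> closed_segment y u"
          unfolding closed_segment_def using a by blast
        moreover have "closed_segment y u \<subseteq> ?B"
          by (rule closed_segment_subset[OF y(2) _ convex_ball]) (use ZB uZ in blast)
        ultimately have "z \<in> ?B"
          by blast
        moreover have "norm z \<le> 1 * norm u"
          unfolding b(3) norm_scaleR using b by (intro mult_right_mono) auto
        moreover have "norm u < r"
          using uZ by (simp add: Z_def)
        moreover have "z \<in> (\<Union>l\<in>{1..}. (\<lambda>z. l *\<^sub>R z) ` ball w \<delta>)"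
        proof (rule UN_I)
          show "b * l \<in> {1..}"
            using False by simp
          show "z \<in> (\<lambda>z. (b * l) *\<^sub>R z) ` ball w \<delta>"
            by (rule image_eqI[OF _ l(2)]) (simp add: b(3) l(3))
        qed
        ultimately have "z \<in> Z"
          by (simp add: Z_def)
        then show ?thesis
          by blast
      qed
    qed
  qed
  moreover have "max_domain \<union> Z \<subseteq> ball 0 r"
    using S(3) by (auto simp: Z_def)
  ultimately have "star_section (max_domain \<union> Z) s'"
    unfolding star_section_def using S(2,4) by (simp add: s'_def)
  from max_domain_upper[OF this] have "Z \<subseteq> max_domain"
    by blast
  moreover have "v \<in> Z"
    unfolding Z_def
  proof (intro IntI UN_I)
    show "1 / t n \<in> {1..}"
      using t[of n] by simp
    show "v \<in> (\<lambda>z. (1 / t n) *\<^sub>R z) ` ball w \<delta>"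
      by (rule image_eqI[of _ _ w]) (use t[of n] \<delta>(1) in \<open>simp_all add: w_def\<close>)
    show "v \<in> ?B" "v \<in> ball 0 r"
      using \<sigma>(1) vr by simp_all
  qed
  ultimately show False
    using vW by blast
qed

lemma exists_disc_section: "\<exists>s. graph_section (ball 0 r) s \<and> s 0 = q"
  using star_sectionD(1,4)[OF star_section_max] unfolding max_domain_eq by blast

text \<open>The maximum over the closed disc exists by compactness. Comparing it with the value at
  the centre gives theta |g p - g q|^2 <= M - g q . e < theta d^2, so the maximum is at distance
  less than d from g q; projecting, its base point is interior to the disc.\<close>

lemma exists_interior_max:
  assumes d: "0 < d" "d < r" and \<theta>: "\<theta> > 0"
    and M: "\<And>p. p \<in> topspace L \<Longrightarrow> g p \<bullet> e \<le> M" "M - g q \<bullet> e < \<theta> * d\<^sup>2"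
  obtains U x p S' where "(U, x) \<in> A" "p \<in> U" "open S'" "S' \<subseteq> x ` U" "x p \<in> S'" "norm (g p - g q) < d"
    "\<And>u. u \<in> S' \<Longrightarrow> local_rep g (U, x) u \<bullet> e - \<theta> * (norm (local_rep g (U, x) u - g q))\<^sup>2
        \<le> g p \<bullet> e - \<theta> * (norm (g p - g q))\<^sup>2"
proof -
  obtain s where s: "graph_section (ball 0 r) s" "s 0 = q"
    using exists_disc_section by (elim exE conjE) (rule that)
  note sD = graph_sectionD[OF s(1)]
  let ?\<Phi> = "\<lambda>p. g p \<bullet> e - \<theta> * (norm (g p - g q))\<^sup>2"
  have sub: "cball 0 d \<subseteq> ball 0 r" "ball 0 d \<subseteq> cball (0 :: real^2) d"
    using d by auto
  have "continuous_on (ball 0 r) (g \<circ> s)"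
    by (rule continuous_at_imp_continuous_on)
      (rule ballI, rule differentiable_imp_continuous_within, rule smooth_param_differentiable[OF section_smooth_param[OF s(1)]])
  then have "continuous_on (cball 0 d) (g \<circ> s)"
    by (rule continuous_on_subset[OF _ sub(1)])
  then have "continuous_on (cball 0 d) (\<lambda>v. ?\<Phi> (s v))"
    unfolding o_def by (intro continuous_intros)
  moreover have "cball (0 :: real^2) d \<noteq> {}"
    using d by simp
  ultimately obtain v where v: "v \<in> cball 0 d" "\<forall>z\<in>cball 0 d. ?\<Phi> (s z) \<le> ?\<Phi> (s v)"
    using continuous_attains_sup[OF compact_cball, of 0 d "\<lambda>v. ?\<Phi> (s v)"] by blast
  have vr: "v \<in> ball 0 r"
    using v(1) sub(1) by blast
  have "?\<Phi> (s 0) \<le> ?\<Phi> (s v)"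
    using v(2) d by simp
  then have "g q \<bullet> e \<le> M - \<theta> * (norm (g (s v) - g q))\<^sup>2"
    using M(1)[OF sD(5)[OF vr]] s(2) by simp
  then have "\<theta> * (norm (g (s v) - g q))\<^sup>2 < \<theta> * d\<^sup>2"
    using M(2) by linarith
  then have "(norm (g (s v) - g q))\<^sup>2 < d\<^sup>2"
    using \<theta> by simp
  then have nd: "norm (g (s v) - g q) < d"
    using d by (simp add: power_less_imp_less_base)
  have "norm v = norm (\<pi> (g (s v) - g q))"
    using sD(3)[OF vr] by (simp add: shadow_def)
  also have "\<dots> < d"
    using norm_proj nd by (rule le_less_trans)
  finally have vd: "v \<in> ball 0 d"
    by simp
  obtain U x where U: "(U, x) \<in> A" "s v \<in> U"
    using sD(5)[OF vr] by (rule exists_chart)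
  obtain V B \<sigma> where V: "openin L V" "s v \<in> V" "V \<subseteq> U" "open B" "shadow (s v) \<in> B"
    and "continuous_map (top_of_set B) L \<sigma>" "\<And>b. b \<in> B \<Longrightarrow> \<sigma> b \<in> V \<and> shadow (\<sigma> b) = b"
    and \<sigma>: "\<And>r. r \<in> V \<Longrightarrow> shadow r \<in> B \<and> \<sigma> (shadow r) = r" "\<And>b. b \<in> B \<Longrightarrow> (x \<circ> \<sigma>) differentiable (at b)"
    by (rule local_inverse[OF U sD(4)[OF vr]]) (rule that)
  \<comment> \<open>The maximum compares only points of the graph, so the chart neighbourhood must
    lie on it. If a point of \<open>V\<close> and the point of the graph above the same base point
    are both in \<open>V\<close>, they coincide, because \<open>shadow\<close> is injective on
    \<open>V\<close>.\<close>
  let ?O = "ball 0 d \<inter> {z \<in> ball 0 r. s z \<in> V}"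
  have "open ?O"
    using smooth_param_openin[OF sD(2,1) V(1)] by blast
  then have V1: "openin L {p \<in> V. shadow p \<in> ?O}"
    by (rule openin_shadow_preimage[OF V(1)])
  let ?S = "x ` {p \<in> V. shadow p \<in> ?O}"
  show thesis
  proof (rule that[OF U])
    show "open ?S"
      by (rule open_chart_image[OF U(1) V1]) (use V(3) in blast)
    show "?S \<subseteq> x ` U"
      using V(3) by blast
    show "x (s v) \<in> ?S"
      using V(2) vd vr sD(3)[OF vr] by (intro imageI) simp
    show "norm (g (s v) - g q) < d"
      by (rule nd)
    fix u assume "u \<in> ?S"
    then obtain p where p: "u = x p" "p \<in> V" "shadow p \<in> ball 0 d" "shadow p \<in> ball 0 r" "s (shadow p) \<in> V"
      by blast
    have "s (shadow p) = \<sigma> (shadow (s (shadow p)))"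
      using \<sigma>(1)[OF p(5)] by simp
    also have "\<dots> = \<sigma> (shadow p)"
      using sD(3)[OF p(4)] by simp
    also have "\<dots> = p"
      using \<sigma>(1)[OF p(2)] by simp
    finally have sp: "s (shadow p) = p" .
    have "shadow p \<in> cball 0 d"
      using p(3) sub(2) by blast
    from bspec[OF v(2) this] have "?\<Phi> p \<le> ?\<Phi> (s v)"
      unfolding sp .
    moreover have "local_rep g (U, x) u = g p"
      using p(1,2) V(3) U(1) by auto
    ultimately show "local_rep g (U, x) u \<bullet> e - \<theta> * (norm (local_rep g (U, x) u - g q))\<^sup>2 \<le> ?\<Phi> (s v)"
      by simp
  qed
qed

end

section \<open>The height function on a slab\<close>

context immersed_patch
begin

lemma norm_normal_part_le:
  assumes "u \<in> S"
  shows "norm (normal_part f u v) \<le> norm v"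
proof -
  let ?N = "normal_part f u v"
  have "?N \<bullet> (v - ?N) = 0"
    unfolding normal_part_eq[OF assms, of v, THEN arg_cong, of "\<lambda>N. v - N"]
    by (simp add: inner_simps normal_part_inner_pdiff[OF assms])
  then have "norm ?N * norm ?N = ?N \<bullet> v"
    by (simp add: inner_diff_right dot_square_norm power2_eq_square)
  also have "\<dots> \<le> norm ?N * norm v"
    by (rule norm_cauchy_schwarz)
  finally show ?thesis
    by (cases "?N = 0") simp_all
qed

text \<open>Gram-Schmidt turns the coordinate vectors into an orthonormal basis E1, E2 of the
  tangent plane, and the map takes inner products with it. That it is contracting is Bessel's
  inequality.\<close>

lemma exists_isometric_projection:
  assumes u: "u \<in> S"
  obtains \<pi> :: "'b \<Rightarrow> real^2" where "linear \<pi>" "\<And>y. norm (\<pi> y) \<le> norm y"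
    "\<And>\<tau>. \<tau> \<in> tangent_plane f u \<Longrightarrow> norm (\<pi> \<tau>) = norm \<tau>"
proof -
  let ?a = "pdiff 1 f u" and ?b = "pdiff 2 f u"
  define E1 where "E1 = (1 / norm ?a) *\<^sub>R ?a"
  define b' where "b' = ?b - (?b \<bullet> E1) *\<^sub>R E1"
  define E2 where "E2 = (1 / norm b') *\<^sub>R b'"
  note ne = tangent_combination_nonzero[OF u]
  have a0: "?a \<noteq> 0"
    using ne[of 1 0] by simp
  have "b' = (- (?b \<bullet> E1) / norm ?a) *\<^sub>R ?a + 1 *\<^sub>R ?b"
    by (simp add: b'_def E1_def)
  then have b0: "b' \<noteq> 0"
    using ne[of "- (?b \<bullet> E1) / norm ?a" 1] by simp
  have E11: "E1 \<bullet> E1 = 1"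
    using a0 by (simp add: E1_def dot_square_norm power2_eq_square)
  have E22: "E2 \<bullet> E2 = 1"
    using b0 by (simp add: E2_def dot_square_norm power2_eq_square)
  have "b' \<bullet> E1 = 0"
    by (simp add: b'_def inner_diff_left E11)
  then have E21: "E2 \<bullet> E1 = 0"
    by (simp add: E2_def)
  then have E12: "E1 \<bullet> E2 = 0"
    by (simp add: inner_commute)
  have "norm b' *\<^sub>R E2 = b'"
    using b0 by (simp add: E2_def)
  then have b: "?b = (?b \<bullet> E1) *\<^sub>R E1 + norm b' *\<^sub>R E2"
    by (simp add: b'_def)
  define \<pi> where "\<pi> y = (vector [y \<bullet> E1, y \<bullet> E2] :: real^2)" for y
  have n\<pi>: "(norm (\<pi> y))\<^sup>2 = (y \<bullet> E1)\<^sup>2 + (y \<bullet> E2)\<^sup>2" for y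
    unfolding power2_norm_eq_inner inner_vec_def sum_2 \<pi>_def by (simp add: power2_eq_square)
  show thesis
  proof (rule that[of \<pi>])
    show "linear \<pi>"
      by (rule linearI) (simp_all add: \<pi>_def vec_eq_iff forall_2 inner_add_left)
    show "norm (\<pi> y) \<le> norm y" for y
    proof -
      let ?R = "y - (y \<bullet> E1) *\<^sub>R E1 - (y \<bullet> E2) *\<^sub>R E2"
      have "?R \<bullet> ?R = y \<bullet> y - (y \<bullet> E1)\<^sup>2 - (y \<bullet> E2)\<^sup>2"
        by (simp add: inner_simps E11 E22 E12 E21 inner_commute[of E1 y] inner_commute[of E2 y] power2_eq_square)
      moreover have "?R \<bullet> ?R \<ge> 0"
        by (rule inner_ge_zero)
      ultimately have "(norm (\<pi> y))\<^sup>2 \<le> (norm y)\<^sup>2"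
        unfolding n\<pi> by (simp add: power2_norm_eq_inner)
      then show ?thesis
        by (rule power2_le_imp_le) simp
    qed
    fix \<tau> assume "\<tau> \<in> tangent_plane f u"
    then obtain w :: "real^2" where w: "\<tau> = w$1 *\<^sub>R ?a + w$2 *\<^sub>R ?b"
      unfolding tangent_plane_eq[OF u] by (elim rangeE) (rule that)
    have wa: "w$1 *\<^sub>R ?a = (w$1 * norm ?a) *\<^sub>R E1"
      using a0 by (simp add: E1_def)
    have wb: "w$2 *\<^sub>R ?b = (w$2 * (?b \<bullet> E1)) *\<^sub>R E1 + (w$2 * norm b') *\<^sub>R E2"
      using arg_cong[OF b, of "\<lambda>z. w$2 *\<^sub>R z"] by (simp only: scaleR_add_right scaleR_scaleR)
    obtain x y where \<tau>: "\<tau> = x *\<^sub>R E1 + y *\<^sub>R E2"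
      by (rule that[of "w$1 * norm ?a + w$2 * (?b \<bullet> E1)" "w$2 * norm b'"])
        (simp only: w wa wb scaleR_add_left add.assoc)
    have "(norm (\<pi> \<tau>))\<^sup>2 = (norm \<tau>)\<^sup>2"
      unfolding n\<pi> unfolding power2_norm_eq_inner
      by (simp add: \<tau> inner_simps E11 E22 E12 E21 power2_eq_square)
    then show "norm (\<pi> \<tau>) = norm \<tau>"
      by simp
  qed
qed

end

lemma (in immersed_surface) second_form_leI:
  assumes "\<And>U x w1 w2 z1 z2. (U, x) \<in> A \<Longrightarrow> p \<in> U \<Longrightarrow>
     norm (second_form (local_rep g (U, x)) (x p) w1 w2 z1 z2)
     \<le> C * norm (tangent_combination (local_rep g (U, x)) (x p) w1 w2)
        * norm (tangent_combination (local_rep g (U, x)) (x p) z1 z2)"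
  shows "second_form_le C p"
  unfolding second_form_le_def
  by (rule ballI, simp only: split_paired_all prod.case, intro allI impI, rule assms)

lemma no_complete_singular_minimal_surface_in_slab:
  fixes e :: "'b::euclidean_space" and g :: "'a \<Rightarrow> 'b"
  assumes \<alpha>: "\<alpha> \<ge> 1" and e: "norm e = 1"
    and sms: "singular_minimal_surface \<alpha> e L A g"
    and complete: "complete_surface L A g"
    and curv: "curvature_bounded_below A g"
    and slab: "between_hyperplanes_perpendicular_to e (g ` topspace L)"
  shows False
proof -
  interpret immersed_surface L A g
    using sms unfolding singular_minimal_surface_def by unfold_locales auto
  have pos: "g p \<bullet> e > 0" if "p \<in> topspace L" for p
    using sms that unfolding singular_minimal_surface_def by blast
  have H: "2 *\<^sub>R mean_curvature (local_rep g (U, x)) (x p) = (\<alpha> / (g p \<bullet> e)) *\<^sub>R normal_part (local_rep g (U, x)) (x p) e"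
    if "(U, x) \<in> A" "p \<in> U" for U x p
  proof -
    have *: "\<forall>(U, x)\<in>A. \<forall>u\<in>x ` U. 2 *\<^sub>R mean_curvature (local_rep g (U, x)) u =
          (\<alpha> / (local_rep g (U, x) u \<bullet> e)) *\<^sub>R normal_part (local_rep g (U, x)) u e"
      using sms unfolding singular_minimal_surface_def by blast
    show ?thesis
      using bspec[OF bspec[OF * that(1), unfolded prod.case] imageI[OF that(2)]] that by simp
  qed
  obtain \<kappa> where \<kappa>: "\<forall>(U, x)\<in>A. \<forall>u\<in>x ` U. \<kappa> \<le> gaussian_curvature (induced_metric (local_rep g (U, x))) u"
    using curv unfolding curvature_bounded_below_def by (elim exE) (rule that)
  have K: "\<kappa> \<le> gaussian_curvature (induced_metric (local_rep g (U, x))) (x p)" if "(U, x) \<in> A" "p \<in> U" for U x p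
    using bspec[OF bspec[OF \<kappa> that(1), unfolded prod.case] imageI[OF that(2)]] .
  obtain b where b: "\<And>p. p \<in> topspace L \<Longrightarrow> g p \<bullet> e \<le> b"
    using slab unfolding between_hyperplanes_perpendicular_to_def by blast
  have ne: "topspace L \<noteq> {}"
    using surface unfolding smooth_surface_def by blast
  define M where "M = (SUP p\<in>topspace L. g p \<bullet> e)"
  have bdd: "bdd_above ((\<lambda>p. g p \<bullet> e) ` topspace L)"
    using b by (intro bdd_aboveI2)
  have M: "g p \<bullet> e \<le> M" if "p \<in> topspace L" for p
    unfolding M_def by (rule cSUP_upper[OF that bdd])
  have M0: "M > 0"
  proof -
    obtain p where "p \<in> topspace L"
      using ne by blast
    then show ?thesis
      using pos[of p] M[of p] by simp
  qed
  \<comment> \<open>On the part of the surface under consideration the height is at least M/2, so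
    this bounds the factor alpha / phi in the equation for the mean curvature.\<close>
  define c where "c = 2 * \<alpha> / M"
  define C where "C = sqrt (c\<^sup>2 + 2 * \<bar>\<kappa>\<bar>)"
  have C: "C \<ge> 0" "C\<^sup>2 \<ge> c\<^sup>2 - 2 * \<kappa>"
    by (simp_all add: C_def)
  \<comment> \<open>Points within 2 r <= M/4 of g q, where the height of \<open>q\<close> exceeds 3
    M/4, have height at least M/2. The second bound gives 24 C r <= 1; there C + 1 avoids division
    by zero.\<close>
  define r where "r = min (M / 8) (1 / (24 * (C + 1)))"
  have r: "r > 0" "r \<le> M / 8"
    using M0 C(1) by (simp_all add: r_def)
  have "24 * C * r \<le> 24 * (C + 1) * (1 / (24 * (C + 1)))"
    using C(1) r(1) by (intro mult_mono) (auto simp: r_def)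
  also have "\<dots> = 1"
    using C(1) by simp
  finally have Cr: "24 * C * r \<le> 1" .
  \<comment> \<open>With d = r/2 the first bound gives 2 theta d <= 1/4, the value of rho below. The
    second gives 4 theta <= 1/(8 M), to be contradicted at the end.\<close>
  define \<theta> where "\<theta> = min (1 / (4 * r)) (1 / (32 * M))"
  have \<theta>: "\<theta> > 0" "\<theta> \<le> 1 / (4 * r)" "\<theta> \<le> 1 / (32 * M)"
    using r M0 by (simp_all add: \<theta>_def)
  define d where "d = r / 2"
  have d: "0 < d" "d < r"
    using r by (simp_all add: d_def)
  have "min (M / 4) (\<theta> * d\<^sup>2) > 0"
    using M0 \<theta>(1) d(1) by simp
  then have "M - min (M / 4) (\<theta> * d\<^sup>2) < M"
    by simp
  then obtain q where q: "q \<in> topspace L" "M - min (M / 4) (\<theta> * d\<^sup>2) < g q \<bullet> e"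
    unfolding M_def using less_cSUP_iff[OF ne bdd] by blast
  obtain U0 x0 where U0: "(U0, x0) \<in> A" "q \<in> U0"
    using q(1) by (rule exists_chart)
  interpret P0: immersed_patch "local_rep g (U0, x0)" "x0 ` U0"
    by (rule immersed_patch_chart[OF U0(1)])
  obtain \<pi> :: "'b \<Rightarrow> real^2" where \<pi>: "linear \<pi>" "\<And>y. norm (\<pi> y) \<le> norm y"
    "\<And>\<tau>. \<tau> \<in> tangent_plane (local_rep g (U0, x0)) (x0 q) \<Longrightarrow> norm (\<pi> \<tau>) = norm \<tau>"
    by (rule P0.exists_isometric_projection[OF imageI[OF U0(2)]]) (rule that)
  have second_form: "second_form_le C p" if p: "p \<in> topspace L" "norm (g p - g q) \<le> 2 * r" for p
  proof (rule second_form_leI)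
    have "\<bar>(g p - g q) \<bullet> e\<bar> \<le> norm (g p - g q) * norm e"
      by (rule Cauchy_Schwarz_ineq2)
    then have "\<bar>g p \<bullet> e - g q \<bullet> e\<bar> \<le> M / 4"
      using p(2) e r(2) by (simp add: inner_diff_left)
    then have \<phi>: "g p \<bullet> e \<ge> M / 2"
      using q(2) by linarith
    have \<phi>c: "\<alpha> / (g p \<bullet> e) \<le> c"
    proof -
      have "\<alpha> / (g p \<bullet> e) \<le> \<alpha> / (M / 2)"
        using \<phi> M0 \<alpha> by (intro divide_left_mono) auto
      then show ?thesis
        by (simp add: c_def mult.commute)
    qed
    fix U x w1 w2 z1 z2
    assume U: "(U, x) \<in> A" "p \<in> U"
    interpret P: immersed_patch "local_rep g (U, x)" "x ` U"
      by (rule immersed_patch_chart[OF U(1)])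
    have "norm (2 *\<^sub>R mean_curvature (local_rep g (U, x)) (x p)) \<le> (\<alpha> / (g p \<bullet> e)) * 1"
      unfolding H[OF U] norm_scaleR
      using P.norm_normal_part_le[OF imageI[OF U(2)], of e] e \<alpha> pos[OF p(1)]
      by (intro mult_mono) auto
    then have "norm (2 *\<^sub>R mean_curvature (local_rep g (U, x)) (x p)) \<le> c"
      using \<phi>c by linarith
    from P.norm_second_fundamental_form_le[OF imageI[OF U(2)] K[OF U] this C]
    show "norm (second_form (local_rep g (U, x)) (x p) w1 w2 z1 z2)
     \<le> C * norm (tangent_combination (local_rep g (U, x)) (x p) w1 w2)
        * norm (tangent_combination (local_rep g (U, x)) (x p) z1 z2)" .
  qed
  interpret T: tame_surface L A g \<pi> q C r
    by unfold_locales
      (use \<pi> q(1) C(1) r(1) Cr second_form complete in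
        \<open>simp_all add: tangent_at_eq[OF U0] linear_add[OF \<pi>(1)] linear_scale[OF \<pi>(1)]\<close>)
  have gap: "M - g q \<bullet> e < \<theta> * d\<^sup>2"
    using q(2) by linarith
  obtain U x p S' where U: "(U, x) \<in> A" "p \<in> U" and S': "open S'" "S' \<subseteq> x ` U" "x p \<in> S'"
    and near: "norm (g p - g q) < d"
    and max: "\<And>u. u \<in> S' \<Longrightarrow> local_rep g (U, x) u \<bullet> e - \<theta> * (norm (local_rep g (U, x) u - g q))\<^sup>2
        \<le> g p \<bullet> e - \<theta> * (norm (g p - g q))\<^sup>2"
    by (rule T.exists_interior_max[OF d \<theta>(1) M gap], assumption, rule that)
  interpret P: immersed_patch "local_rep g (U, x)" "x ` U"
    by (rule immersed_patch_chart[OF U(1)])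
  have p: "p \<in> topspace L"
    using chart_subset[OF U(1)] U(2) by blast
  have gp: "local_rep g (U, x) (x p) = g p"
    by (rule local_rep_chart[OF U])
  have "2 * \<theta> * norm (g p - g q) \<le> 2 * \<theta> * d"
    using near \<theta>(1) by (intro mult_left_mono) auto
  also have "\<dots> \<le> 1 / 4"
    using \<theta>(2) r(1) by (simp add: d_def field_simps)
  finally have "2 * \<theta> * norm (g p - g q) \<le> 1 / 4" .
  \<comment> \<open>The bracket is 11/16 for rho = 1/4. As alpha / phi is at least 1/M, the left
    side is at least 11/(16 M), whereas the right side is at most 1/(8 M).\<close>
  then have "(\<alpha> / (g p \<bullet> e)) * (1 - (1/4)\<^sup>2 - 1/4) \<le> 4 * \<theta>"
    using max pos[OF p] \<alpha> \<theta>(1)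
    by (intro P.penalised_height_max[OF S'(3,1,2) _ _ H[OF U] _ e]) (simp_all add: gp)
  moreover have "1 / M \<le> \<alpha> / (g p \<bullet> e)"
    using \<alpha> pos[OF p] M[OF p] by (intro frac_le) auto
  moreover have "4 * \<theta> \<le> 1 / M / 8"
    using \<theta>(3) by simp
  moreover have "1 / M > 0"
    using M0 by simp
  ultimately show False
    by (simp add: power2_eq_square)
qed

theorem proposition12:
  fixes n p :: nat and e :: "real^'m"
  assumes "n \<ge> 3" and "CARD('m) = p + 2" and "norm e = 1"
  shows "\<not> (\<exists>(L :: 'a topology) A (g :: 'a \<Rightarrow> real^'m).
    singular_minimal_surface (real n - 2) e L A g \<and>
    complete_surface L A g \<and>
    curvature_bounded_below A g \<and>
    between_hyperplanes_perpendicular_to e (g ` topspace L))"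
proof -
  have n: "real n - 2 \<ge> 1"
    using assms(1) by simp
  show ?thesis
  proof (rule notI, elim exE conjE)
    fix L :: "'a topology" and A and g :: "'a \<Rightarrow> real^'m"
    assume "singular_minimal_surface (real n - 2) e L A g" "complete_surface L A g"
      "curvature_bounded_below A g" "between_hyperplanes_perpendicular_to e (g ` topspace L)"
    then show False
      by (rule no_complete_singular_minimal_surface_in_slab[OF n assms(3)])
  qed
qed

end
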